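(* Let $0<s\le 1$, let $u_0\in BV^s(\mathbb{R})$, let $f\in C^1(\mathbb{R},\mathbb{R})$, and let $u$ be the unique entropy solution on $]0,+\infty[_t\times\mathbb{R}_x$ of $$\partial_t u+\partial_x f(u)=0,\qquad u(0,x)=u_0(x).$$ Then $$\forall t>0,\qquad TV^s u(t,\cdot)\{\mathbb{R}\}\le TV^s u_0\{\mathbb{R}\}.$$
   Context: For a nonempty interval $I\subset\mathbb{R}$, a subdivision of $I$ is a finite set $\sigma=\{x_0,x_1,\dots,x_n\}\subset I$ with $x_0<x_1<\dots<x_n$. For $s\in]0,1]$ and $u:I\to\mathbb{R}$, set $TV^su\{\sigma\}=\sum_{i=1}^n|u(x_i)-u(x_{i-1})|^{1/s}$ and $TV^su\{I\}=\sup_\sigma TV^su\{\sigma\}$, the supremum being over all subdivisions $\sigma$ of $I$. $BV^s(I)$ is the set of functions $u:I\to\mathbb{R}$ with $TV^su\{I\}<+\infty$ (such functions are bounded). For a measurable function defined almost everywhere, one sets $TV^su\{I\}=\inf_{v=u\text{ a.e.}}TV^sv\{I\}$. Entropy solution means the usual (Kruzhkov) entropy solution of the scalar conservation law. *)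

theory Defs
  imports "HOL-Analysis.Analysis"
begin

definition subdivisions :: "real set \<Rightarrow> real set set" where
  "subdivisions I = {\<sigma>. finite \<sigma> \<and> \<sigma> \<noteq> {} \<and> \<sigma> \<subseteq> I}"

definition TVs_subdiv :: "real \<Rightarrow> (real \<Rightarrow> real) \<Rightarrow> real set \<Rightarrow> real" where
  "TVs_subdiv s u \<sigma> =
     (let x = (\<lambda>i. sorted_list_of_set \<sigma> ! i)
      in \<Sum>i = 1..card \<sigma> - 1. \<bar>u (x i) - u (x (i - 1))\<bar> powr (1 / s))"

definition TVs :: "real \<Rightarrow> (real \<Rightarrow> real) \<Rightarrow> real set \<Rightarrow> ennreal" where
  "TVs s u I = (SUP \<sigma> \<in> subdivisions I. ennreal (TVs_subdiv s u \<sigma>))"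

definition BVs :: "real \<Rightarrow> real set \<Rightarrow> (real \<Rightarrow> real) set" where
  "BVs s I = {u. TVs s u I < \<infinity>}"

text \<open>The variation of a function that is only defined up to null sets.\<close>

definition ess_TVs :: "real \<Rightarrow> (real \<Rightarrow> real) \<Rightarrow> real set \<Rightarrow> ennreal" where
  "ess_TVs s u I = (INF v \<in> {v. AE x in lebesgue. x \<in> I \<longrightarrow> v x = u x}. TVs s v I)"

lemma ess_TVs_le_TVs: "ess_TVs s u I \<le> TVs s u I"
  unfolding ess_TVs_def by (rule INF_lower) simp

lemma ess_TVs_cong:
  assumes "AE x in lebesgue. x \<in> I \<longrightarrow> u x = w x"
  shows "ess_TVs s u I = ess_TVs s w I"
proof -
  have "(AE x in lebesgue. x \<in> I \<longrightarrow> v x = u x) \<longleftrightarrow> (AE x in lebesgue. x \<in> I \<longrightarrow> v x = w x)" for v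
    using assms by (auto elim: AE_mp)
  then show ?thesis by (simp add: ess_TVs_def)
qed

text \<open>Points of the half plane are pairs (t, x).\<close>

abbreviation half_plane :: "(real \<times> real) set" where
  "half_plane \<equiv> {0<..} \<times> UNIV"

text \<open>Nonnegative test functions of class C1, compactly supported in the open half plane;
  \<open>\<phi>t\<close> and \<open>\<phi>x\<close> are the two partial derivatives of \<open>\<phi>\<close>.\<close>

definition test_function ::
  "(real \<times> real \<Rightarrow> real) \<Rightarrow> (real \<times> real \<Rightarrow> real) \<Rightarrow> (real \<times> real \<Rightarrow> real) \<Rightarrow> bool" where
  "test_function \<phi> \<phi>t \<phi>x \<longleftrightarrow>
     (\<forall>p. (\<phi> has_derivative (\<lambda>(h, k). h * \<phi>t p + k * \<phi>x p)) (at p)) \<and>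
     continuous_on UNIV \<phi>t \<and> continuous_on UNIV \<phi>x \<and>
     (\<forall>p. 0 \<le> \<phi> p) \<and>
     (\<exists>K. compact K \<and> K \<subseteq> half_plane \<and> (\<forall>p. p \<notin> K \<longrightarrow> \<phi> p = 0))"

definition locally_integrable :: "(real \<Rightarrow> real) \<Rightarrow> bool" where
  "locally_integrable w \<longleftrightarrow> (\<forall>r>0. set_integrable lebesgue {-r..r} w)"

definition continuous_L1loc :: "(real \<Rightarrow> real \<Rightarrow> real) \<Rightarrow> bool" where
  "continuous_L1loc u \<longleftrightarrow>
     (\<forall>t\<ge>0. locally_integrable (u t)) \<and>
     (\<forall>t\<ge>0. \<forall>r>0.
        ((\<lambda>\<tau>. LINT x:{-r..r}|lebesgue. \<bar>u \<tau> x - u t x\<bar>) \<longlongrightarrow> 0) (at t within {0..}))"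

text \<open>Kruzhkov entropy solutions of the Cauchy problem with flux \<open>f\<close> and initial datum \<open>u0\<close>,
  taken in their representative that is continuous in time with values in L1loc.
  This representative is what gives a meaning to \<open>u t\<close>, up to null sets in x, for every t,
  and to the initial condition. The values \<open>u t\<close> for negative t are irrelevant.\<close>

definition entropy_solution ::
  "(real \<Rightarrow> real) \<Rightarrow> (real \<Rightarrow> real) \<Rightarrow> (real \<Rightarrow> real \<Rightarrow> real) \<Rightarrow> bool" where
  "entropy_solution f u0 u \<longleftrightarrow>
     (\<lambda>(t, x). u t x) \<in> borel_measurable (lebesgue_on half_plane) \<and>
     (\<exists>M. AE (t, x) in lebesgue_on half_plane. \<bar>u t x\<bar> \<le> M) \<and>
     continuous_L1loc u \<and>
     (AE x in lebesgue. u 0 x = u0 x) \<and>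
     (\<forall>k \<phi> \<phi>t \<phi>x. test_function \<phi> \<phi>t \<phi>x \<longrightarrow>
        0 \<le> (LINT (t, x)|lebesgue_on half_plane.
               \<bar>u t x - k\<bar> * \<phi>t (t, x) + sgn (u t x - k) * (f (u t x) - f k) * \<phi>x (t, x)))"

end

theory Submission
  imports Defs "HOL-Library.Sublist"
begin

text \<open>
  The solution \<open>u\<close> is compared with a piecewise constant front tracking approximation \<open>w\<close>. Where
  \<open>w\<close> equals a constant \<open>k\<close>, Kruzhkov's inequality for \<open>u\<close> with this \<open>k\<close> controls \<open>\<bar>u - w\<bar>\<close>; across
  a front of \<open>w\<close> the boundary terms have the right sign for each single value of \<open>u\<close>, because this
  sign condition is Kruzhkov's entropy condition for the front. Hence no doubling of variables and
  no traces of \<open>u\<close> are needed, and \<open>u\<close> is an \<open>L\<^sup>1\<close> limit of front tracking approximations.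

  The values of \<open>w\<close> stay in a finite grid, and each collision of fronts deletes a value of \<open>w\<close>
  and possibly inserts intermediate ones. Neither operation increases the \<open>1/s\<close>-variation, since \<open>1/s \<ge> 1\<close>
  makes it a convex function of each value, and only finitely many collisions occur. The essential
  variation is lower semicontinuous along the approximations.
\<close>

section \<open>The variation of lists and of step functions\<close>

text \<open>The datum may have infinite total variation, so the ordinary variation of its step
  approximations has no uniform bound. Yet the error of front tracking is a multiple of the
  tolerance \<open>\<omega>\<close>, of this variation and of the elapsed time. This dictates the
  order of choices: sample the datum, then take \<open>\<omega>\<close> small depending on the
  variation of that one sample, then refine the grid. It is also why a collision has to respect the
  variation for exponent 1 and for exponent 1/s at once. Collisions need no quantitative count: the
  number of grid cells crossed by the list of values, followed by the number of fronts, decreases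
  lexicographically. The datum is approximated only locally in L1, and \<open>f\<close> is Lipschitz
  only on bounded sets. Distances are therefore weighted by a cutoff on a backward cone whose slope
  is a Lipschitz constant of \<open>f\<close> on an interval containing all values that are
  compared.\<close>

fun pvar :: "real \<Rightarrow> real list \<Rightarrow> real" where
  "pvar p (a # b # l) = \<bar>b - a\<bar> powr p + pvar p (b # l)"
| "pvar p _ = 0"

text \<open>For \<open>p > 1\<close>, deleting a middle entry of a monotone run can raise
  \<open>pvar\<close>, by superadditivity of the power. Bounding all subsequences gives a quantity
  that is stable under deletion, the discrete form of the supremum over subdivisions.\<close>

definition pvar_le :: "real \<Rightarrow> real \<Rightarrow> real list \<Rightarrow> bool" where
  "pvar_le p C ks \<longleftrightarrow> (\<forall>l. subseq l ks \<longrightarrow> pvar p l \<le> C)"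

lemma pvar_le_self: "pvar_le p C ks \<Longrightarrow> pvar p ks \<le> C"
  by (simp add: pvar_le_def)

lemma pvar_le_subseq: "pvar_le p C ks \<Longrightarrow> subseq ls ks \<Longrightarrow> pvar_le p C ls"
  unfolding pvar_le_def using subseq_order.trans by blast

text \<open>The bound may depend on the list. It serves for \<open>p = 1\<close>, where samples of
  the datum have no uniform bound.\<close>

lemma pvar_le_exists: "\<exists>C. pvar_le p C ks"
proof (intro exI)
  have eq: "{l. subseq l ks} = set (subseqs ks)" by auto
  show "pvar_le p (Max (pvar p ` {l. subseq l ks})) ks"
    unfolding pvar_le_def eq by (auto intro!: Max_ge)
qed

lemma pvar_Cons: "l \<noteq> [] \<Longrightarrow> pvar p (a # l) = \<bar>hd l - a\<bar> powr p + pvar p l"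
  by (cases l) auto

lemma pvar_join: "pvar p (xs @ a # ys) = pvar p (xs @ [a]) + pvar p (a # ys)"
proof (induction xs)
  case (Cons x xs)
  then show ?case by (cases xs) auto
qed simp

lemma pvar_snoc: "xs \<noteq> [] \<Longrightarrow> pvar p (xs @ [a]) = pvar p xs + \<bar>a - last xs\<bar> powr p"
  using pvar_join[of p "butlast xs" "last xs" "[a]"] append_butlast_last_id[of xs]
  by (metis append.assoc append_Cons append_Nil pvar.simps(1) pvar.simps(3) add.right_neutral)

lemma pvar_remdups_adj: "pvar p (remdups_adj l) = pvar p l"
proof (induction l rule: remdups_adj.induct)
  case (3 x y l)
  have "hd (remdups_adj (y # l)) = y" "remdups_adj (y # l) \<noteq> []" by auto
  then show ?case using 3 by (auto simp: pvar_Cons)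
qed auto

section \<open>Convexity of the variation in a single entry\<close>

lemma convex_on_abs_powr:
  fixes a p :: real
  assumes "p \<ge> 1"
  shows "convex_on UNIV (\<lambda>z. \<bar>z - a\<bar> powr p)"
proof (rule convex_onI)
  fix t x y :: real
  assume t: "0 < t" "t < 1"
  \<comment> \<open>Convexity of the power is invoked for two positive arguments. If one argument is
    0, it reduces to this inequality for the weight of the other.\<close>
  have small: "r powr p \<le> r" if "0 < r" "r < 1" for r :: real
    using powr_mono'[of 1 p r] assms that by simp
  have *: "((1 - t) * X + t * Y) powr p \<le> (1 - t) * X powr p + t * Y powr p"
    if XY: "X \<ge> 0" "Y \<ge> 0" for X Y :: real
  proof -
    consider "X = 0" | "Y = 0" | "X > 0 \<and> Y > 0" using XY by linarith
    then show ?thesis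
    proof cases
      case 1
      then show ?thesis using small[of t] t XY by (auto simp: powr_mult mult_right_mono)
    next
      case 2
      then show ?thesis using small[of "1 - t"] t XY by (auto simp: powr_mult mult_right_mono)
    next
      case 3
      then show ?thesis
        using convex_onD[OF powr_convex[OF assms], of t X Y] t by auto
    qed
  qed
  have "\<bar>(1 - t) *\<^sub>R x + t *\<^sub>R y - a\<bar> = \<bar>(1 - t) * (x - a) + t * (y - a)\<bar>"
    by (simp add: algebra_simps)
  also have "\<dots> \<le> (1 - t) * \<bar>x - a\<bar> + t * \<bar>y - a\<bar>"
    using abs_triangle_ineq[of "(1 - t) * (x - a)" "t * (y - a)"] t by (simp add: abs_mult)
  finally have "\<bar>(1 - t) *\<^sub>R x + t *\<^sub>R y - a\<bar> powr p \<le> ((1 - t) * \<bar>x - a\<bar> + t * \<bar>y - a\<bar>) powr p"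
    using assms by (intro powr_mono2) auto
  then show "\<bar>(1 - t) *\<^sub>R x + t *\<^sub>R y - a\<bar> powr p \<le> (1 - t) * \<bar>x - a\<bar> powr p + t * \<bar>y - a\<bar> powr p"
    using *[of "\<bar>x - a\<bar>" "\<bar>y - a\<bar>"] by linarith
qed simp

lemma convex_on_le_max_segment:
  fixes g :: "real \<Rightarrow> real"
  assumes "convex_on UNIV g" "b \<in> closed_segment a c"
  shows "g b \<le> max (g a) (g c)"
proof -
  obtain t where t: "0 \<le> t" "t \<le> 1" "b = (1 - t) *\<^sub>R a + t *\<^sub>R c"
    using assms(2) by (auto simp: closed_segment_def)
  then have "g b \<le> (1 - t) * g a + t * g c"
    using convex_onD[OF assms(1), of t a c] by simp
  also have "\<dots> \<le> (1 - t) * max (g a) (g c) + t * max (g a) (g c)"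
    using t by (intro add_mono mult_left_mono) auto
  finally show ?thesis by (simp add: algebra_simps)
qed

text \<open>The entry \<open>z\<close> occurs only in the increments on its two sides. Splitting the
  list at \<open>z\<close> leaves two functions of \<open>z\<close>, each constant or a power of a
  distance plus a constant.\<close>

lemma convex_on_pvar:
  assumes "p \<ge> 1"
  shows "convex_on UNIV (\<lambda>z. pvar p (l1 @ z # l2))"
proof -
  have 1: "convex_on UNIV (\<lambda>z. pvar p (l1 @ [z]))"
    using convex_on_add[of UNIV "\<lambda>_. pvar p l1", OF _ convex_on_abs_powr[OF assms, of "last l1"]]
    by (cases "l1 = []") (auto simp: pvar_snoc convex_on_const)
  have 2: "convex_on UNIV (\<lambda>z. pvar p (z # l2))"
    using convex_on_add[OF convex_on_abs_powr[OF assms, of "hd l2"], of "\<lambda>_. pvar p l2"]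
    by (cases "l2 = []") (auto simp: pvar_Cons abs_minus_commute convex_on_const)
  show ?thesis
    using convex_on_add[OF 1 2] by (subst pvar_join)
qed

lemma subseq_snocE:
  assumes "subseq l (xs @ [a])"
  obtains "subseq l xs" | l' where "l = l' @ [a]" "subseq l' xs"
  using assms
proof (cases rule: subseq_appendE)
  case (append l1 l2)
  then have "l2 = [] \<or> l2 = [a]"
    using list_emb_length[OF append(3)] by (cases l2) (auto split: if_splits)
  then show ?thesis using append that by auto
qed

text \<open>The variation along a subsequence is a convex function of each of its entries, hence an
  intermediate entry may be pushed to one of the neighbours without decreasing the variation.\<close>

lemma pvar_le_insert:
  assumes p: "p \<ge> 1" and C: "pvar_le p C (xs @ a # c # ys)" and b: "b \<in> closed_segment a c"
  shows "pvar_le p C (xs @ a # b # c # ys)"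
  unfolding pvar_le_def
proof (intro allI impI)
  fix l assume "subseq l (xs @ a # b # c # ys)"
  then have "subseq l ((xs @ [a]) @ b # c # ys)" by simp
  then obtain l1 m where l: "l = l1 @ m" "subseq l1 (xs @ [a])" "subseq m (b # c # ys)"
    by (rule subseq_appendE)
  show "pvar p l \<le> C"
  \<comment> \<open>If \<open>m\<close> avoids the new entry \<open>b\<close>, then \<open>l\<close>
    is already a subsequence of the old list.\<close>
  proof (cases "subseq m (c # ys)")
    case True
    then have "subseq l ((xs @ [a]) @ c # ys)" using l list_emb_append_mono by blast
    then show ?thesis using C by (simp add: pvar_le_def)
  next
    case False
    then obtain l2 where m: "m = b # l2" "subseq l2 (c # ys)"
      using l(3) by (auto elim: list_emb.cases)
    have "pvar p (l1 @ b # l2) \<le> max (pvar p (l1 @ a # l2)) (pvar p (l1 @ c # l2))"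
      using convex_on_le_max_segment[OF convex_on_pvar[OF p, of l1 l2] b] .
    moreover have "pvar p (l1 @ a # l2) \<le> C"
    proof -
      have *: "pvar p (l' @ a # l2) \<le> C" if "subseq l' xs" for l'
        using C m(2) that list_emb_append_mono[of "(=)" l' xs "a # l2" "a # c # ys"]
        by (auto simp: pvar_le_def)
      from l(2) show ?thesis
      proof (cases rule: subseq_snocE)
        \<comment> \<open>Here \<open>l1\<close> already ends in \<open>a\<close>. Putting
          \<open>a\<close> in place of \<open>b\<close> repeats it, and a repetition adds only
          \<open>0 powr p = 0\<close>.\<close>
        case (2 l')
        then have "pvar p (l1 @ a # l2) = pvar p (l' @ a # l2)"
          using pvar_join[of p "l' @ [a]" a l2] pvar_join[of p l' a l2] pvar_snoc[of "l' @ [a]" p a]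
          by simp
        then show ?thesis using *[OF 2(2)] by simp
      qed (rule *)
    qed
    moreover have "pvar p (l1 @ c # l2) \<le> C"
    proof -
      have *: "pvar p (l1 @ c # l') \<le> C" if "subseq l' ys" for l'
        using C l(2) that list_emb_append_mono[of "(=)" l1 "xs @ [a]" "c # l'" "c # ys"]
        by (auto simp: pvar_le_def)
      show ?thesis
      proof (cases "subseq l2 ys")
        case False
        then obtain l' where l': "l2 = c # l'" "subseq l' ys"
          using m(2) by (auto elim: list_emb.cases)
        then have "pvar p (l1 @ c # l2) = pvar p (l1 @ c # l')"
          using pvar_join[of p l1 c l2] pvar_join[of p l1 c l'] by simp
        then show ?thesis using *[OF l'(2)] by simp
      qed (rule *)
    qed
    ultimately show ?thesis using l m by simp
  qed
qed

section \<open>Step functions described by fronts\<close>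

text \<open>A front is a position with the value to its right; \<open>k\<close> is the value left of
  the first front. The strict test makes the function left continuous. Fronts may share a position:
  the values between them are then not attained, but they stay in the list as fronts that can
  separate later.\<close>

fun step :: "real \<Rightarrow> (real \<times> real) list \<Rightarrow> real \<Rightarrow> real" where
  "step k [] x = k"
| "step k ((y, k') # fs) x = (if y < x then step k' fs x else k)"

text \<open>As \<open>x\<close> increases, the scan in \<open>step\<close> stops at the same front
  or a later one. Sampled values thus run through the list of values in order, staying or jumping
  ahead, whether or not the positions are sorted.\<close>

lemma subseq_remdups_adj_step:
  "sorted xs \<Longrightarrow> subseq (remdups_adj (map (step k fs) xs)) (k # map snd fs)"
proof (induction fs arbitrary: k xs)
  case Nil
  have "map (step k []) xs = replicate (length xs) k" by (induction xs) auto
  then show ?case by (simp only: remdups_adj_replicate) simp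
next
  case (Cons f fs)
  obtain y k' where f: "f = (y, k')" by force
  from Cons.prems show ?case
  proof (induction xs)
    case (Cons x xs)
    have sub: "subseq (remdups_adj (map (step k (f # fs)) xs)) (k # map snd (f # fs))"
      using Cons by simp
    show ?case
    proof (cases "y < x")
      case True
      then have "map (step k (f # fs)) (x # xs) = map (step k' fs) (x # xs)"
        using Cons.prems f by fastforce
      then show ?thesis
        using Cons.IH Cons.prems \<open>\<And>xs k. sorted xs \<Longrightarrow> subseq (remdups_adj (map (step k fs) xs)) (k # map snd fs)\<close>[of "x # xs" k'] f
        by (simp only:) auto
    next
      case False
      then have x: "step k (f # fs) x = k" by (simp add: f)
      define m where "m = map (step k (f # fs)) xs"
      have "subseq (remdups_adj (k # m)) (k # map snd (f # fs))"
      proof (cases m)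
        case (Cons z m')
        show ?thesis
        proof (cases "z = k")
          case True
          then show ?thesis using sub Cons by (simp add: m_def)
        next
          case False
          obtain r where "remdups_adj m = z # r" using Cons by (cases "remdups_adj m") (auto simp: remdups_adj_Cons split: list.splits if_splits)
          then show ?thesis using sub Cons False by (auto simp: m_def[symmetric] dest: subseq_Cons2_neq)
        qed
      qed auto
      then show ?thesis using x by (simp add: m_def)
    qed
  qed simp
qed

lemma pvar_step_le:
  assumes "pvar_le p C (k # map snd fs)" "sorted xs"
  shows "pvar p (map (step k fs) xs) \<le> C"
  using assms subseq_remdups_adj_step[OF assms(2), of k fs] pvar_remdups_adj
  unfolding pvar_le_def by metis

lemma pvar_eq_sum:
  "pvar p l = (\<Sum>i < length l - 1. \<bar>l ! Suc i - l ! i\<bar> powr p)"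
proof (induction p l rule: pvar.induct)
  case (1 p a b l)
  then show ?case by (simp add: sum.lessThan_Suc_shift del: sum.lessThan_Suc)
qed auto

lemma TVs_subdiv_eq_pvar:
  "TVs_subdiv s u \<sigma> = pvar (1 / s) (map u (sorted_list_of_set \<sigma>))"
  unfolding TVs_subdiv_def pvar_eq_sum Let_def
  by (simp add: sum.atLeast1_atMost_eq)

text \<open>A subsequence of samples at increasing points is the sample along a smaller subdivision,
  so the bound over all subsequences is already contained in \<open>TVs\<close>.\<close>

lemma pvar_le_TVs:
  assumes "TVs s v UNIV \<le> ennreal C" "C \<ge> 0" "sorted xs" "distinct xs"
  shows "pvar_le (1 / s) C (map v xs)"
  unfolding pvar_le_def
proof (intro allI impI)
  fix l assume "subseq l (map v xs)"
  then obtain N where "l = map v (nths xs N)"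
    by (auto simp: subseq_conv_nths nths_map)
  moreover have xs: "sorted (nths xs N)" "distinct (nths xs N)"
    using assms by (auto simp: sorted_nths)
  then have "sorted_list_of_set (set (nths xs N)) = nths xs N"
    by (rule sorted_list_of_set.idem_if_sorted_distinct)
  ultimately have l: "pvar (1 / s) l = TVs_subdiv s v (set (nths xs N))"
    by (simp add: TVs_subdiv_eq_pvar)
  show "pvar (1 / s) l \<le> C"
  proof (cases "nths xs N = []")
    case True
    then show ?thesis using l assms by (simp add: TVs_subdiv_def)
  next
    case False
    then have "ennreal (TVs_subdiv s v (set (nths xs N))) \<le> TVs s v UNIV"
      unfolding TVs_def by (intro SUP_upper) (auto simp: subdivisions_def)
    then show ?thesis using assms l by (metis ennreal_le_iff order_trans)
  qed
qed

section \<open>Admissible fronts and their collisions\<close>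

text \<open>The Rankine-Hugoniot speed. Since division by 0 yields 0, the relation
  \<open>f b - f a = chord_slope f a b * (b - a)\<close> holds for \<open>a = b\<close> too.\<close>

definition chord_slope :: "(real \<Rightarrow> real) \<Rightarrow> real \<Rightarrow> real \<Rightarrow> real" where
  "chord_slope f a b = (f b - f a) / (b - a)"

text \<open>The tolerance \<open>\<omega>\<close> absorbs the deviation of \<open>f\<close> from its piecewise linear interpolation on the
  grid of values.\<close>

definition admissible :: "(real \<Rightarrow> real) \<Rightarrow> real \<Rightarrow> real \<Rightarrow> real \<Rightarrow> bool" where
  "admissible f \<omega> a b \<longleftrightarrow>
     (\<forall>z\<in>closed_segment a b.
        - \<omega> * \<bar>b - a\<bar> \<le> sgn (b - a) * (f z - f a - chord_slope f a b * (z - a)))"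

lemma chord_slope_add:
  "chord_slope f a b * (b - a) + chord_slope f b c * (c - b) = chord_slope f a c * (c - a)"
  by (cases "a = b"; cases "b = c"; cases "a = c") (auto simp: chord_slope_def)

text \<open>This is why two fronts of the same sign that run into each other merge into a single one.\<close>

lemma admissible_merge:
  assumes adm: "admissible f \<omega> a b" "admissible f \<omega> b c" and b: "b \<in> closed_segment a c"
    and sl: "chord_slope f a b \<ge> chord_slope f b c" and "\<omega> \<ge> 0"
  shows "admissible f \<omega> a c"
proof -
  define A B C where "A = chord_slope f a b" and "B = chord_slope f b c" and "C = chord_slope f a c"
  have add: "A * (b - a) + B * (c - b) = C * (c - a)"
    unfolding A_def B_def C_def by (rule chord_slope_add)
  have fb: "f b - f a = A * (b - a)" by (simp add: A_def chord_slope_def)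
  have BA: "B \<le> A" using sl by (simp add: A_def B_def)
  \<comment> \<open>For \<open>a \<noteq> c\<close>, \<open>C\<close> is the average of
    \<open>A\<close> and \<open>B\<close> with weights proportional to \<open>b - a\<close> and
    \<open>c - b\<close>, so \<open>B \<le> C \<le> A\<close>. The factor \<open>c - a\<close> lets
    one inequality serve jumps in both directions; multiplying by its square below avoids a
    division.\<close>
  have gap: "0 \<le> (c - a) * ((A - C) * (z - a))" if "(c - a) * (z - a) \<ge> 0" for z
  proof -
    have "(c - a) * (A - C) = (A - B) * (c - b)" using add by (simp add: algebra_simps)
    have "0 \<le> (c - a) * (c - b)" using b
      by (auto simp: closed_segment_eq_real_ivl zero_le_mult_iff split: if_splits)
    then show ?thesis
    proof (cases "a = c")
      case False
      have "(c - a)\<^sup>2 * ((c - a) * ((A - C) * (z - a))) = ((c - a) * (z - a)) * ((A - B) * ((c - a) * (c - b)))"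
        using \<open>(c - a) * (A - C) = (A - B) * (c - b)\<close> by algebra
      also have "\<dots> \<ge> 0" using that BA \<open>0 \<le> (c - a) * (c - b)\<close> by simp
      finally show ?thesis using False by (simp add: zero_le_mult_iff)
    qed simp
  qed
  have gap2: "0 \<le> (c - a) * ((C - B) * (c - z))" if "(c - a) * (c - z) \<ge> 0" for z
  proof -
    have eq: "(c - a) * (C - B) = (A - B) * (b - a)" using add by (simp add: algebra_simps)
    have pos: "0 \<le> (c - a) * (b - a)" using b
      by (auto simp: closed_segment_eq_real_ivl zero_le_mult_iff split: if_splits)
    show ?thesis
    proof (cases "a = c")
      case False
      have "(c - a)\<^sup>2 * ((c - a) * ((C - B) * (c - z))) = ((c - a) * (c - z)) * ((A - B) * ((c - a) * (b - a)))"
        using eq by algebra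
      also have "\<dots> \<ge> 0" using that BA pos by simp
      finally show ?thesis using False by (simp add: zero_le_mult_iff)
    qed simp
  qed
  show ?thesis unfolding admissible_def
  proof
    fix z assume z: "z \<in> closed_segment a c"
    \<comment> \<open>Passing from the chord of a partial jump \<open>l\<close> to the chord of the
      whole jump can only increase the signed deviation of \<open>f\<close>, and the allowed
      tolerance grows with the length of the jump.\<close>
    have trans: "- \<omega> * \<bar>c - a\<bar> \<le> sgn (c - a) * Y"
      if "- \<omega> * \<bar>l\<bar> \<le> sgn l * X" "\<bar>l\<bar> \<le> \<bar>c - a\<bar>" "l * (c - a) \<ge> 0" "0 \<le> (c - a) * (Y - X)"
        "l \<noteq> 0" for l X Y
    proof -
      have s: "sgn l = sgn (c - a)" using that by (auto simp: sgn_if zero_le_mult_iff)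
      have "0 \<le> sgn (c - a) * (Y - X)" using that(4) by (auto simp: sgn_if zero_le_mult_iff)
      moreover have "\<omega> * \<bar>l\<bar> \<le> \<omega> * \<bar>c - a\<bar>" using that \<open>\<omega> \<ge> 0\<close> by (intro mult_left_mono)
      ultimately show ?thesis using that s by (simp add: algebra_simps)
    qed
    have "z \<in> closed_segment a b \<or> z \<in> closed_segment b c"
      using z b by (auto simp: closed_segment_eq_real_ivl split: if_splits)
    then consider "a = b" | "b = c" | "a \<noteq> b" "b \<noteq> c" "z \<in> closed_segment a b"
      | "a \<noteq> b" "b \<noteq> c" "z \<in> closed_segment b c" by blast
    then show "- \<omega> * \<bar>c - a\<bar> \<le> sgn (c - a) * (f z - f a - chord_slope f a c * (z - a))"
    proof cases
      case 1
      then show ?thesis using adm z by (simp add: admissible_def)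
    next
      case 2
      then show ?thesis using adm z by (simp add: admissible_def)
    next
      case 3
      have "(c - a) * (z - a) \<ge> 0"
        using z by (auto simp: closed_segment_eq_real_ivl zero_le_mult_iff split: if_splits)
      have "0 \<le> (c - a) * ((f z - f a - C * (z - a)) - (f z - f a - A * (z - a)))"
        using gap[OF \<open>(c - a) * (z - a) \<ge> 0\<close>] by (simp add: algebra_simps)
      then show ?thesis
        using adm(1) 3 b unfolding admissible_def C_def[symmetric] A_def[symmetric]
        by (intro trans[of "b - a" "f z - f a - A * (z - a)"])
          (auto simp: closed_segment_eq_real_ivl zero_le_mult_iff split: if_splits)
    next
      case 4
      have "(c - a) * (c - z) \<ge> 0"
        using z by (auto simp: closed_segment_eq_real_ivl zero_le_mult_iff split: if_splits)
      from gap2[OF this] have "0 \<le> (c - a) * ((f z - f a - C * (z - a)) - (f z - f b - B * (z - b)))"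
      proof -
        have "(f z - f a - C * (z - a)) - (f z - f b - B * (z - b)) = (C - B) * (c - z)"
          using fb add by (simp add: algebra_simps)
        then show ?thesis using \<open>0 \<le> (c - a) * ((C - B) * (c - z))\<close> by simp
      qed
      then show ?thesis
        using adm(2) 4 b unfolding admissible_def C_def[symmetric] B_def[symmetric]
        by (intro trans[of "c - b" "f z - f b - B * (z - b)"])
          (auto simp: closed_segment_eq_real_ivl zero_le_mult_iff split: if_splits)
    qed
  qed
qed

section \<open>Grid cells as a termination measure\<close>

text \<open>For entries in \<open>G\<close> this is an integer-valued total variation: the number of
  grid cells crossed along the list.\<close>

fun cells :: "real set \<Rightarrow> real list \<Rightarrow> nat" where
  "cells G (a # b # l) = card (G \<inter> {min a b<..max a b}) + cells G (b # l)"
| "cells G _ = 0"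

lemma cells_join: "cells G (xs @ a # ys) = cells G (xs @ [a]) + cells G (a # ys)"
proof (induction xs)
  case (Cons x xs)
  then show ?case by (cases xs) auto
qed simp

lemma successively_join:
  "successively P (xs @ a # ys) \<longleftrightarrow> successively P (xs @ [a]) \<and> successively P (a # ys)"
  by (induction xs rule: induct_list012) (auto simp: successively_Cons)

lemma card_cell_add:
  assumes "finite G" "b \<in> closed_segment a c"
  shows "card (G \<inter> {min a b<..max a b}) + card (G \<inter> {min b c<..max b c})
    = card (G \<inter> {min a c<..max a (c::real)})"
proof -
  have "card (G \<inter> {min a b<..max a b}) + card (G \<inter> {min b c<..max b c})
    = card (G \<inter> {min a b<..max a b} \<union> G \<inter> {min b c<..max b c})"
    using assms by (intro card_Un_disjoint[symmetric])
      (auto simp: closed_segment_eq_real_ivl split: if_splits)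
  also have "G \<inter> {min a b<..max a b} \<union> G \<inter> {min b c<..max b c} = G \<inter> {min a c<..max a c}"
    using assms(2) by (auto simp: closed_segment_eq_real_ivl split: if_splits)
  finally show ?thesis .
qed

lemma card_cell_less:
  assumes "finite G" "a \<in> G" "b \<in> G" "c \<in> G" "b \<notin> closed_segment a (c::real)"
  shows "card (G \<inter> {min a c<..max a c}) <
    card (G \<inter> {min a b<..max a b}) + card (G \<inter> {min b c<..max b c})"
proof -
  have "b < min a c \<or> b > max a c"
    using assms(5) by (auto simp: closed_segment_eq_real_ivl split: if_splits)
  \<comment> \<open>The cells contain only their upper endpoint. The additional grid point is
    therefore \<open>min a c\<close> if \<open>b\<close> lies below the segment, and
    \<open>b\<close> itself if it lies above.\<close>
  then have "G \<inter> {min a c<..max a c} \<subset> G \<inter> {min a b<..max a b} \<union> G \<inter> {min b c<..max b c}"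
  proof
    assume "b < min a c"
    then have "min a c \<in> G \<inter> {min a b<..max a b} \<union> G \<inter> {min b c<..max b c}" using assms(2,4) by (cases "a \<le> c") auto
    moreover have "min a c \<notin> G \<inter> {min a c<..max a c}" by simp
    moreover have "G \<inter> {min a c<..max a c} \<subseteq> G \<inter> {min a b<..max a b} \<union> G \<inter> {min b c<..max b c}"
      using \<open>b < min a c\<close> by auto
    ultimately show ?thesis by blast
  next
    assume "b > max a c"
    then have "b \<in> G \<inter> {min a b<..max a b} \<union> G \<inter> {min b c<..max b c}"
      using assms(3) \<open>b > max a c\<close> by auto
    moreover have "b \<notin> G \<inter> {min a c<..max a c}" using \<open>b > max a c\<close> by (metis IntE greaterThanAtMost_iff not_less)
    moreover have "G \<inter> {min a c<..max a c} \<subseteq> G \<inter> {min a b<..max a b} \<union> G \<inter> {min b c<..max b c}"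
      using \<open>b > max a c\<close> by auto
    ultimately show ?thesis by blast
  qed
  then have "card (G \<inter> {min a c<..max a c}) < card (G \<inter> {min a b<..max a b} \<union> G \<inter> {min b c<..max b c})"
    using assms by (intro psubset_card_mono) auto
  also have "\<dots> \<le> card (G \<inter> {min a b<..max a b}) + card (G \<inter> {min b c<..max b c})"
    by (rule card_Un_le)
  finally show ?thesis .
qed

text \<open>All exponents at once: \<open>p = 1 / s\<close> is the exponent of the final estimate,
  \<open>p = 1\<close> controls the error made by moving the fronts.\<close>

definition pvar_dominates :: "real list \<Rightarrow> real list \<Rightarrow> bool" where
  "pvar_dominates ks ls \<longleftrightarrow> (\<forall>p C. p \<ge> 1 \<longrightarrow> pvar_le p C ks \<longrightarrow> pvar_le p C ls)"

lemma pvar_dominates_refl [simp]: "pvar_dominates ks ks" by (simp add: pvar_dominates_def)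

lemma pvar_dominates_trans: "pvar_dominates ks ls \<Longrightarrow> pvar_dominates ls ms \<Longrightarrow> pvar_dominates ks ms"
  by (simp add: pvar_dominates_def)

lemma pvar_dominates_subseq: "subseq ls ks \<Longrightarrow> pvar_dominates ks ls"
  unfolding pvar_dominates_def by (blast intro: pvar_le_subseq)

lemma pvar_dominates_insert: "b \<in> closed_segment a c \<Longrightarrow> pvar_dominates (xs @ a # c # ys) (xs @ a # b # c # ys)"
  unfolding pvar_dominates_def by (blast intro: pvar_le_insert)

text \<open>Neighbours are required to be admissible in both orders. Because of the tolerance, a
  small rarefaction jump is accepted like a shock; this plays the part of a piecewise linear
  interpolation of the flux.\<close>

definition fine_grid :: "(real \<Rightarrow> real) \<Rightarrow> real \<Rightarrow> real set \<Rightarrow> bool" where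
  "fine_grid f \<omega> G \<longleftrightarrow>
     (\<forall>g\<in>G. \<forall>h\<in>G. G \<inter> open_segment g h = {} \<longrightarrow> admissible f \<omega> g h)"

text \<open>The chain runs monotonically through the grid values from \<open>a\<close> to
  \<open>c\<close>: every insertion is of an intermediate value, and no cell is crossed twice. The
  context \<open>xs\<close>, \<open>ys\<close> belongs to the claim because domination speaks of
  whole lists.\<close>

lemma elementary_chain:
  assumes G: "finite G"
    and el: "fine_grid f \<omega> G"
  shows "a \<in> G \<Longrightarrow> c \<in> G \<Longrightarrow> \<exists>cs. cs \<noteq> [] \<and> last cs = c \<and> set cs \<subseteq> G \<and>
    successively (admissible f \<omega>) (a # cs) \<and>
    cells G (a # cs) = card (G \<inter> {min a c<..max a c}) \<and>
    (\<forall>xs ys. pvar_dominates (xs @ a # c # ys) (xs @ a # cs @ ys))"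
proof (induction "card (G \<inter> open_segment a c)" arbitrary: a c rule: less_induct)
  case less
  show ?case
  proof (cases "G \<inter> open_segment a c = {}")
    case True
    then show ?thesis using el less.prems unfolding fine_grid_def by (intro exI[of _ "[c]"]) auto
  next
    case False
    then obtain g where g: "g \<in> G" "g \<in> open_segment a c" by auto
    have "G \<inter> open_segment a g \<subset> G \<inter> open_segment a c" "G \<inter> open_segment g c \<subset> G \<inter> open_segment a c"
      using g by (auto simp: open_segment_eq_real_ivl set_eq_iff split: if_splits)
    then have "card (G \<inter> open_segment a g) < card (G \<inter> open_segment a c)"
      "card (G \<inter> open_segment g c) < card (G \<inter> open_segment a c)"
      using G by (auto intro: psubset_card_mono)
    with less g obtain c1 c2 where
      c1: "c1 \<noteq> []" "last c1 = g" "set c1 \<subseteq> G" "successively (admissible f \<omega>) (a # c1)"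
        "cells G (a # c1) = card (G \<inter> {min a g<..max a g})"
        "\<And>xs ys. pvar_dominates (xs @ a # g # ys) (xs @ a # c1 @ ys)" and
      c2: "c2 \<noteq> []" "last c2 = c" "set c2 \<subseteq> G" "successively (admissible f \<omega>) (g # c2)"
        "cells G (g # c2) = card (G \<inter> {min g c<..max g c})"
        "\<And>xs ys. pvar_dominates (xs @ g # c # ys) (xs @ g # c2 @ ys)"
      by meson
    obtain c1' where c1': "c1 = c1' @ [g]" using c1 append_butlast_last_id by metis
    have gs: "g \<in> closed_segment a c" using g by (auto simp: open_segment_def)
    have "pvar_dominates (xs @ a # c # ys) (xs @ a # (c1 @ c2) @ ys)" for xs ys
    proof -
      have "pvar_dominates (xs @ a # c # ys) (xs @ a # g # c # ys)" by (rule pvar_dominates_insert[OF gs])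
      moreover have "pvar_dominates (xs @ a # g # c # ys) (xs @ a # g # c2 @ ys)"
        using c2(6)[of "xs @ [a]"] by simp
      moreover have "pvar_dominates (xs @ a # g # c2 @ ys) (xs @ a # (c1 @ c2) @ ys)"
        using c1(6)[of xs "c2 @ ys"] by simp
      ultimately show ?thesis by (blast intro: pvar_dominates_trans)
    qed
    moreover have "successively (admissible f \<omega>) (a # c1 @ c2)"
      using successively_join[of _ "a # c1'" g c2] c1(4) c2(4) c1' by simp
    moreover have "cells G (a # c1 @ c2) = card (G \<inter> {min a c<..max a c})"
      using cells_join[of G "a # c1'" g c2] c1(5) c2(5) c1' card_cell_add[OF G gs] by simp
    ultimately show ?thesis using c1 c2 by (intro exI[of _ "c1 @ c2"]) auto
  qed
qed

text \<open>If \<open>b\<close> lies between \<open>a\<close> and \<open>c\<close>, the fronts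
  merge: the cell count stays and two fronts become one. Otherwise the jumps partly cancel and the
  cell count drops strictly; the remaining jump need not be admissible and is split into elementary
  ones, whose number does not matter after the drop.\<close>

lemma resolve_collision:
  assumes G: "finite G"
    and el: "fine_grid f \<omega> G"
    and abc: "a \<in> G" "b \<in> G" "c \<in> G"
    and adm: "admissible f \<omega> a b" "admissible f \<omega> b c" "chord_slope f b c < chord_slope f a b"
    and "\<omega> \<ge> 0"
  shows "\<exists>cs. cs \<noteq> [] \<and> last cs = c \<and> set cs \<subseteq> G \<and>
    successively (admissible f \<omega>) (a # cs) \<and>
    (cells G (a # cs) < cells G [a, b, c] \<or> cells G (a # cs) = cells G [a, b, c] \<and> length cs < 2) \<and>
    (\<forall>xs ys. pvar_dominates (xs @ a # b # c # ys) (xs @ a # cs @ ys))"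
proof -
  have sub: "pvar_dominates (xs @ a # b # c # ys) (xs @ a # c # ys)" for xs ys
    by (rule pvar_dominates_subseq) (auto simp: subseq_append')
  show ?thesis
  proof (cases "b \<in> closed_segment a c")
    case True
    then show ?thesis
      using admissible_merge[OF adm(1,2) True] adm(3) \<open>\<omega> \<ge> 0\<close> abc sub card_cell_add[OF G True]
      by (intro exI[of _ "[c]"]) auto
  next
    case False
    obtain cs where cs: "cs \<noteq> []" "last cs = c" "set cs \<subseteq> G"
      "successively (admissible f \<omega>) (a # cs)" "cells G (a # cs) = card (G \<inter> {min a c<..max a c})"
      "\<And>xs ys. pvar_dominates (xs @ a # c # ys) (xs @ a # cs @ ys)"
      using elementary_chain[OF G el abc(1,3)] by blast
    then show ?thesis
      using card_cell_less[OF G abc False] pvar_dominates_trans[OF sub]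
      by (intro exI[of _ cs]) auto
  qed
qed

fun advance :: "(real \<Rightarrow> real) \<Rightarrow> real \<Rightarrow> real \<Rightarrow> (real \<times> real) list \<Rightarrow> (real \<times> real) list" where
  "advance f \<tau> k [] = []"
| "advance f \<tau> k ((y, k') # fs) = (y + \<tau> * chord_slope f k k', k') # advance f \<tau> k' fs"

lemma length_advance [simp]: "length (advance f \<tau> k fs) = length fs"
  by (induction f \<tau> k fs rule: advance.induct) auto

lemma map_snd_advance [simp]: "map snd (advance f \<tau> k fs) = map snd fs"
  by (induction f \<tau> k fs rule: advance.induct) auto

lemma fst_advance_nth:
  "i < length fs \<Longrightarrow> fst (advance f \<tau> k fs ! i) =
     fst (fs ! i) + \<tau> * chord_slope f ((k # map snd fs) ! i) ((k # map snd fs) ! Suc i)"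
proof (induction f \<tau> k fs arbitrary: i rule: advance.induct)
  case (2 f \<tau> k y k' fs)
  then show ?case by (cases i) auto
qed simp

text \<open>Of the fronts stacked at one position only the last value is visible to the right. Hence
  a collision changes the list of fronts but not the function.\<close>

lemma step_replace:
  assumes "cs \<noteq> []" "last cs = c"
  shows "step k (us @ map (Pair y) cs @ vs) x = step k (us @ (y, b) # (y, c) # vs) x"
proof (induction us arbitrary: k)
  case Nil
  have "step k (map (Pair y) cs @ vs) x = (if y < x then step c vs x else k)"
    using assms by (induction cs arbitrary: k) (auto split: if_splits)
  then show ?case by simp
next
  case (Cons a us)
  then show ?case by (cases a) auto
qed

text \<open>\<open>D\<close> abstracts the distance between the solution at a given time and a step
  function. Only its growth while no fronts cross is needed, which separates the combinatorics of
  collisions from the conservation law.\<close>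

lemma front_tracking:
  fixes D :: "real \<Rightarrow> (real \<Rightarrow> real) \<Rightarrow> real"
  assumes G: "finite G"
    and el: "fine_grid f \<omega> G"
    and "\<omega> \<ge> 0"
    and move: "\<And>a b k fs. 0 \<le> a \<Longrightarrow> a \<le> b \<Longrightarrow> set (k # map snd fs) \<subseteq> G \<Longrightarrow>
      successively (admissible f \<omega>) (k # map snd fs) \<Longrightarrow>
      (\<And>\<tau>. 0 \<le> \<tau> \<Longrightarrow> \<tau> \<le> b - a \<Longrightarrow> sorted (map fst (advance f \<tau> k fs))) \<Longrightarrow>
      D b (step k (advance f (b - a) k fs)) \<le>
        D a (step k fs) + 2 * \<omega> * pvar 1 (k # map snd fs) * (b - a)"
  shows "0 \<le> a \<Longrightarrow> a \<le> b \<Longrightarrow> set (k # map snd fs) \<subseteq> G \<Longrightarrow>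
      successively (admissible f \<omega>) (k # map snd fs) \<Longrightarrow> sorted (map fst fs) \<Longrightarrow>
      pvar_le 1 C (k # map snd fs) \<Longrightarrow>
      \<exists>k' fs'. pvar_dominates (k # map snd fs) (k' # map snd fs') \<and>
        D b (step k' fs') \<le> D a (step k fs) + 2 * \<omega> * C * (b - a)"
proof (induction "(cells G (k # map snd fs), length fs)" arbitrary: a k fs
    rule: wf_induct_rule[OF wf_lex_prod[OF wf_less_than wf_less_than]])
  case (1 k fs a)
  define n where "n = length fs"
  define y where "y i = fst (fs ! i)" for i
  define vals where "vals = k # map snd fs"
  define sp where "sp i = chord_slope f (vals ! i) (vals ! Suc i)" for i
  \<comment> \<open>\<open>S\<close> consists of the neighbouring pairs on collision course, and
    \<open>T i\<close> is the time until pair \<open>i\<close> meets. Pairs outside \<open>S\<close>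
    never get closer.\<close>
  define S where "S = {i. Suc i < n \<and> sp (Suc i) < sp i}"
  define T where "T i = (y (Suc i) - y i) / (sp i - sp (Suc i))" for i
  have S: "finite S" by (rule finite_subset[of _ "{..<n}"]) (auto simp: S_def)
  have ysort: "y i \<le> y (Suc i)" if "Suc i < n" for i
    using 1(6) that by (auto simp: y_def n_def sorted_iff_nth_Suc)
  have adv: "fst (advance f \<tau> k fs ! i) = y i + \<tau> * sp i" if "i < n" for i \<tau>
    using that fst_advance_nth[of i fs f \<tau> k] by (simp add: y_def sp_def vals_def n_def)
  have sorted: "sorted (map fst (advance f \<tau> k fs))" if "0 \<le> \<tau>" "\<And>i. i \<in> S \<Longrightarrow> \<tau> \<le> T i" for \<tau>
    unfolding sorted_iff_nth_Suc
  proof (intro allI impI)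
    fix i assume "Suc i < length (map fst (advance f \<tau> k fs))"
    then have i: "Suc i < n" by (simp add: n_def)
    have "y i + \<tau> * sp i \<le> y (Suc i) + \<tau> * sp (Suc i)"
    proof (cases "i \<in> S")
      case True
      then have "\<tau> * (sp i - sp (Suc i)) \<le> y (Suc i) - y i"
        using that(2)[OF True] by (simp add: T_def S_def pos_le_divide_eq)
      then show ?thesis by (simp add: algebra_simps)
    next
      case False
      then have "sp i \<le> sp (Suc i)" using i by (simp add: S_def)
      then show ?thesis using ysort[OF i] that(1) by (simp add: add_mono mult_left_mono)
    qed
    then show "map fst (advance f \<tau> k fs) ! i \<le> map fst (advance f \<tau> k fs) ! Suc i"
      using i adv by (simp add: n_def)
  qed
  have C: "pvar 1 (k # map snd fs) \<le> C" using 1(7) by (rule pvar_le_self)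
  show ?case
  proof (cases "\<forall>i\<in>S. b - a \<le> T i")
    case True
    have "D b (step k (advance f (b - a) k fs)) \<le> D a (step k fs) + 2 * \<omega> * pvar 1 (k # map snd fs) * (b - a)"
      using 1 True by (intro move sorted) auto
    also have "\<dots> \<le> D a (step k fs) + 2 * \<omega> * C * (b - a)"
      using C \<open>\<omega> \<ge> 0\<close> 1 by (intro add_left_mono mult_right_mono mult_left_mono) auto
    finally show ?thesis by (intro exI[of _ k] exI[of _ "advance f (b - a) k fs"]) simp
  next
    case False
    then have "S \<noteq> {}" by auto
    \<comment> \<open>Only one pair is resolved at the earliest collision time. Other pairs meeting
      at that time can reappear with waiting time 0, which is harmless: the induction descends in
      the measure, not in time.\<close>
    then obtain i where i: "i \<in> S" "\<And>j. j \<in> S \<Longrightarrow> T i \<le> T j"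
      using S ex_min_if_finite[of "T ` S"] by (metis (no_types, lifting) arg_min_if_finite(1) arg_min_least)
    define \<tau> where "\<tau> = T i"
    have iS: "Suc i < n" "sp (Suc i) < sp i" using i(1) by (auto simp: S_def)
    have \<tau>: "0 \<le> \<tau>" using iS ysort[of i] by (simp add: \<tau>_def T_def)
    have \<tau>b: "\<tau> < b - a" using False i(2) unfolding \<tau>_def by force
    define fs1 where "fs1 = advance f \<tau> k fs"
    have len1: "length fs1 = n" by (simp add: fs1_def n_def)
    have vals1: "map snd fs1 = map snd fs" by (simp add: fs1_def)
    have eqy: "fst (fs1 ! i) = fst (fs1 ! Suc i)"
      using iS adv by (simp add: fs1_def \<tau>_def T_def field_simps)
    define us vs yy b' c where "us = take i fs1" and "vs = drop (Suc (Suc i)) fs1"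
      and "yy = fst (fs1 ! i)" and "b' = snd (fs1 ! i)" and "c = snd (fs1 ! Suc i)"
    have fs1: "fs1 = us @ (yy, b') # (yy, c) # vs"
    proof -
      have "fs1 = us @ fs1 ! i # fs1 ! Suc i # vs"
        unfolding us_def vs_def using iS len1 by (simp add: Cons_nth_drop_Suc)
      moreover have "fs1 ! i = (yy, b')" "fs1 ! Suc i = (yy, c)"
        using eqy by (auto simp: yy_def b'_def c_def prod_eq_iff)
      ultimately show ?thesis by simp
    qed
    have lus: "length us = i" using iS len1 by (simp add: us_def)
    define zs a' where "zs = butlast (k # map snd us)" and "a' = last (k # map snd us)"
    have za: "k # map snd us = zs @ [a']" unfolding zs_def a'_def by (rule append_butlast_last_id[symmetric]) simp
    have vals: "k # map snd fs = zs @ a' # b' # c # map snd vs"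
    proof -
      have "k # map snd fs = (k # map snd us) @ b' # c # map snd vs"
        using arg_cong[OF fs1, of "map snd"] vals1 by simp
      then show ?thesis by (simp add: za)
    qed
    have "length zs = i" using arg_cong[OF za, of length] lus by simp
    then have sps: "sp i = chord_slope f a' b'" "sp (Suc i) = chord_slope f b' c"
      by (auto simp: sp_def vals_def vals nth_append)
    have inG: "a' \<in> G" "b' \<in> G" "c \<in> G" "set zs \<subseteq> G" "set (map snd vs) \<subseteq> G"
      using 1(4) unfolding vals by auto
    have succ: "successively (admissible f \<omega>) (zs @ [a'])" "successively (admissible f \<omega>) (c # map snd vs)"
      "admissible f \<omega> a' b'" "admissible f \<omega> b' c"
      using 1(5) successively_join[of "admissible f \<omega>" zs a' "b' # c # map snd vs"]
      unfolding vals by auto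
    have slopes: "chord_slope f b' c < chord_slope f a' b'" using iS(2) sps by simp
    obtain cs where cs: "cs \<noteq> []" "last cs = c" "set cs \<subseteq> G"
      "successively (admissible f \<omega>) (a' # cs)"
      "cells G (a' # cs) < cells G [a', b', c] \<or> cells G (a' # cs) = cells G [a', b', c] \<and> length cs < 2"
      "\<And>xs ys. pvar_dominates (xs @ a' # b' # c # ys) (xs @ a' # cs @ ys)"
      using resolve_collision[OF G el inG(1-3) succ(3,4) slopes \<open>\<omega> \<ge> 0\<close>]
      by (elim exE conjE) (rule that; assumption | blast)
    define fs2 where "fs2 = us @ map (Pair yy) cs @ vs"
    have vals2: "k # map snd fs2 = zs @ a' # cs @ map snd vs"
      using za by (simp add: fs2_def o_def)
    have ref: "pvar_dominates (k # map snd fs) (k # map snd fs2)"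
      unfolding vals vals2 by (rule cs(6))
    \<comment> \<open>Since the function is unchanged, \<open>D\<close> does not jump at the
      collision.\<close>
    have step2: "step k fs2 = step k fs1"
      unfolding fs1 fs2_def by (rule ext) (rule step_replace[OF cs(1,2)])
    obtain cs' where cs': "cs = cs' @ [c]" using cs append_butlast_last_id by metis
    have cells_eq: "cells G (zs @ a' # b' # c # map snd vs)
        = cells G (zs @ [a']) + (cells G [a', b', c] + cells G (c # map snd vs))"
      "cells G (zs @ a' # cs @ map snd vs)
        = cells G (zs @ [a']) + (cells G (a' # cs) + cells G (c # map snd vs))"
      using cells_join[of G zs a' "b' # c # map snd vs"] cells_join[of G "[a', b']" c "map snd vs"]
        cells_join[of G zs a' "cs @ map snd vs"] cells_join[of G "a' # cs'" c "map snd vs"]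
      by (auto simp: cs')
    have dec: "((cells G (k # map snd fs2), length fs2), (cells G (k # map snd fs), length fs))
        \<in> less_than <*lex*> less_than"
    proof -
      have "length fs2 = length us + length cs + length vs" "length fs = length us + 2 + length vs"
        using len1 arg_cong[OF fs1, of length] by (auto simp: fs2_def n_def)
      then show ?thesis unfolding vals vals2 cells_eq using cs(5) by auto
    qed
    have sorted2: "sorted (map fst fs2)"
    proof -
      have "sorted (map fst fs1)" unfolding fs1_def using \<tau> i(2) by (intro sorted) (auto simp: \<tau>_def)
      then show ?thesis unfolding fs1 fs2_def
        by (auto simp: sorted_append o_def map_replicate_const)
    qed
    have succ2: "successively (admissible f \<omega>) (k # map snd fs2)"
      unfolding vals2 using succ cs(4) successively_join[of _ zs a' "cs @ map snd vs"]
        successively_join[of _ "a' # cs'" c "map snd vs"] by (auto simp: cs')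
    have m1: "D (a + \<tau>) (step k fs2) \<le> D a (step k fs) + 2 * \<omega> * C * \<tau>"
    proof -
      have "D (a + \<tau>) (step k (advance f (a + \<tau> - a) k fs))
          \<le> D a (step k fs) + 2 * \<omega> * pvar 1 (k # map snd fs) * (a + \<tau> - a)"
        using 1 \<tau> i(2) by (intro move sorted) (auto simp: \<tau>_def intro: order_trans)
      also have "\<dots> \<le> D a (step k fs) + 2 * \<omega> * C * (a + \<tau> - a)"
        using C \<open>\<omega> \<ge> 0\<close> \<tau> by (intro add_left_mono mult_right_mono mult_left_mono) auto
      finally show ?thesis by (simp add: step2 fs1_def)
    qed
    have "set (k # map snd fs2) \<subseteq> G" unfolding vals2 using inG cs(3) by auto
    \<comment> \<open>Domination at exponent 1 keeps the same \<open>C\<close> valid, so the errors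
      of consecutive time intervals add up to one error for the total time.\<close>
    moreover have "pvar_le 1 C (k # map snd fs2)" using ref 1(7) by (simp add: pvar_dominates_def)
    ultimately obtain k' fs' where "pvar_dominates (k # map snd fs2) (k' # map snd fs')"
      "D b (step k' fs') \<le> D (a + \<tau>) (step k fs2) + 2 * \<omega> * C * (b - (a + \<tau>))"
      using 1(1)[OF dec _ _ _ succ2 sorted2, of "a + \<tau>"] 1(2) \<tau> \<tau>b by auto
    then show ?thesis using ref m1
      by (intro exI[of _ k'] exI[of _ fs']) (auto intro: pvar_dominates_trans simp: algebra_simps)
  qed
qed

text \<open>Jumps of the sampled datum need not be admissible. Each is split into elementary jumps
  stacked at its position. The prefix \<open>xs\<close> and the inclusion of positions carry the
  induction along the list: the former for the domination, the latter for the sorting.\<close>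

lemma elementary_refinement:
  assumes G: "finite G"
    and el: "fine_grid f \<omega> G"
  shows "set (k # map snd fs) \<subseteq> G \<Longrightarrow> sorted (map fst fs) \<Longrightarrow>
    \<exists>fs'. step k fs' = step k fs \<and> set (k # map snd fs') \<subseteq> G \<and> sorted (map fst fs') \<and>
      fst ` set fs' \<subseteq> fst ` set fs \<and>
      successively (admissible f \<omega>) (k # map snd fs') \<and>
      (\<forall>xs. pvar_dominates (xs @ k # map snd fs) (xs @ k # map snd fs'))"
proof (induction fs arbitrary: k)
  case Nil
  then show ?case by (intro exI[of _ "[]"]) auto
next
  case (Cons z fs)
  obtain y c where z: "z = (y, c)" by force
  obtain fs' where fs': "step c fs' = step c fs" "set (c # map snd fs') \<subseteq> G" "sorted (map fst fs')"
    "fst ` set fs' \<subseteq> fst ` set fs" "successively (admissible f \<omega>) (c # map snd fs')"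
    "\<And>xs. pvar_dominates (xs @ c # map snd fs) (xs @ c # map snd fs')"
    using Cons.IH[of c] Cons.prems z by auto
  obtain cs where cs: "cs \<noteq> []" "last cs = c" "set cs \<subseteq> G"
    "successively (admissible f \<omega>) (k # cs)"
    "\<And>xs ys. pvar_dominates (xs @ k # c # ys) (xs @ k # cs @ ys)"
    using elementary_chain[OF G el, of k c] Cons.prems z by auto
  obtain cs' where cs': "cs = cs' @ [c]" using cs append_butlast_last_id by metis
  define fs2 where "fs2 = map (Pair y) cs @ fs'"
  have "step k fs2 x = step k (z # fs) x" for x
    using step_replace[OF cs(1,2), of k "[]" y fs' x c] fs'(1) by (simp add: fs2_def z)
  moreover have vals2: "k # map snd fs2 = k # cs @ map snd fs'" by (simp add: fs2_def o_def)
  moreover have "sorted (map fst fs2)"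
    using Cons.prems fs'(3,4) z by (force simp: fs2_def sorted_append o_def map_replicate_const)
  moreover have "fst ` set fs2 \<subseteq> fst ` set (z # fs)"
    using fs'(4) z by (auto simp: fs2_def)
  moreover have "successively (admissible f \<omega>) (k # map snd fs2)"
    unfolding vals2 using cs(4) fs'(5) successively_join[of _ "k # cs'" c "map snd fs'"] by (simp add: cs')
  moreover have "pvar_dominates (xs @ k # map snd (z # fs)) (xs @ k # map snd fs2)" for xs
  proof -
    have "pvar_dominates (xs @ k # map snd (z # fs)) (xs @ k # c # map snd fs')"
      using fs'(6)[of "xs @ [k]"] z by simp
    then show ?thesis unfolding vals2 using cs(5) pvar_dominates_trans by blast
  qed
  ultimately show ?case using cs(3) fs'(2) Cons.prems z
    by (intro exI[of _ fs2]) auto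
qed

section \<open>Entropy solutions with a Borel representative\<close>

text \<open>A quadratic spline rising from 0 to 1 on \<open>[0, 1]\<close>; \<open>hat\<close> is
  its derivative, a tent of height 2 and mass 1. Test functions are only required to be C1, so this
  explicit cutoff is regular enough.\<close>

definition smooth_step :: "real \<Rightarrow> real" where
  "smooth_step z = 2 * (max 0 z)\<^sup>2 - 4 * (max 0 (z - 1/2))\<^sup>2 + 2 * (max 0 (z - 1))\<^sup>2"

definition hat :: "real \<Rightarrow> real" where
  "hat z = 4 * max 0 z - 8 * max 0 (z - 1/2) + 4 * max 0 (z - 1)"

lemma has_real_derivative_max_0_square:
  "((\<lambda>z. (max 0 z)\<^sup>2) has_real_derivative 2 * max 0 z) (at (z::real))"
proof -
  consider "z < 0" | "z = 0" | "z > 0" by linarith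
  then show ?thesis
  proof cases
    case 1
    have "((\<lambda>z. 0) has_real_derivative 2 * max 0 z) (at z)" using 1 by simp
    then show ?thesis
      by (rule has_field_derivative_transform_within_open[of _ _ _ "{..<0}"]) (use 1 in auto)
  next
    case 2
    have "((\<lambda>h. (max 0 h)\<^sup>2 / h) \<longlongrightarrow> 0) (at (0::real))"
      by (rule Lim_null_comparison[of _ "\<lambda>h. \<bar>h\<bar>"])
        (auto intro!: tendsto_eq_intros always_eventually simp: max_def power2_eq_square)
    then show ?thesis using 2 by (simp add: DERIV_def)
  next
    case 3
    have "((\<lambda>z. z\<^sup>2) has_real_derivative 2 * max 0 z) (at z)"
      using 3 by (auto intro!: derivative_eq_intros)
    then show ?thesis
      by (rule has_field_derivative_transform_within_open[of _ _ _ "{0<..}"]) (use 3 in auto)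
  qed
qed

lemma has_real_derivative_smooth_step [derivative_intros]:
  assumes "(g has_real_derivative g') (at x within A)"
  shows "((\<lambda>x. smooth_step (g x)) has_real_derivative hat (g x) * g') (at x within A)"
proof -
  have sh: "((\<lambda>z. (max 0 (z - c))\<^sup>2) has_real_derivative 2 * max 0 (z - c)) (at z)" for c z :: real
    using DERIV_shift[of "\<lambda>z. (max 0 z)\<^sup>2" "2 * max 0 (z - c)" z "- c"]
      has_real_derivative_max_0_square[of "z - c"] by simp
  have "(smooth_step has_real_derivative hat z) (at z)" for z
    unfolding smooth_step_def[abs_def]
    by (rule DERIV_cong[OF DERIV_add[OF DERIV_diff[OF
        DERIV_cmult[OF has_real_derivative_max_0_square] DERIV_cmult[OF sh]] DERIV_cmult[OF sh]]])
      (simp add: hat_def)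
  then show ?thesis using assms DERIV_chain2 by blast
qed

lemma continuous_on_hat [continuous_intros]:
  "continuous_on A g \<Longrightarrow> continuous_on A (\<lambda>x. hat (g x))"
  unfolding hat_def by (intro continuous_intros)

lemma continuous_on_smooth_step [continuous_intros]:
  "continuous_on A g \<Longrightarrow> continuous_on A (\<lambda>x. smooth_step (g x))"
  unfolding smooth_step_def by (intro continuous_intros)

lemma hat_nonneg: "0 \<le> hat z"
  unfolding hat_def by (auto simp: max_def)

lemma hat_eq_0: "z \<le> 0 \<or> 1 \<le> z \<Longrightarrow> hat z = 0"
  unfolding hat_def by (auto simp: max_def)

lemma hat_le: "hat z \<le> 2"
  unfolding hat_def by (auto simp: max_def)

lemma smooth_step_eq_0: "z \<le> 0 \<Longrightarrow> smooth_step z = 0"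
  unfolding smooth_step_def by (auto simp: max_def)

lemma smooth_step_eq_1: "1 \<le> z \<Longrightarrow> smooth_step z = 1"
  unfolding smooth_step_def by (auto simp: max_def power2_eq_square algebra_simps)

lemma smooth_step_mono: "x \<le> y \<Longrightarrow> smooth_step x \<le> smooth_step y"
  by (rule DERIV_nonneg_imp_nondecreasing)
    (auto intro!: exI[of _ "hat _"] hat_nonneg derivative_eq_intros)

lemma smooth_step_nonneg: "0 \<le> smooth_step z"
  using smooth_step_mono[of "min 0 z" z] smooth_step_eq_0[of "min 0 z"] by simp

lemma smooth_step_le_1: "smooth_step z \<le> 1"
  using smooth_step_mono[of z "max 1 z"] smooth_step_eq_1[of "max 1 z"] by simp

text \<open>The limit at \<open>z = 0\<close> is 0, in accordance with the strict test in
  \<open>step\<close>. Regularised step functions thus converge at every point, including the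
  positions of fronts.\<close>

lemma smooth_step_tendsto:
  "(\<lambda>n. smooth_step (z * real (Suc n))) \<longlonglongrightarrow> (if 0 < z then 1 else 0)"
proof (cases "0 < z")
  case True
  obtain N where N: "1 / z < real N" using reals_Archimedean2 by blast
  have "eventually (\<lambda>n. smooth_step (z * real (Suc n)) = 1) sequentially"
    using eventually_ge_at_top[of N]
  proof eventually_elim
    case (elim n)
    then have "1 / z \<le> real (Suc n)" using N by linarith
    then show ?case using True by (intro smooth_step_eq_1) (simp add: field_simps)
  qed
  then show ?thesis using True by (simp add: tendsto_eventually)
next
  case False
  then show ?thesis by (simp add: smooth_step_eq_0 mult_nonpos_nonneg)
qed

lemma integral_hat:
  "integrable lborel hat" "(\<integral>z. hat z \<partial>lborel) = 1"
proof -
  have *: "hat = (\<lambda>z. hat z * indicator {0..1} z)"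
  proof
    show "hat z = hat z * indicator {0..1} z" for z
      by (cases "z \<le> 0 \<or> 1 \<le> z") (simp_all add: hat_eq_0 indicator_def)
  qed
  have "has_bochner_integral lborel (\<lambda>z. hat z * indicator {0..1} z) (smooth_step 1 - smooth_step 0)"
    by (rule has_bochner_integral_FTC_Icc_nonneg)
      (auto intro!: derivative_eq_intros hat_nonneg borel_measurable_continuous_onI continuous_intros)
  then have "has_bochner_integral lborel hat 1"
    using * by (simp add: smooth_step_eq_0 smooth_step_eq_1)
  then show "integrable lborel hat" "(\<integral>z. hat z \<partial>lborel) = 1"
    by (auto simp: has_bochner_integral_iff)
qed

definition kruzhkov_flux :: "(real \<Rightarrow> real) \<Rightarrow> real \<Rightarrow> real \<Rightarrow> real" where
  "kruzhkov_flux f w k = sgn (w - k) * (f w - f k)"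

text \<open>Fubini's theorem needs a Borel function \<open>v\<close>; it represents \<open>u t\<close> only for almost every t.\<close>

locale borel_entropy_solution =
  fixes f :: "real \<Rightarrow> real" and u :: "real \<Rightarrow> real \<Rightarrow> real" and v :: "real \<times> real \<Rightarrow> real" and M :: real
  assumes v_measurable [measurable]: "v \<in> borel_measurable borel"
    and v_bound: "\<bar>v p\<bar> \<le> M"
    and v_eq: "AE t in lborel. 0 < t \<longrightarrow> (AE x in lborel. u t x = v (t, x))"
    and continuous_u: "continuous_L1loc u"
    and continuous_f: "continuous_on UNIV f"
    and entropy: "test_function \<phi> \<phi>t \<phi>x \<Longrightarrow>
      0 \<le> (\<integral>p. \<bar>v p - k\<bar> * \<phi>t p + kruzhkov_flux f (v p) k * \<phi>x p \<partial>lborel)"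

section \<open>Passing to a bounded Borel representative\<close>

lemma has_derivative_zero_on_open:
  assumes "(\<phi> has_derivative (\<lambda>(h, k). h * a + k * b)) (at p)"
    and "open S" "p \<in> S" "\<And>q. q \<in> S \<Longrightarrow> \<phi> q = (0::real)"
  shows "a = 0" "b = (0::real)"
proof -
  have "((\<lambda>_. 0) has_derivative (\<lambda>(h, k). h * a + k * b)) (at p)"
    by (rule has_derivative_transform_within_open[OF assms(1-3)]) (use assms in auto)
  then have "(\<lambda>(h, k). h * a + k * b) = (\<lambda>_. 0)"
    using has_derivative_const has_derivative_unique by blast
  from fun_cong[OF this, of "(1, 0)"] fun_cong[OF this, of "(0, 1)"]
  show "a = 0" "b = 0" by auto
qed

text \<open>Outside the compact support, an open set, the function vanishes identically. This turns
  the entropy integral over the half plane into one over the whole plane, whatever \<open>v\<close>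
  is elsewhere.\<close>

lemma test_function_derivs_zero:
  assumes "test_function \<phi> \<phi>t \<phi>x" "p \<notin> half_plane"
  shows "\<phi>t p = 0" "\<phi>x p = 0"
proof -
  obtain K where K: "compact K" "K \<subseteq> half_plane" "\<And>p. p \<notin> K \<Longrightarrow> \<phi> p = 0"
    and der: "(\<phi> has_derivative (\<lambda>(h, k). h * \<phi>t p + k * \<phi>x p)) (at p)"
    using assms(1) unfolding test_function_def by blast
  have o: "open (- K)" "p \<in> - K" using K assms(2) by (auto simp: compact_imp_closed)
  show "\<phi>t p = 0" "\<phi>x p = 0"
    using has_derivative_zero_on_open[OF der o] K(3) by blast+
qed

lemma entropy_solution_borel:
  assumes u: "entropy_solution f u0 u" and f: "continuous_on UNIV f"
  obtains v M where "borel_entropy_solution f u v M"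
proof -
  define U where "U = (\<lambda>p. u (fst p) (snd p))"
  have hp: "half_plane \<in> sets borel" by (intro borel_open open_Times) auto
  have Um: "U \<in> borel_measurable (lebesgue_on half_plane)"
    using u by (simp add: entropy_solution_def U_def split_beta')
  obtain M where M: "AE p in lebesgue_on half_plane. \<bar>U p\<bar> \<le> M"
    using u by (auto simp: entropy_solution_def U_def split_beta')
  have hpl: "half_plane \<inter> space lebesgue \<in> sets lebesgue" using hp by auto
  have "(\<lambda>p. indicator half_plane p *\<^sub>R U p) \<in> borel_measurable lebesgue"
    using Um hpl by (simp only: borel_measurable_restrict_space_iff)
  then obtain g where g: "g \<in> borel_measurable lborel"
    "AE p in lborel. indicator half_plane p *\<^sub>R U p = g p"
    using completion_ex_borel_measurable_real by blast
  \<comment> \<open>Truncating \<open>g\<close> at this level alters it only on a null set within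
    the half plane and gives a bound at every point. The absolute value puts the truncation levels
    in order without a discussion of the sign of \<open>M\<close>.\<close>
  define N where "N = \<bar>M\<bar>"
  define v where "v p = max (- N) (min N (g p))" for p
  have vm[measurable]: "v \<in> borel_measurable borel" using g(1) unfolding v_def by simp
  have M': "AE p in lborel. p \<in> half_plane \<longrightarrow> \<bar>U p\<bar> \<le> M"
    using M hpl by (simp add: AE_restrict_space_iff AE_completion_iff)
  have Uv: "AE p in lborel. p \<in> half_plane \<longrightarrow> U p = v p"
    using g(2) M' by eventually_elim (auto simp: v_def N_def)
  show ?thesis
  proof (rule that, unfold_locales)
    show "v \<in> borel_measurable borel" by fact
    show "\<bar>v p\<bar> \<le> N" for p by (auto simp: v_def N_def)
    have "AE p in lborel \<Otimes>\<^sub>M lborel. p \<in> half_plane \<longrightarrow> U p = v p"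
      using Uv by (subst lborel_prod)
    then have "AE t in lborel. AE x in lborel. (t, x) \<in> half_plane \<longrightarrow> U (t, x) = v (t, x)"
      by (rule lborel_pair.AE_pair)
    then show "AE t in lborel. 0 < t \<longrightarrow> (AE x in lborel. u t x = v (t, x))"
      by eventually_elim (auto simp: U_def)
    show "continuous_L1loc u" "continuous_on UNIV f"
      using u f by (auto simp: entropy_solution_def)
    fix \<phi> \<phi>t \<phi>x k assume t: "test_function \<phi> \<phi>t \<phi>x"
    then have cont: "continuous_on UNIV \<phi>t" "continuous_on UNIV \<phi>x" by (auto simp: test_function_def)
    have [measurable]: "\<phi>t \<in> borel_measurable borel" "\<phi>x \<in> borel_measurable borel"
      using cont by (auto intro: borel_measurable_continuous_onI)
    have [measurable]: "f \<in> borel_measurable borel" using f by (rule borel_measurable_continuous_onI)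
    define F where "F w p = \<bar>w - k\<bar> * \<phi>t p + kruzhkov_flux f w k * \<phi>x p" for w p
    have phm: "\<phi>t \<in> borel_measurable (lebesgue_on half_plane)" "\<phi>x \<in> borel_measurable (lebesgue_on half_plane)"
      by (auto intro!: measurable_restrict_space1 measurable_completion)
    have Fm: "(\<lambda>p. F (U p) p) \<in> borel_measurable (lebesgue_on half_plane)"
    proof -
      have "(\<lambda>p. f (U p)) \<in> borel_measurable (lebesgue_on half_plane)"
        using Um by measurable
      then show ?thesis using phm Um unfolding F_def kruzhkov_flux_def by measurable
    qed
    have Fv: "(\<lambda>p. F (v p) p) \<in> borel_measurable lborel"
      unfolding F_def kruzhkov_flux_def by measurable
    have "0 \<le> (LINT p|lebesgue_on half_plane. F (U p) p)"
      using u t by (auto simp: entropy_solution_def F_def U_def kruzhkov_flux_def split_beta')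
    also have "\<dots> = (LINT p|lebesgue. indicator half_plane p *\<^sub>R F (U p) p)"
      by (rule integral_restrict_space[OF hpl])
    also have "\<dots> = (LINT p|lebesgue. F (v p) p)"
    proof (rule integral_cong_AE)
      show "(\<lambda>p. indicator half_plane p *\<^sub>R F (U p) p) \<in> borel_measurable lebesgue"
        using Fm hpl by (simp only: borel_measurable_restrict_space_iff)
      show "(\<lambda>p. F (v p) p) \<in> borel_measurable lebesgue"
        using Fv by (rule measurable_completion)
      have "F w p = 0" if "p \<notin> half_plane" for w p
        using test_function_derivs_zero[OF t that] by (simp add: F_def)
      then show "AE p in lebesgue. indicator half_plane p *\<^sub>R F (U p) p = F (v p) p"
        using AE_completion[OF Uv] by (auto simp: indicator_def)
    qed
    also have "\<dots> = (LINT p|lborel. F (v p) p)"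
      by (rule integral_completion[OF Fv])
    finally show "0 \<le> (\<integral>p. \<bar>v p - k\<bar> * \<phi>t p + kruzhkov_flux f (v p) k * \<phi>x p \<partial>lborel)"
      by (simp add: F_def)
  qed
qed

lemma integrable_bounded_box:
  fixes g :: "real \<times> real \<Rightarrow> real"
  assumes g: "g \<in> borel_measurable borel" and B: "\<And>p. \<bar>g p\<bar> \<le> B"
    and Q: "\<And>t x. \<not> (a \<le> t \<and> t \<le> b \<and> \<bar>x\<bar> \<le> R) \<Longrightarrow> g (t, x) = 0"
  shows "integrable lborel g"
proof (rule Bochner_Integration.integrable_bound)
  show "integrable lborel (\<lambda>p. B * indicator (cbox (a, - R) (b, R)) p)"
    by (intro integrable_mult_right integrable_real_indicator) (auto simp: emeasure_lborel_cbox_eq)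
  show "g \<in> borel_measurable lborel" using g by simp
  have "0 \<le> B" using B[of undefined] by linarith
  then have "\<bar>g (t, x)\<bar> \<le> B * indicator (cbox (a, - R) (b, R)) (t, x)" for t x
    using B[of "(t, x)"] Q[of t x]
    by (cases "a \<le> t \<and> t \<le> b \<and> \<bar>x\<bar> \<le> R") (auto simp: indicator_def)
  then show "AE p in lborel. norm (g p) \<le> norm (B * indicator (cbox (a, - R) (b, R)) p)"
    using \<open>0 \<le> B\<close> by (auto simp: abs_mult)
qed

text \<open>An approximate identity with moving centre. The substitution
  \<open>t = d n + h n * z\<close> shifts the dependence on \<open>n\<close> into the argument of
  the bounded continuous function \<open>A\<close>.\<close>

lemma hat_delta_tendsto:
  fixes A :: "real \<Rightarrow> real"
  assumes A: "continuous_on UNIV A" and B: "\<And>t. \<bar>A t\<bar> \<le> B"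
    and h: "\<And>n. h n > 0" "h \<longlonglongrightarrow> 0" and d: "d \<longlonglongrightarrow> c"
  shows "(\<lambda>n. \<integral>t. hat ((t - d n) / h n) / h n * A t \<partial>lborel) \<longlonglongrightarrow> A c"
proof -
  have [measurable]: "A \<in> borel_measurable borel" "hat \<in> borel_measurable borel"
    using A by (auto intro!: borel_measurable_continuous_onI continuous_intros)
  have eq: "(\<integral>t. hat ((t - d n) / h n) / h n * A t \<partial>lborel) = (\<integral>z. hat z * A (d n + h n * z) \<partial>lborel)" for n
  proof -
    have "(\<integral>t. hat ((t - d n) / h n) / h n * A t \<partial>lborel)
      = \<bar>h n\<bar> *\<^sub>R (\<integral>z. hat ((d n + h n * z - d n) / h n) / h n * A (d n + h n * z) \<partial>lborel)"
      using h(1)[of n]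
        lborel_integral_real_affine[of "h n" "\<lambda>t. hat ((t - d n) / h n) / h n * A t" "d n"]
      by simp
    also have "\<dots> = (\<integral>z. \<bar>h n\<bar> * (hat ((d n + h n * z - d n) / h n) / h n * A (d n + h n * z)) \<partial>lborel)"
      by simp
    also have "\<dots> = (\<integral>z. hat z * A (d n + h n * z) \<partial>lborel)"
      using h(1)[of n] by (intro Bochner_Integration.integral_cong) auto
    finally show ?thesis .
  qed
  have "(\<lambda>n. \<integral>z. hat z * A (d n + h n * z) \<partial>lborel) \<longlonglongrightarrow> (\<integral>z. hat z * A c \<partial>lborel)"
  proof (rule integral_dominated_convergence[where w = "\<lambda>z. hat z * B"])
    show "integrable lborel (\<lambda>z. hat z * B)" using integral_hat(1) by simp
    have "(\<lambda>n. A (d n + h n * z)) \<longlonglongrightarrow> A c" for z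
    proof -
      have "(\<lambda>n. d n + h n * z) \<longlonglongrightarrow> c + 0 * z" by (intro tendsto_intros d h)
      then have "(\<lambda>n. d n + h n * z) \<longlonglongrightarrow> c" by simp
      moreover have "isCont A c" using A by (simp add: continuous_on_eq_continuous_at)
      ultimately show ?thesis by (rule isCont_tendsto_compose[rotated])
    qed
    then show "AE z in lborel. (\<lambda>n. hat z * A (d n + h n * z)) \<longlonglongrightarrow> hat z * A c"
      by (auto intro!: tendsto_intros)
    show "AE z in lborel. norm (hat z * A (d n + h n * z)) \<le> hat z * B" for n
      using B hat_nonneg by (auto simp: abs_mult intro!: mult_left_mono)
  qed auto
  then show ?thesis unfolding eq using integral_hat(2) by simp
qed

lemma continuous_bounded_box:
  fixes g :: "real \<times> real \<Rightarrow> real"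
  assumes "continuous_on UNIV g"
  obtains B where "0 \<le> B" "\<And>t x. t \<in> {a..b} \<Longrightarrow> x \<in> {c..d} \<Longrightarrow> \<bar>g (t, x)\<bar> \<le> B"
proof -
  have "compact (g ` ({a..b} \<times> {c..d}))"
    using assms by (intro compact_continuous_image compact_Times) (auto intro: continuous_on_subset)
  then have "bounded (g ` ({a..b} \<times> {c..d}))" by (rule compact_imp_bounded)
  then obtain B where "\<forall>p\<in>{a..b} \<times> {c..d}. \<bar>g p\<bar> \<le> B" by (auto simp: bounded_iff)
  then show ?thesis using that[of "max 0 B"] by (auto simp: le_max_iff_disj)
qed

context borel_entropy_solution
begin

lemma weighted_integrable:
  assumes t: "0 \<le> t" and g: "continuous_on UNIV g" and R: "\<And>x. R < \<bar>x\<bar> \<Longrightarrow> g x = 0"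
  shows "integrable lebesgue (\<lambda>x. g x * \<bar>u t x - k\<bar>)"
proof -
  define r where "r = max R 1"
  have r: "r > 0" "\<And>x. r < \<bar>x\<bar> \<Longrightarrow> g x = 0" using R by (auto simp: r_def)
  have "set_integrable lebesgue {-r..r} (u t)"
    using continuous_u t r(1) by (auto simp: continuous_L1loc_def locally_integrable_def)
  moreover have "set_integrable lebesgue {-r..r} (\<lambda>x. k)"
    unfolding set_integrable_def by (auto intro!: integrable_mult_left integrable_real_indicator
        simp: emeasure_lborel_Icc_eq)
  ultimately have "set_integrable lebesgue {-r..r} (\<lambda>x. \<bar>u t x - k\<bar>)"
    by (intro set_integrable_abs set_integral_diff)
  then have int: "integrable lebesgue (\<lambda>x. indicator {-r..r} x * \<bar>u t x - k\<bar>)"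
    by (simp add: set_integrable_def)
  obtain B where B: "\<And>x. x \<in> {-r..r} \<Longrightarrow> \<bar>g x\<bar> \<le> B"
  proof -
    have "compact (g ` {-r..r})"
      using g by (intro compact_continuous_image) (auto intro: continuous_on_subset)
    then have "bounded (g ` {-r..r})" by (rule compact_imp_bounded)
    then obtain B where "\<forall>x\<in>{-r..r}. \<bar>g x\<bar> \<le> B" by (auto simp: bounded_iff)
    then show ?thesis using that[of B] by auto
  qed
  have gm: "g \<in> borel_measurable lebesgue"
    using borel_measurable_continuous_onI[OF g] by (auto intro: measurable_completion)
  have eq: "(\<lambda>x. g x * \<bar>u t x - k\<bar>) = (\<lambda>x. g x * (indicator {-r..r} x * \<bar>u t x - k\<bar>))"
  proof
    show "g x * \<bar>u t x - k\<bar> = g x * (indicator {-r..r} x * \<bar>u t x - k\<bar>)" for x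
      by (cases "\<bar>x\<bar> \<le> r") (auto simp: r(2) indicator_def)
  qed
  show ?thesis unfolding eq
  proof (rule Bochner_Integration.integrable_bound[OF integrable_mult_right[OF int, of B]])
    show "(\<lambda>x. g x * (indicator {-r..r} x * \<bar>u t x - k\<bar>)) \<in> borel_measurable lebesgue"
      by (rule borel_measurable_times[OF gm borel_measurable_integrable[OF int]])
    have "\<bar>g x\<bar> * (indicator {-r..r} x * \<bar>u t x - k\<bar>) \<le> \<bar>B\<bar> * (indicator {-r..r} x * \<bar>u t x - k\<bar>)" for x
    proof (cases "x \<in> {-r..r}")
      case True
      then show ?thesis using B[of x] by (intro mult_right_mono) auto
    qed simp
    then show "AE x in lebesgue. norm (g x * (indicator {-r..r} x * \<bar>u t x - k\<bar>))
        \<le> norm (B * (indicator {-r..r} x * \<bar>u t x - k\<bar>))"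
      by (auto simp: abs_mult indicator_def)
  qed
qed

text \<open>The change in time is split in two: first the weight varies with \<open>u t\<close>
  fixed, by dominated convergence; then \<open>u\<close> varies under a bounded weight, by
  continuity in L1loc.\<close>

lemma weighted_continuous:
  assumes ab: "0 \<le> a" and \<Phi>: "continuous_on UNIV \<Phi>"
    and R: "\<And>t x. a \<le> t \<Longrightarrow> t \<le> b \<Longrightarrow> R < \<bar>x\<bar> \<Longrightarrow> \<Phi> (t, x) = 0"
  shows "continuous_on {a..b} (\<lambda>t. LINT x|lebesgue. \<Phi> (t, x) * \<bar>u t x - k\<bar>)"
  unfolding continuous_on_sequentially comp_def
proof (intro allI ballI impI)
  fix \<tau> t assume t: "t \<in> {a..b}" and \<tau>: "(\<forall>n. \<tau> n \<in> {a..b}) \<and> \<tau> \<longlonglongrightarrow> t"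
  define r where "r = max R 1"
  have r: "r > 0" "\<And>t x. a \<le> t \<Longrightarrow> t \<le> b \<Longrightarrow> r < \<bar>x\<bar> \<Longrightarrow> \<Phi> (t, x) = 0" using R by (auto simp: r_def)
  obtain B where "0 \<le> B" and B: "\<And>t x. t \<in> {a..b} \<Longrightarrow> x \<in> {-r..r} \<Longrightarrow> \<bar>\<Phi> (t, x)\<bar> \<le> B"
    using continuous_bounded_box[OF \<Phi>, of a b "-r" r] by blast
  have slice: "continuous_on UNIV (\<lambda>x. \<Phi> (s, x))" for s
    by (rule continuous_on_compose2[OF \<Phi>]) (auto intro!: continuous_intros)
  have int: "integrable lebesgue (\<lambda>x. \<Phi> (s, x) * \<bar>u s' x - k\<bar>)" if "s \<in> {a..b}" "s' \<ge> 0" for s s'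
    using that r by (intro weighted_integrable[OF _ slice]) auto
  have setint: "set_integrable lebesgue {-r..r} (u s)" if "s \<ge> 0" for s
    using continuous_u that r(1) by (auto simp: continuous_L1loc_def locally_integrable_def)
  have diffint: "integrable lebesgue (\<lambda>x. indicator {-r..r} x * \<bar>u s x - u s' x\<bar>)" if "s \<ge> 0" "s' \<ge> 0" for s s'
    using set_integrable_abs[OF set_integral_diff(1)[OF setint setint], OF that] by (simp add: set_integrable_def)
  define I where "I n = (LINT x|lebesgue. \<Phi> (\<tau> n, x) * \<bar>u t x - k\<bar>)" for n
  have "(\<lambda>n. I n) \<longlonglongrightarrow> (LINT x|lebesgue. \<Phi> (t, x) * \<bar>u t x - k\<bar>)"
    unfolding I_def
  proof (rule integral_dominated_convergence[where w = "\<lambda>x. B * (indicator {-r..r} x * \<bar>u t x - k\<bar>)"])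
    show "(\<lambda>x. \<Phi> (t, x) * \<bar>u t x - k\<bar>) \<in> borel_measurable lebesgue"
      using int[of t t] t ab by auto
    show "(\<lambda>x. \<Phi> (\<tau> n, x) * \<bar>u t x - k\<bar>) \<in> borel_measurable lebesgue" for n
      using int[of "\<tau> n" t] t ab \<tau> by auto
    have "set_integrable lebesgue {-r..r} (\<lambda>x. k)"
      unfolding set_integrable_def by (auto intro!: integrable_mult_left integrable_real_indicator
        simp: emeasure_lborel_Icc_eq)
    then have "set_integrable lebesgue {-r..r} (\<lambda>x. \<bar>u t x - k\<bar>)"
      using setint[of t] t ab by (intro set_integrable_abs set_integral_diff) auto
    then show "integrable lebesgue (\<lambda>x. B * (indicator {-r..r} x * \<bar>u t x - k\<bar>))"
      by (intro integrable_mult_right) (simp add: set_integrable_def)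
    have "(\<lambda>n. \<Phi> (\<tau> n, x)) \<longlonglongrightarrow> \<Phi> (t, x)" for x
      using \<Phi> \<tau> by (intro continuous_on_tendsto_compose[OF \<Phi>] tendsto_intros) auto
    then show "AE x in lebesgue. (\<lambda>n. \<Phi> (\<tau> n, x) * \<bar>u t x - k\<bar>) \<longlonglongrightarrow> \<Phi> (t, x) * \<bar>u t x - k\<bar>"
      by (auto intro!: tendsto_intros)
    have "\<bar>\<Phi> (\<tau> n, x)\<bar> \<le> B * indicator {-r..r} x" for n x
      using B[of "\<tau> n" x] r(2)[of "\<tau> n" x] \<tau> by (force simp: indicator_def)
    from mult_right_mono[OF this, of "\<bar>u t x - k\<bar>" for x]
    show "AE x in lebesgue. norm (\<Phi> (\<tau> n, x) * \<bar>u t x - k\<bar>) \<le> B * (indicator {-r..r} x * \<bar>u t x - k\<bar>)" for n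
      by (auto simp: abs_mult mult.assoc)
  qed
  moreover have "(\<lambda>n. (LINT x|lebesgue. \<Phi> (\<tau> n, x) * \<bar>u (\<tau> n) x - k\<bar>) - I n) \<longlonglongrightarrow> 0"
  proof (rule Lim_null_comparison)
    have "((\<lambda>\<tau>. LINT x:{-r..r}|lebesgue. \<bar>u \<tau> x - u t x\<bar>) \<longlongrightarrow> 0) (at t within {0..})"
      using continuous_u t ab r(1) by (auto simp: continuous_L1loc_def)
    then have "(\<lambda>n. LINT x:{-r..r}|lebesgue. \<bar>u (\<tau> n) x - u t x\<bar>) \<longlonglongrightarrow> 0"
    proof -
      define F where "F s = (LINT x:{-r..r}|lebesgue. \<bar>u s x - u t x\<bar>)" for s
      \<comment> \<open>The given limit excludes the time \<open>t\<close> itself, whereas the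
        sequence \<open>\<tau>\<close> may take this value; knowing \<open>F t\<close> upgrades the
        limit to continuity.\<close>
      have "F t = 0" by (simp add: F_def set_lebesgue_integral_def)
      assume "((\<lambda>\<tau>. LINT x:{-r..r}|lebesgue. \<bar>u \<tau> x - u t x\<bar>) \<longlongrightarrow> 0) (at t within {0..})"
      then have "continuous (at t within {0..}) F"
        using \<open>F t = 0\<close> by (simp add: continuous_within F_def[abs_def])
      then have "(\<lambda>n. F (\<tau> n)) \<longlonglongrightarrow> F t"
        using \<tau> ab unfolding continuous_within_sequentially comp_def by (auto intro: order_trans)
      then show ?thesis using \<open>F t = 0\<close> by (simp add: F_def)
    qed
    from tendsto_mult_left[OF this, of B]
    show "(\<lambda>n. B * (LINT x:{-r..r}|lebesgue. \<bar>u (\<tau> n) x - u t x\<bar>)) \<longlonglongrightarrow> 0" by simp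
    have "norm ((LINT x|lebesgue. \<Phi> (\<tau> n, x) * \<bar>u (\<tau> n) x - k\<bar>) - I n)
        \<le> B * (LINT x:{-r..r}|lebesgue. \<bar>u (\<tau> n) x - u t x\<bar>)" for n
    proof -
      have n: "\<tau> n \<in> {a..b}" "0 \<le> \<tau> n" "0 \<le> t" using \<tau> t ab by (auto intro: order_trans)
      have "norm ((LINT x|lebesgue. \<Phi> (\<tau> n, x) * \<bar>u (\<tau> n) x - k\<bar>) - I n)
        = norm (LINT x|lebesgue. \<Phi> (\<tau> n, x) * \<bar>u (\<tau> n) x - k\<bar> - \<Phi> (\<tau> n, x) * \<bar>u t x - k\<bar>)"
        unfolding I_def using int n by simp
      also have "\<dots> \<le> (LINT x|lebesgue. norm (\<Phi> (\<tau> n, x) * \<bar>u (\<tau> n) x - k\<bar> - \<Phi> (\<tau> n, x) * \<bar>u t x - k\<bar>))"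
        by (rule integral_norm_bound)
      also have "\<dots> \<le> (LINT x|lebesgue. B * (indicator {-r..r} x * \<bar>u (\<tau> n) x - u t x\<bar>))"
      proof (rule integral_mono)
        show "integrable lebesgue (\<lambda>x. norm (\<Phi> (\<tau> n, x) * \<bar>u (\<tau> n) x - k\<bar> - \<Phi> (\<tau> n, x) * \<bar>u t x - k\<bar>))"
          using int n by simp
        show "integrable lebesgue (\<lambda>x. B * (indicator {-r..r} x * \<bar>u (\<tau> n) x - u t x\<bar>))"
          using diffint n by simp
        show "norm (\<Phi> (\<tau> n, x) * \<bar>u (\<tau> n) x - k\<bar> - \<Phi> (\<tau> n, x) * \<bar>u t x - k\<bar>)
          \<le> B * (indicator {-r..r} x * \<bar>u (\<tau> n) x - u t x\<bar>)" for x
        proof -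
          have "\<bar>\<Phi> (\<tau> n, x)\<bar> \<le> B * indicator {-r..r} x"
            using B[of "\<tau> n" x] r(2)[of "\<tau> n" x] n by (force simp: indicator_def)
          then have "\<bar>\<Phi> (\<tau> n, x)\<bar> * \<bar>\<bar>u (\<tau> n) x - k\<bar> - \<bar>u t x - k\<bar>\<bar>
            \<le> (B * indicator {-r..r} x) * \<bar>u (\<tau> n) x - u t x\<bar>"
            using \<open>0 \<le> B\<close> by (intro mult_mono) auto
          then show ?thesis by (simp add: abs_mult flip: right_diff_distrib)
        qed
      qed
      also have "\<dots> = B * (LINT x:{-r..r}|lebesgue. \<bar>u (\<tau> n) x - u t x\<bar>)"
        by (simp add: set_lebesgue_integral_def)
      finally show ?thesis .
    qed
    then show "eventually (\<lambda>n. norm ((LINT x|lebesgue. \<Phi> (\<tau> n, x) * \<bar>u (\<tau> n) x - k\<bar>) - I n)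
        \<le> B * (LINT x:{-r..r}|lebesgue. \<bar>u (\<tau> n) x - u t x\<bar>)) sequentially"
      by simp
  qed
  ultimately show "(\<lambda>n. LINT x|lebesgue. \<Phi> (\<tau> n, x) * \<bar>u (\<tau> n) x - k\<bar>)
      \<longlonglongrightarrow> (LINT x|lebesgue. \<Phi> (t, x) * \<bar>u t x - k\<bar>)"
    using tendsto_add by fastforce
qed

end

section \<open>The entropy inequality on a time interval\<close>

text \<open>A C1 plateau: for \<open>c + h \<le> d\<close> it rises on \<open>[c, c + h]\<close>,
  equals 1 up to \<open>d\<close> and falls on \<open>[d, d + h]\<close>.\<close>

definition ramp :: "real \<Rightarrow> real \<Rightarrow> real \<Rightarrow> real \<Rightarrow> real" where
  "ramp h c d t = smooth_step ((t - c) / h) - smooth_step ((t - d) / h)"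

definition ramp' :: "real \<Rightarrow> real \<Rightarrow> real \<Rightarrow> real \<Rightarrow> real" where
  "ramp' h c d t = hat ((t - c) / h) / h - hat ((t - d) / h) / h"

lemma has_real_derivative_ramp:
  "h > 0 \<Longrightarrow> (ramp h c d has_real_derivative ramp' h c d t) (at t)"
  unfolding ramp_def[abs_def] ramp'_def by (auto intro!: derivative_eq_intros)

lemma continuous_on_ramp: "h > 0 \<Longrightarrow> continuous_on A (ramp h c d)"
  unfolding ramp_def[abs_def] by (auto intro!: continuous_intros)

lemma continuous_on_ramp': "h > 0 \<Longrightarrow> continuous_on A (ramp' h c d)"
  unfolding ramp'_def[abs_def] by (auto intro!: continuous_intros)

lemma ramp_bounds: "h > 0 \<Longrightarrow> c \<le> d \<Longrightarrow> 0 \<le> ramp h c d t \<and> ramp h c d t \<le> 1"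
  unfolding ramp_def
  using smooth_step_mono[of "(t - d) / h" "(t - c) / h"] smooth_step_nonneg[of "(t - d) / h"]
    smooth_step_le_1[of "(t - c) / h"]
  by (auto simp: divide_right_mono)

lemma ramp_eq_0: "h > 0 \<Longrightarrow> c \<le> d \<Longrightarrow> t \<le> c \<or> d + h \<le> t \<Longrightarrow> ramp h c d t = 0 \<and> ramp' h c d t = 0"
  by (auto simp: ramp_def ramp'_def smooth_step_eq_0 smooth_step_eq_1 hat_eq_0 field_simps)

lemma ramp_eq_1: "h > 0 \<Longrightarrow> c + h \<le> t \<Longrightarrow> t \<le> d \<Longrightarrow> ramp h c d t = 1"
  by (simp add: ramp_def smooth_step_eq_0 smooth_step_eq_1 field_simps)

context borel_entropy_solution
begin

lemma f_measurable [measurable]: "f \<in> borel_measurable borel"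
  using continuous_f by (rule borel_measurable_continuous_onI)

lemma kruzhkov_flux_bound:
  obtains B where "0 \<le> B" "\<And>p. \<bar>kruzhkov_flux f (v p) k\<bar> \<le> B"
proof -
  have "compact (f ` {-M..M})"
    using continuous_f by (intro compact_continuous_image) (auto intro: continuous_on_subset)
  then have "bounded (f ` {-M..M})" by (rule compact_imp_bounded)
  then obtain B where B: "\<forall>w\<in>{-M..M}. \<bar>f w\<bar> \<le> B" by (auto simp: bounded_iff)
  have "\<bar>kruzhkov_flux f (v p) k\<bar> \<le> max 0 (B + \<bar>f k\<bar>)" for p
  proof -
    have "v p \<in> {-M..M}" using v_bound[of p] by auto
    then have "\<bar>f (v p)\<bar> \<le> B" using B by blast
    then show ?thesis by (auto simp: kruzhkov_flux_def abs_mult sgn_if)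
  qed
  then show ?thesis using that[of "max 0 (B + \<bar>f k\<bar>)"] by simp
qed

text \<open>The entropy inequality is tested with \<open>\<theta> t * \<Phi> (t, x)\<close>, where \<open>\<theta>\<close> tends to the
  indicator function of \<open>{a<..<b}\<close>; the continuity of \<open>u\<close> in time turns \<open>\<theta>'\<close> into the two
  boundary terms.\<close>

lemma entropy_inequality_interval:
  fixes a b k R :: real and \<Phi> \<Phi>t \<Phi>x :: "real \<times> real \<Rightarrow> real"
  assumes ab: "0 \<le> a" "a < b"
    and der: "\<And>p. (\<Phi> has_derivative (\<lambda>(h, k). h * \<Phi>t p + k * \<Phi>x p)) (at p)"
    and cont: "continuous_on UNIV \<Phi>t" "continuous_on UNIV \<Phi>x"
    and nonneg: "\<And>t x. a \<le> t \<Longrightarrow> t \<le> b \<Longrightarrow> 0 \<le> \<Phi> (t, x)"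
    and R: "\<And>t x. a \<le> t \<Longrightarrow> t \<le> b \<Longrightarrow> R < \<bar>x\<bar> \<Longrightarrow> \<Phi> (t, x) = 0"
  defines "J \<equiv> \<lambda>p. indicator ({a<..<b} \<times> UNIV) p *
      (\<bar>v p - k\<bar> * \<Phi>t p + kruzhkov_flux f (v p) k * \<Phi>x p)"
  shows "integrable lborel J"
    and "(LINT x|lebesgue. \<Phi> (b, x) * \<bar>u b x - k\<bar>) - (LINT x|lebesgue. \<Phi> (a, x) * \<bar>u a x - k\<bar>)
      \<le> (\<integral>p. J p \<partial>lborel)"
proof -
  have c\<Phi>: "continuous_on UNIV \<Phi>"
    using der by (auto intro!: continuous_at_imp_continuous_on has_derivative_continuous)
  have [measurable]: "\<Phi> \<in> borel_measurable borel" "\<Phi>t \<in> borel_measurable borel" "\<Phi>x \<in> borel_measurable borel"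
    using c\<Phi> cont by (auto intro: borel_measurable_continuous_onI)
  obtain B0 where B0: "0 \<le> B0" "\<And>t x. t \<in> {a..b} \<Longrightarrow> x \<in> {-R..R} \<Longrightarrow> \<bar>\<Phi> (t, x)\<bar> \<le> B0"
    using continuous_bounded_box[OF c\<Phi>, of a b "-R" R] by blast
  obtain B1 where B1: "0 \<le> B1" "\<And>t x. t \<in> {a..b} \<Longrightarrow> x \<in> {-R..R} \<Longrightarrow> \<bar>\<Phi>t (t, x)\<bar> \<le> B1"
    using continuous_bounded_box[OF cont(1), of a b "-R" R] by blast
  obtain B2 where B2: "0 \<le> B2" "\<And>t x. t \<in> {a..b} \<Longrightarrow> x \<in> {-R..R} \<Longrightarrow> \<bar>\<Phi>x (t, x)\<bar> \<le> B2"
    using continuous_bounded_box[OF cont(2), of a b "-R" R] by blast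
  obtain Q where Q: "0 \<le> Q" "\<And>p. \<bar>kruzhkov_flux f (v p) k\<bar> \<le> Q"
    using kruzhkov_flux_bound[of k] by blast
  define C where "C = (M + \<bar>k\<bar>) * B1 + Q * B2"
  have vk: "\<bar>v p - k\<bar> \<le> M + \<bar>k\<bar>" for p using v_bound[of p] by linarith
  have M0: "0 \<le> M" using v_bound[of undefined] by linarith
  \<comment> \<open>\<open>\<Phi>\<close> vanishes on an open set around such a point, hence so do
    its derivatives there; the support of \<open>\<Phi>\<close> is controlled only for times in
    \<open>[a, b]\<close>.\<close>
  have zero: "\<Phi>t (t, x) = 0" "\<Phi>x (t, x) = 0" if "a < t" "t < b" "R < \<bar>x\<bar>" for t x
  proof -
    have o: "open ({a<..<b} \<times> (-{-R..R}))" by (intro open_Times) auto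
    have m: "(t, x) \<in> {a<..<b} \<times> (-{-R..R})" using that by auto
    have z: "\<Phi> q = 0" if "q \<in> {a<..<b} \<times> (-{-R..R})" for q
    proof (cases q)
      case (Pair t' x')
      then have "a < t'" "t' < b" "R < \<bar>x'\<bar>" using that by auto
      then show ?thesis using R[of t' x'] Pair by simp
    qed
    show "\<Phi>t (t, x) = 0" "\<Phi>x (t, x) = 0"
      using has_derivative_zero_on_open[OF der[of "(t, x)"] o m] z by blast+
  qed
  define G where "G p = \<bar>v p - k\<bar> * \<Phi>t p + kruzhkov_flux f (v p) k * \<Phi>x p" for p
  have [measurable]: "G \<in> borel_measurable borel" unfolding G_def kruzhkov_flux_def by measurable
  have G: "\<bar>G (t, x)\<bar> \<le> C" if "a < t" "t < b" for t x
  proof (cases "\<bar>x\<bar> \<le> R")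
    case True
    have "\<bar>v (t, x) - k\<bar> * \<bar>\<Phi>t (t, x)\<bar> \<le> (M + \<bar>k\<bar>) * B1"
      using that True vk M0 by (intro mult_mono B1) auto
    moreover have "\<bar>kruzhkov_flux f (v (t, x)) k\<bar> * \<bar>\<Phi>x (t, x)\<bar> \<le> Q * B2"
      using that True Q by (intro mult_mono B2) auto
    ultimately show ?thesis unfolding G_def C_def
      by (intro order_trans[OF abs_triangle_ineq] add_mono) (auto simp: abs_mult)
  next
    case False
    then show ?thesis using zero that B1 B2 Q M0 by (simp add: G_def C_def)
  qed
  have C0: "0 \<le> C" using B1 B2 Q M0 by (simp add: C_def)
  have G0: "G (t, x) = 0" if "a < t" "t < b" "R < \<bar>x\<bar>" for t x
    using zero that by (simp add: G_def)
  have JG: "J p = indicator ({a<..<b} \<times> UNIV) p * G p" for p by (simp add: J_def G_def)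
  show "integrable lborel J" unfolding JG
  proof (rule integrable_bounded_box[where B = C and a = a and b = b and R = R])
    show "(\<lambda>p. indicator ({a<..<b} \<times> UNIV) p * G p) \<in> borel_measurable borel"
    proof -
      have "open ({a<..<b} \<times> (UNIV :: real set))" by (intro open_Times) auto
      then show ?thesis by (intro borel_measurable_times borel_measurable_indicator borel_open) auto
    qed
    show "\<bar>indicator ({a<..<b} \<times> UNIV) p * G p\<bar> \<le> C" for p
      using G[of "fst p" "snd p"] C0 by (auto simp: indicator_def)
    show "indicator ({a<..<b} \<times> UNIV) (t, x) * G (t, x) = 0" if "\<not> (a \<le> t \<and> t \<le> b \<and> \<bar>x\<bar> \<le> R)" for t x
      using that G0[of t x] by (auto simp: indicator_def)
  qed
  define A where "A t = (LINT x|lebesgue. \<Phi> (t, x) * \<bar>u t x - k\<bar>)" for t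
  \<comment> \<open>The constant extension beyond \<open>[a, b]\<close> is continuous and bounded on
    the whole line, as \<open>hat_delta_tendsto\<close> requires.\<close>
  define A' where "A' t = A (max a (min b t))" for t
  have contA: "continuous_on {a..b} A"
    unfolding A_def using weighted_continuous[OF ab(1) c\<Phi>, of b R k] R by auto
  have contA': "continuous_on UNIV A'"
    unfolding A'_def by (rule continuous_on_compose2[OF contA]) (use ab in \<open>auto intro!: continuous_intros\<close>)
  have [measurable]: "A' \<in> borel_measurable borel" using contA' by (rule borel_measurable_continuous_onI)
  obtain BA where BA: "\<And>t. \<bar>A' t\<bar> \<le> BA"
  proof -
    have "bounded (A ` {a..b})"
      using compact_continuous_image[OF contA] by (auto intro: compact_imp_bounded)
    then obtain B where "\<forall>t\<in>{a..b}. \<bar>A t\<bar> \<le> B" by (auto simp: bounded_iff)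
    then show ?thesis using that[of B] ab by (auto simp: A'_def)
  qed
  \<comment> \<open>\<open>v\<close> represents \<open>u t\<close> only for almost every
    \<open>t\<close>, which is enough under the integral in \<open>t\<close>. The limit then
    involves only the continuous function \<open>A\<close>, so the given times \<open>a\<close> and
    \<open>b\<close> are reached exactly.\<close>
  have slice: "AE t in lborel. a < t \<longrightarrow> t < b \<longrightarrow> (\<integral>x. \<Phi> (t, x) * \<bar>v (t, x) - k\<bar> \<partial>lborel) = A t"
    using v_eq
  proof eventually_elim
    case (elim t)
    show ?case
    proof (intro impI)
      assume t: "a < t" "t < b"
      have c: "continuous_on UNIV (\<lambda>x. \<Phi> (t, x))"
        by (rule continuous_on_compose2[OF c\<Phi>]) (auto intro!: continuous_intros)
      have m: "(\<lambda>x. \<Phi> (t, x) * \<bar>v (t, x) - k\<bar>) \<in> borel_measurable lborel" by measurable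
      have "A t = (LINT x|lebesgue. \<Phi> (t, x) * \<bar>v (t, x) - k\<bar>)"
        unfolding A_def
      proof (rule integral_cong_AE)
        show "(\<lambda>x. \<Phi> (t, x) * \<bar>u t x - k\<bar>) \<in> borel_measurable lebesgue"
          using weighted_integrable[OF _ c, of t R k] R t ab by auto
        show "(\<lambda>x. \<Phi> (t, x) * \<bar>v (t, x) - k\<bar>) \<in> borel_measurable lebesgue"
          using m by (rule measurable_completion)
        have "AE x in lborel. u t x = v (t, x)" using elim t ab by auto
        then show "AE x in lebesgue. \<Phi> (t, x) * \<bar>u t x - k\<bar> = \<Phi> (t, x) * \<bar>v (t, x) - k\<bar>"
          by (intro AE_completion) auto
      qed
      then show "(\<integral>x. \<Phi> (t, x) * \<bar>v (t, x) - k\<bar> \<partial>lborel) = A t"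
        using integral_completion[OF m] by simp
    qed
  qed
  \<comment> \<open>The widths tend to 0, and \<open>a + 2 * h n \<le> b\<close> puts the endpoints
    \<open>a + h n\<close> and \<open>b - h n\<close> of the ramp in order.\<close>
  define h where "h n = (b - a) / 2 / real (Suc n)" for n
  have h: "h n > 0" "a + 2 * h n \<le> b" for n
  proof -
    show "h n > 0" using ab by (simp add: h_def)
    have "h n \<le> (b - a) / 2 / 1" unfolding h_def using ab by (intro divide_left_mono) auto
    then show "a + 2 * h n \<le> b" by simp
  qed
  have h0: "h \<longlonglongrightarrow> 0"
  proof -
    have "(\<lambda>n. (b - a) / 2 * inverse (real (Suc n))) \<longlonglongrightarrow> (b - a) / 2 * 0"
      by (intro tendsto_mult tendsto_const LIMSEQ_inverse_real_of_nat)
    then show ?thesis by (simp only: h_def[abs_def] divide_inverse mult_zero_right)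
  qed
  \<comment> \<open>The rise begins at \<open>a + h n\<close> instead of \<open>a\<close>, so the
    support is compact in the open half plane even for \<open>a = 0\<close>; the fall ends at
    \<open>b\<close>.\<close>
  define \<theta> where "\<theta> n = ramp (h n) (a + h n) (b - h n)" for n
  define \<theta>' where "\<theta>' n = ramp' (h n) (a + h n) (b - h n)" for n
  have \<theta>_b: "0 \<le> \<theta> n t" "\<theta> n t \<le> 1" for n t
    using ramp_bounds[of "h n" "a + h n" "b - h n" t] h[of n] by (auto simp: \<theta>_def)
  have \<theta>_0: "\<theta> n t = 0" "\<theta>' n t = 0" if "t \<le> a + h n \<or> b \<le> t" for n t
    using ramp_eq_0[of "h n" "a + h n" "b - h n" t] h[of n] that by (auto simp: \<theta>_def \<theta>'_def)
  have \<theta>_1: "(\<lambda>n. \<theta> n t) \<longlonglongrightarrow> 1" if "a < t" "t < b" for t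
  proof (rule tendsto_eventually)
    have "eventually (\<lambda>n. h n < min ((t - a) / 2) (b - t)) sequentially"
      using h0 that by (intro order_tendstoD) auto
    then show "eventually (\<lambda>n. \<theta> n t = 1) sequentially"
    proof eventually_elim
      case (elim n)
      then show ?case unfolding \<theta>_def using h[of n] by (intro ramp_eq_1) auto
    qed
  qed
  have [measurable]: "\<theta> n \<in> borel_measurable borel" "\<theta>' n \<in> borel_measurable borel" for n
    unfolding \<theta>_def \<theta>'_def using h
    by (auto intro!: borel_measurable_continuous_onI continuous_on_ramp continuous_on_ramp')
  have mfst: "(fst :: real \<times> real \<Rightarrow> real) \<in> borel_measurable borel"
    by (intro borel_measurable_continuous_onI continuous_on_fst continuous_on_id)
  have m\<theta>: "(\<lambda>p::real\<times>real. \<theta> n (fst p)) \<in> borel_measurable borel"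
    "(\<lambda>p::real\<times>real. \<theta>' n (fst p)) \<in> borel_measurable borel" for n
    by (rule measurable_compose[OF mfst]; measurable)+
  have m\<Phi>v: "(\<lambda>p. \<Phi> p * \<bar>v p - k\<bar>) \<in> borel_measurable borel" by measurable
  have ineq: "0 \<le> (\<integral>t. \<theta>' n t * A' t \<partial>lborel) + (\<integral>p. \<theta> n (fst p) * G p \<partial>lborel)" for n
  proof -
    define \<phi> where "\<phi> p = \<theta> n (fst p) * \<Phi> p" for p
    define \<phi>t where "\<phi>t p = \<theta>' n (fst p) * \<Phi> p + \<theta> n (fst p) * \<Phi>t p" for p
    define \<phi>x where "\<phi>x p = \<theta> n (fst p) * \<Phi>x p" for p
    have int1: "integrable lborel (\<lambda>p. \<theta>' n (fst p) * (\<Phi> p * \<bar>v p - k\<bar>))"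
    proof (rule integrable_bounded_box[where B = "4 / h n * (B0 * (M + \<bar>k\<bar>))" and a = a and b = b and R = R])
      have t': "\<bar>\<theta>' n t\<bar> \<le> 4 / h n" for t
      proof -
        have hb: "hat z / h n \<le> 2 / h n" "0 \<le> hat z / h n" for z
          using h(1)[of n] hat_le hat_nonneg by (auto intro: divide_right_mono)
        have "\<bar>hat z / h n - hat w / h n\<bar> \<le> 2 / h n + 2 / h n" for z w
          unfolding abs_le_iff using hb[of z] hb[of w] by linarith
        then show ?thesis by (simp add: \<theta>'_def ramp'_def)
      qed
      show "\<bar>\<theta>' n (fst p) * (\<Phi> p * \<bar>v p - k\<bar>)\<bar> \<le> 4 / h n * (B0 * (M + \<bar>k\<bar>))" for p
      proof (cases "a < fst p \<and> fst p < b \<and> \<bar>snd p\<bar> \<le> R")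
        case True
        then have "\<bar>\<Phi> (fst p, snd p)\<bar> \<le> B0" by (intro B0(2)) auto
        then have "\<bar>\<theta>' n (fst p)\<bar> * (\<bar>\<Phi> p\<bar> * \<bar>v p - k\<bar>) \<le> 4 / h n * (B0 * (M + \<bar>k\<bar>))"
          using vk B0(1) M0 t' h(1)[of n] by (intro mult_mono) auto
        then show ?thesis by (simp add: abs_mult)
      next
        case False
        then have "\<theta>' n (fst p) = 0 \<or> \<Phi> p = 0"
          using \<theta>_0[of "fst p" n] h[of n] R[of "fst p" "snd p"] by force
        then show ?thesis using B0(1) M0 h(1)[of n] by auto
      qed
      show "\<theta>' n (fst (t, x)) * (\<Phi> (t, x) * \<bar>v (t, x) - k\<bar>) = 0" if "\<not> (a \<le> t \<and> t \<le> b \<and> \<bar>x\<bar> \<le> R)" for t x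
        using that R[of t x] \<theta>_0[of t n] h[of n] by force
    qed (intro borel_measurable_times m\<theta> m\<Phi>v)
    have "test_function \<phi> \<phi>t \<phi>x" unfolding test_function_def
    proof (intro conjI allI)
      fix p :: "real \<times> real"
      have "(\<theta> n has_derivative (\<lambda>x. \<theta>' n (fst p) * x)) (at (fst p))"
        using has_real_derivative_ramp[OF h(1)[of n], of "a + h n" "b - h n" "fst p"]
        by (simp add: \<theta>_def \<theta>'_def has_field_derivative_def)
      moreover have "(fst has_derivative fst) (at p)"
        by (rule has_derivative_fst[OF has_derivative_ident])
      ultimately have "((\<lambda>p. \<theta> n (fst p)) has_derivative (\<lambda>q. \<theta>' n (fst p) * fst q)) (at p)"
        by (rule has_derivative_compose[rotated])
      from has_derivative_mult[OF this der[of p]]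
      show "(\<phi> has_derivative (\<lambda>(h, k). h * \<phi>t p + k * \<phi>x p)) (at p)"
        unfolding \<phi>_def[abs_def] by (rule has_derivative_eq_rhs)
          (auto simp: fun_eq_iff \<phi>t_def \<phi>x_def algebra_simps)
      have "0 \<le> \<Phi> p" if "\<theta> n (fst p) \<noteq> 0"
        using nonneg[of "fst p" "snd p"] that \<theta>_0[of "fst p" n] h[of n] by force
      then show "0 \<le> \<phi> p" using \<theta>_b[of n "fst p"] by (cases "\<theta> n (fst p) = 0") (auto simp: \<phi>_def)
    next
      have c: "continuous_on UNIV (\<lambda>p::real\<times>real. \<theta> n (fst p))" "continuous_on UNIV (\<lambda>p::real\<times>real. \<theta>' n (fst p))"
        unfolding \<theta>_def \<theta>'_def
        by (auto intro!: continuous_on_compose2[OF continuous_on_ramp, of _ UNIV]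
            continuous_on_compose2[OF continuous_on_ramp', of _ UNIV] continuous_intros h)
      show "continuous_on UNIV \<phi>t" "continuous_on UNIV \<phi>x"
        unfolding \<phi>t_def \<phi>x_def by (intro continuous_intros c c\<Phi> cont)+
      have "\<phi> p = 0" if "p \<notin> {a + h n..b} \<times> {-R..R}" for p
        using that \<theta>_0[of "fst p" n] R[of "fst p" "snd p"] h[of n]
        by (cases p) (force simp: \<phi>_def)
      moreover have "{a + h n..b} \<times> {-R..R} \<subseteq> half_plane" using ab h[of n] by auto
      ultimately show "\<exists>K. compact K \<and> K \<subseteq> half_plane \<and> (\<forall>p. p \<notin> K \<longrightarrow> \<phi> p = 0)"
        by (intro exI[of _ "{a + h n..b} \<times> {-R..R}"]) (auto intro: compact_Times)
    qed
    from entropy[OF this, of k]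
    have "0 \<le> (\<integral>p. \<theta>' n (fst p) * (\<Phi> p * \<bar>v p - k\<bar>) + \<theta> n (fst p) * G p \<partial>lborel)"
      by (simp add: \<phi>t_def \<phi>x_def G_def algebra_simps)
    also have "\<dots> = (\<integral>p. \<theta>' n (fst p) * (\<Phi> p * \<bar>v p - k\<bar>) \<partial>lborel) + (\<integral>p. \<theta> n (fst p) * G p \<partial>lborel)"
    proof (rule Bochner_Integration.integral_add)
      show "integrable lborel (\<lambda>p. \<theta> n (fst p) * G p)"
      proof (rule integrable_bounded_box[where B = C and a = a and b = b and R = R])
        show "\<bar>\<theta> n (fst p) * G p\<bar> \<le> C" for p
        proof (cases "a < fst p \<and> fst p < b")
          case True
          then have "\<bar>\<theta> n (fst p)\<bar> * \<bar>G p\<bar> \<le> 1 * C"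
            using G[of "fst p" "snd p"] \<theta>_b[of n "fst p"] by (intro mult_mono) auto
          then show ?thesis by (simp add: abs_mult)
        next
          case False
          then show ?thesis using \<theta>_0[of "fst p" n] C0 h[of n] by force
        qed
        show "\<theta> n (fst (t, x)) * G (t, x) = 0" if "\<not> (a \<le> t \<and> t \<le> b \<and> \<bar>x\<bar> \<le> R)" for t x
          using that G0[of t x] \<theta>_0[of t n] h[of n] by force
      qed (intro borel_measurable_times m\<theta>, measurable)
      show "integrable lborel (\<lambda>p. \<theta>' n (fst p) * (\<Phi> p * \<bar>v p - k\<bar>))" by (rule int1)
    qed
    also have "(\<integral>p. \<theta>' n (fst p) * (\<Phi> p * \<bar>v p - k\<bar>) \<partial>lborel) = (\<integral>t. \<theta>' n t * A' t \<partial>lborel)"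
    proof -
      have "integrable (lborel \<Otimes>\<^sub>M lborel) (\<lambda>p. \<theta>' n (fst p) * (\<Phi> p * \<bar>v p - k\<bar>))"
        using int1 by (subst lborel_prod)
      from lborel_pair.integral_fst'[OF this]
      have "(\<integral>p. \<theta>' n (fst p) * (\<Phi> p * \<bar>v p - k\<bar>) \<partial>lborel)
        = (\<integral>t. (\<integral>x. \<theta>' n t * (\<Phi> (t, x) * \<bar>v (t, x) - k\<bar>) \<partial>lborel) \<partial>lborel)"
        by (simp add: lborel_prod)
      also have "\<dots> = (\<integral>t. \<theta>' n t * (\<integral>x. \<Phi> (t, x) * \<bar>v (t, x) - k\<bar> \<partial>lborel) \<partial>lborel)"
        by simp
      also have "\<dots> = (\<integral>t. \<theta>' n t * A' t \<partial>lborel)"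
      proof (rule integral_cong_AE)
        show "(\<lambda>t. \<theta>' n t * A' t) \<in> borel_measurable lborel"
          by measurable
        show "AE t in lborel. \<theta>' n t * (\<integral>x. \<Phi> (t, x) * \<bar>v (t, x) - k\<bar> \<partial>lborel) = \<theta>' n t * A' t"
          using slice
        proof eventually_elim
          case (elim t)
          show ?case
          proof (cases "a < t \<and> t < b")
            case True
            then show ?thesis using elim by (simp add: A'_def)
          next
            case False
            then show ?thesis using \<theta>_0[of t n] h[of n] by force
          qed
        qed
      qed measurable
      finally show ?thesis .
    qed
    finally show ?thesis .
  qed
  have "(\<lambda>n. (\<integral>t. \<theta>' n t * A' t \<partial>lborel)) \<longlonglongrightarrow> A' a - A' b"
  proof -
    have "(\<lambda>n. a + h n) \<longlonglongrightarrow> a + 0" "(\<lambda>n. b - h n) \<longlonglongrightarrow> b - 0" by (intro tendsto_intros h0)+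
    then have "(\<lambda>n. (\<integral>t. hat ((t - (a + h n)) / h n) / h n * A' t \<partial>lborel)
        - (\<integral>t. hat ((t - (b - h n)) / h n) / h n * A' t \<partial>lborel)) \<longlonglongrightarrow> A' a - A' b"
      by (intro tendsto_diff hat_delta_tendsto[OF contA' BA h(1) h0]) simp_all
    moreover have "(\<integral>t. \<theta>' n t * A' t \<partial>lborel) = (\<integral>t. hat ((t - (a + h n)) / h n) / h n * A' t \<partial>lborel)
        - (\<integral>t. hat ((t - (b - h n)) / h n) / h n * A' t \<partial>lborel)" for n
    proof -
      have "integrable lborel (\<lambda>t. hat ((t - d) / h n) / h n * A' t)" for d
      proof -
        have "integrable lborel (\<lambda>t. hat (- d / h n + (1 / h n) * t))"
          using integral_hat(1) h(1)[of n] by (intro lborel_integrable_real_affine) auto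
        then have i: "integrable lborel (\<lambda>t. BA / h n * hat ((t - d) / h n))"
          by (intro integrable_mult_right) (simp add: diff_divide_distrib)
        have [measurable]: "A' \<in> borel_measurable borel" "hat \<in> borel_measurable borel"
          using contA' by (auto intro!: borel_measurable_continuous_onI continuous_intros)
        show ?thesis
        proof (rule Bochner_Integration.integrable_bound[OF i])
          have "\<bar>hat z / h n * A' t\<bar> \<le> \<bar>BA / h n * hat z\<bar>" for z t
          proof -
            have "\<bar>hat z / h n\<bar> * \<bar>A' t\<bar> \<le> \<bar>hat z / h n\<bar> * \<bar>BA\<bar>"
              using BA[of t] by (intro mult_left_mono) auto
            then show ?thesis by (simp add: abs_mult mult.commute)
          qed
          then show "AE t in lborel. norm (hat ((t - d) / h n) / h n * A' t) \<le> norm (BA / h n * hat ((t - d) / h n))"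
            by simp
        qed measurable
      qed
      note i = this
      show ?thesis
        unfolding \<theta>'_def ramp'_def
        by (subst Bochner_Integration.integral_diff[OF i i, symmetric]) (simp add: algebra_simps)
    qed
    ultimately show ?thesis by simp
  qed
  moreover have "(\<lambda>n. (\<integral>p. \<theta> n (fst p) * G p \<partial>lborel)) \<longlonglongrightarrow> (\<integral>p. J p \<partial>lborel)"
  proof (rule integral_dominated_convergence[where w = "\<lambda>p. C * indicator (cbox (a, - R) (b, R)) p"])
    show "integrable lborel (\<lambda>p. C * indicator (cbox (a, - R) (b, R)) p)"
      by (intro integrable_mult_right integrable_real_indicator) (auto simp: emeasure_lborel_cbox_eq)
    show "J \<in> borel_measurable lborel" using \<open>integrable lborel J\<close> by auto
    have "(\<lambda>n. \<theta> n (fst p) * G p) \<longlonglongrightarrow> J p" for p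
    proof (cases "a < fst p \<and> fst p < b")
      case True
      then show ?thesis using tendsto_mult_right[OF \<theta>_1[of "fst p"], of "G p"]
        by (cases p) (auto simp: JG indicator_def)
    next
      case False
      then have "\<theta> n (fst p) = 0" for n using \<theta>_0[of "fst p" n] h[of n] by force
      then show ?thesis using False by (cases p) (auto simp: JG indicator_def)
    qed
    then show "AE p in lborel. (\<lambda>n. \<theta> n (fst p) * G p) \<longlonglongrightarrow> J p" by simp
    have "\<bar>\<theta> n (fst p) * G p\<bar> \<le> C * indicator (cbox (a, - R) (b, R)) p" for n p
    proof (cases "a < fst p \<and> fst p < b \<and> \<bar>snd p\<bar> \<le> R")
      case True
      then have "\<bar>\<theta> n (fst p)\<bar> * \<bar>G p\<bar> \<le> 1 * C"
        using G[of "fst p" "snd p"] \<theta>_b[of n "fst p"] by (intro mult_mono) auto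
      then show ?thesis using True by (cases p) (auto simp: abs_mult indicator_def)
    next
      case False
      then have "\<theta> n (fst p) = 0 \<or> G p = 0"
        using \<theta>_0[of "fst p" n] h[of n] G0[of "fst p" "snd p"] by force
      then show ?thesis using C0 by (auto simp: indicator_def)
    qed
    then show "AE p in lborel. norm (\<theta> n (fst p) * G p) \<le> C * indicator (cbox (a, - R) (b, R)) p" for n
      by simp
  qed (simp, intro borel_measurable_times m\<theta>, measurable)
  ultimately have "(\<lambda>n. (\<integral>t. \<theta>' n t * A' t \<partial>lborel) + (\<integral>p. \<theta> n (fst p) * G p \<partial>lborel))
      \<longlonglongrightarrow> (A' a - A' b) + (\<integral>p. J p \<partial>lborel)"
    by (rule tendsto_add)
  then have "0 \<le> (A' a - A' b) + (\<integral>p. J p \<partial>lborel)"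
    using ineq by (intro LIMSEQ_le_const) auto
  then show "(LINT x|lebesgue. \<Phi> (b, x) * \<bar>u b x - k\<bar>) - (LINT x|lebesgue. \<Phi> (a, x) * \<bar>u a x - k\<bar>)
      \<le> (\<integral>p. J p \<partial>lborel)"
    using ab by (simp add: A'_def A_def)
qed

end

section \<open>Comparison with moving fronts\<close>

lemma has_derivative_smooth_step [derivative_intros]:
  assumes "(g has_derivative g') (at p)"
  shows "((\<lambda>p. smooth_step (g p)) has_derivative (\<lambda>q. hat (g p) * g' q)) (at p)"
proof -
  have "(smooth_step has_derivative (\<lambda>q. hat (g p) * q)) (at (g p))"
    using has_real_derivative_smooth_step[OF DERIV_ident, of "g p" UNIV]
    by (simp add: has_field_derivative_def)
  with assms show ?thesis by (rule has_derivative_compose)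
qed

section \<open>Cutoff on a backward cone\<close>

text \<open>It equals 1 for \<open>\<bar>x\<bar> \<le> R - 1 - L * t\<close> and 0 for
  \<open>\<bar>x\<bar> \<ge> R - L * t\<close>, where \<open>p = (t, x)\<close>.\<close>

definition cone_weight :: "real \<Rightarrow> real \<Rightarrow> real \<times> real \<Rightarrow> real" where
  "cone_weight R L p = smooth_step (snd p + R - L * fst p) * smooth_step (R - L * fst p - snd p)"

definition cone_weight_t :: "real \<Rightarrow> real \<Rightarrow> real \<times> real \<Rightarrow> real" where
  "cone_weight_t R L p = - L * (hat (snd p + R - L * fst p) * smooth_step (R - L * fst p - snd p) +
     smooth_step (snd p + R - L * fst p) * hat (R - L * fst p - snd p))"

definition cone_weight_x :: "real \<Rightarrow> real \<Rightarrow> real \<times> real \<Rightarrow> real" where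
  "cone_weight_x R L p = hat (snd p + R - L * fst p) * smooth_step (R - L * fst p - snd p) -
     smooth_step (snd p + R - L * fst p) * hat (R - L * fst p - snd p)"

lemma has_derivative_cone_weight:
  "(cone_weight R L has_derivative (\<lambda>(h, k). h * cone_weight_t R L p + k * cone_weight_x R L p)) (at p)"
  unfolding cone_weight_def[abs_def]
  by (rule has_derivative_eq_rhs, (rule derivative_intros)+)
    (auto simp: fun_eq_iff cone_weight_t_def cone_weight_x_def algebra_simps)

lemma continuous_on_cone_weight:
  "continuous_on A (cone_weight R L)" "continuous_on A (cone_weight_t R L)" "continuous_on A (cone_weight_x R L)"
  unfolding cone_weight_def[abs_def] cone_weight_t_def[abs_def] cone_weight_x_def[abs_def] by (intro continuous_intros)+

lemma cone_weight_nonneg: "0 \<le> cone_weight R L p"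
  unfolding cone_weight_def by (intro mult_nonneg_nonneg smooth_step_nonneg)

lemma cone_weight_le_1: "cone_weight R L p \<le> 1"
  unfolding cone_weight_def using mult_mono[OF smooth_step_le_1 smooth_step_le_1] smooth_step_nonneg by simp

lemma cone_weight_eq_0: "0 \<le> L \<Longrightarrow> 0 \<le> t \<Longrightarrow> R < \<bar>x\<bar> \<Longrightarrow> cone_weight R L (t, x) = 0"
proof -
  assume a: "0 \<le> L" "0 \<le> t" "R < \<bar>x\<bar>"
  have "0 \<le> L * t" using a by simp
  then have "x + R - L * t \<le> 0 \<or> R - L * t - x \<le> 0" using a by linarith
  then show ?thesis by (auto simp: cone_weight_def smooth_step_eq_0)
qed

text \<open>Finite speed of propagation, with \<open>w\<close> an entropy
  \<open>\<bar>v - k\<bar>\<close> and \<open>q\<close> its flux: the cone shrinks at speed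
  \<open>L\<close>, at least as fast as entropy can flow in through its sides.\<close>

lemma cone_weight_decreases:
  assumes "\<bar>q\<bar> \<le> L * w" "0 \<le> w"
  shows "w * cone_weight_t R L p + q * cone_weight_x R L p \<le> 0"
proof -
  define X where "X = hat (snd p + R - L * fst p) * smooth_step (R - L * fst p - snd p)"
  define Y where "Y = smooth_step (snd p + R - L * fst p) * hat (R - L * fst p - snd p)"
  have "0 \<le> X" "0 \<le> Y"
    unfolding X_def Y_def by (auto intro!: mult_nonneg_nonneg hat_nonneg smooth_step_nonneg)
  then have "(q - L * w) * X \<le> 0" "(- q - L * w) * Y \<le> 0"
    using assms by (auto intro!: mult_nonpos_nonneg)
  moreover have "w * cone_weight_t R L p + q * cone_weight_x R L p = (q - L * w) * X + (- q - L * w) * Y"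
    unfolding cone_weight_t_def cone_weight_x_def X_def[symmetric] Y_def[symmetric] by (simp add: algebra_simps)
  ultimately show ?thesis by linarith
qed

section \<open>Partition of unity along the fronts\<close>

text \<open>For \<open>c = 1\<close> the weights are \<open>1 - S 0\<close>,
  \<open>S 0 - S 1\<close>, ..., \<open>S (n - 1)\<close>: if \<open>S\<close> decreases within
  \<open>[0, 1]\<close>, a partition of unity for the \<open>n + 1\<close> regions between
  \<open>n\<close> fronts. With \<open>c = 0\<close> and the derivatives of \<open>S\<close> it
  yields the derivatives of these weights.\<close>

definition telescope :: "real \<Rightarrow> (nat \<Rightarrow> real) \<Rightarrow> nat \<Rightarrow> nat \<Rightarrow> real" where
  "telescope c S n i = (if i = 0 then c else S (i - 1)) - (if i = n then 0 else S i)"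

text \<open>Abel summation: differences of weights become jumps of \<open>X\<close> across the
  fronts.\<close>

lemma sum_telescope:
  "(\<Sum>i\<le>n. telescope c S n i * X i) = c * X 0 + (\<Sum>j<n. S j * (X (Suc j) - X j))"
proof -
  have "(\<Sum>i\<le>n. telescope c S n i * X i)
    = (\<Sum>i\<le>n. (if i = 0 then c else S (i - 1)) * X i) - (\<Sum>i\<le>n. (if i = n then 0 else S i) * X i)"
    by (simp add: telescope_def left_diff_distrib sum_subtractf)
  also have "(\<Sum>i\<le>n. (if i = 0 then c else S (i - 1)) * X i) = c * X 0 + (\<Sum>j<n. S j * X (Suc j))"
    by (simp add: sum.lessThan_Suc_shift flip: lessThan_Suc_atMost del: sum.lessThan_Suc)
  also have "(\<Sum>i\<le>n. (if i = n then 0 else S i) * X i) = (\<Sum>j<n. S j * X j)"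
    by (simp flip: lessThan_Suc_atMost)
  finally show ?thesis by (simp add: right_diff_distrib sum_subtractf)
qed

text \<open>The starting value plus all jumps already passed. This is the form in which sums over
  the partition of unity converge when the transition layers shrink; sorting ensures that no front
  is passed before an earlier one.\<close>

lemma step_telescope:
  fixes g :: "real \<Rightarrow> real"
  assumes "sorted (map fst fs)"
  shows "g (step k fs x) = g k + (\<Sum>j<length fs. (if fst (fs ! j) < x then 1 else 0) *
    (g ((k # map snd fs) ! Suc j) - g ((k # map snd fs) ! j)))"
  using assms
proof (induction fs arbitrary: k)
  case (Cons z fs)
  obtain y c where z: "z = (y, c)" by force
  show ?case
  proof (cases "y < x")
    case True
    then show ?thesis using Cons z by (simp add: sum.lessThan_Suc_shift del: sum.lessThan_Suc)
  next
    case False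
    have "\<not> fst ((z # fs) ! j) < x" if "j < length (z # fs)" for j
      using that Cons.prems False z by (cases j) (fastforce dest: nth_mem)+
    then have "(\<Sum>j<length (z # fs). (if fst ((z # fs) ! j) < x then 1 else 0) *
      (g ((k # map snd (z # fs)) ! Suc j) - g ((k # map snd (z # fs)) ! j))) = 0"
      by (intro sum.neutral) auto
    then show ?thesis using False z by (simp del: sum.lessThan_Suc)
  qed
qed simp

text \<open>Kruzhkov's entropy condition for a shock of the comparison function, read with the value
  \<open>w\<close> of the other solution as the constant.\<close>

lemma admissible_kruzhkov:
  assumes "admissible f \<omega> l r" "0 \<le> \<omega>"
  shows "(kruzhkov_flux f w r - kruzhkov_flux f w l)
    - chord_slope f l r * (\<bar>w - r\<bar> - \<bar>w - l\<bar>) \<le> 2 * \<omega> * \<bar>r - l\<bar>"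
proof -
  define \<gamma> where "\<gamma> = chord_slope f l r"
  have fr: "f r - f l = \<gamma> * (r - l)" by (simp add: \<gamma>_def chord_slope_def)
  have pos: "0 \<le> 2 * \<omega> * \<bar>r - l\<bar>" using assms(2) by simp
  \<comment> \<open>For \<open>w\<close> outside the jump, the Rankine-Hugoniot relation makes the
    left-hand side 0. For \<open>w\<close> inside, it is -2 times the signed deviation of
    \<open>f\<close> from its chord at \<open>w\<close>, whence the factor 2.\<close>
  consider "w \<le> l \<and> w \<le> r" | "l \<le> w \<and> r \<le> w" | "l < w \<and> w < r" | "r < w \<and> w < l" by linarith
  then show ?thesis
  proof cases
    case 1
    then have e: "kruzhkov_flux f w r = f r - f w" "kruzhkov_flux f w l = f l - f w"
      by (auto simp: kruzhkov_flux_def sgn_if)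
    have a: "\<bar>w - r\<bar> = r - w" "\<bar>w - l\<bar> = l - w" using 1 by auto
    have g: "\<gamma> * (\<bar>w - r\<bar> - \<bar>w - l\<bar>) = f r - f l"
      unfolding a using fr by (simp add: algebra_simps)
    show ?thesis unfolding \<gamma>_def[symmetric] e g using pos by simp
  next
    case 2
    then have e: "kruzhkov_flux f w r = f w - f r" "kruzhkov_flux f w l = f w - f l"
      by (auto simp: kruzhkov_flux_def sgn_if)
    have a: "\<bar>w - r\<bar> = w - r" "\<bar>w - l\<bar> = w - l" using 2 by auto
    have g: "\<gamma> * (\<bar>w - r\<bar> - \<bar>w - l\<bar>) = f l - f r"
      unfolding a using fr by (simp add: algebra_simps)
    show ?thesis unfolding \<gamma>_def[symmetric] e g using pos by simp
  next
    case 3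
    then have e: "kruzhkov_flux f w r = f r - f w" "kruzhkov_flux f w l = f w - f l"
      by (auto simp: kruzhkov_flux_def sgn_if)
    have a: "\<bar>w - r\<bar> = r - w" "\<bar>w - l\<bar> = w - l" using 3 by auto
    have g: "\<gamma> * (\<bar>w - r\<bar> - \<bar>w - l\<bar>) = f r - f l - 2 * (\<gamma> * (w - l))"
      unfolding a using fr by (simp add: algebra_simps)
    have ad: "- (\<omega> * \<bar>r - l\<bar>) \<le> f w - f l - \<gamma> * (w - l)"
      using assms(1) 3 by (auto simp: admissible_def \<gamma>_def closed_segment_eq_real_ivl)
    show ?thesis unfolding \<gamma>_def[symmetric] e g using ad by linarith
  next
    case 4
    then have e: "kruzhkov_flux f w r = f w - f r" "kruzhkov_flux f w l = f l - f w"
      by (auto simp: kruzhkov_flux_def sgn_if)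
    have a: "\<bar>w - r\<bar> = w - r" "\<bar>w - l\<bar> = l - w" using 4 by auto
    have g: "\<gamma> * (\<bar>w - r\<bar> - \<bar>w - l\<bar>) = f l - f r + 2 * (\<gamma> * (w - l))"
      unfolding a using fr by (simp add: algebra_simps)
    have ad: "- (\<omega> * \<bar>r - l\<bar>) \<le> - (f w - f l - \<gamma> * (w - l))"
      using assms(1) 4 by (auto simp: admissible_def \<gamma>_def closed_segment_eq_real_ivl)
    show ?thesis unfolding \<gamma>_def[symmetric] e g using ad by linarith
  qed
qed

text \<open>In each time slice the bump has mass 1, whatever its width \<open>1 / N\<close>. The
  error at a front is thus bounded independently of \<open>N\<close>.\<close>

lemma integral_moving_hat:
  fixes a b N y \<gamma> :: real
  assumes ab: "a \<le> b" and N: "0 < N"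
  defines "H \<equiv> \<lambda>p. indicator ({a<..<b} \<times> UNIV) p * (N * hat (N * (snd p - (y + (fst p - a) * \<gamma>))))"
  shows "integrable lborel H" "(\<integral>p. H p \<partial>lborel) = b - a"
proof -
  have m: "H \<in> borel_measurable borel"
  proof -
    have o: "open ({a<..<b} \<times> (UNIV :: real set))" by (intro open_Times) auto
    have m: "(\<lambda>p :: real \<times> real. N * hat (N * (snd p - (y + (fst p - a) * \<gamma>)))) \<in> borel_measurable borel"
      by (intro borel_measurable_continuous_onI continuous_intros)
    show ?thesis unfolding H_def
      by (rule borel_measurable_times[OF borel_measurable_indicator[OF borel_open[OF o]] m])
  qed
  \<comment> \<open>The bump is carried at most \<open>\<bar>\<gamma>\<bar> * (b - a)\<close> away
    from \<open>y\<close> and has width \<open>1 / N\<close>.\<close>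
  define R where "R = \<bar>y\<bar> + \<bar>\<gamma>\<bar> * (b - a) + 1 / N"
  show int: "integrable lborel H"
  proof (rule integrable_bounded_box[OF m, where a = a and b = b and R = R and B = "2 * N"])
    show "\<bar>H p\<bar> \<le> 2 * N" for p
      using N hat_le hat_nonneg by (auto simp: H_def indicator_def abs_mult mult.commute)
    fix t x assume *: "\<not> (a \<le> t \<and> t \<le> b \<and> \<bar>x\<bar> \<le> R)"
    show "H (t, x) = 0"
    proof (cases "a < t \<and> t < b")
      case True
      have "hat (N * (x - (y + (t - a) * \<gamma>))) = 0"
      proof (rule ccontr)
        assume "hat (N * (x - (y + (t - a) * \<gamma>))) \<noteq> 0"
        then have "0 < N * (x - (y + (t - a) * \<gamma>))" "N * (x - (y + (t - a) * \<gamma>)) < 1"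
          using hat_eq_0 by (meson not_le)+
        moreover have "0 < z \<and> z < 1 / N" if "0 < N * z" "N * z < 1" for z
          using N that by (simp add: zero_less_mult_iff pos_less_divide_eq mult.commute)
        ultimately have 1: "0 < x - (y + (t - a) * \<gamma>)" "x - (y + (t - a) * \<gamma>) < 1 / N"
          by blast+
        have "\<bar>(t - a) * \<gamma>\<bar> \<le> \<bar>\<gamma>\<bar> * (b - a)"
          using True by (simp add: abs_mult mult.commute mult_left_mono)
        then have "\<bar>x\<bar> \<le> R" using 1 unfolding R_def by linarith
        then show False using * True by auto
      qed
      then show ?thesis by (simp add: H_def)
    qed (simp add: H_def)
  qed
  have inner: "(\<integral>x. H (t, x) \<partial>lborel) = indicator {a<..<b} t" for t
  proof -
    define c where "c = y + (t - a) * \<gamma>"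
    have "(\<integral>x. hat x \<partial>lborel) = \<bar>N\<bar> *\<^sub>R (\<integral>x. hat (- N * c + N * x) \<partial>lborel)"
      using N by (intro lborel_integral_real_affine) simp
    then have "(\<integral>x. N * hat (N * (x - c)) \<partial>lborel) = 1"
      using N integral_hat(2) by (simp add: algebra_simps)
    then show ?thesis by (auto simp: H_def c_def indicator_def)
  qed
  have "integrable (lborel \<Otimes>\<^sub>M lborel) H" using int by (subst lborel_prod)
  from lborel_pair.integral_fst'[OF this]
  have "(\<integral>p. H p \<partial>lborel) = (\<integral>t. indicator {a<..<b} t \<partial>lborel)"
    by (simp add: inner lborel_prod)
  then show "(\<integral>p. H p \<partial>lborel) = b - a" using ab by simp
qed

lemma advance_0 [simp]: "advance f 0 k fs = fs"
  by (induction f "0::real" k fs rule: advance.induct) auto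

lemma pvar_1_eq_sum:
  "pvar 1 (k # map snd fs) =
    (\<Sum>j<length fs. \<bar>(k # map snd fs) ! Suc j - (k # map snd fs) ! j\<bar>)"
  by (simp add: pvar_eq_sum)

context borel_entropy_solution
begin

definition cone_dist :: "real \<Rightarrow> real \<Rightarrow> real \<Rightarrow> (real \<Rightarrow> real) \<Rightarrow> real" where
  "cone_dist R L t w = (LINT x|lebesgue. cone_weight R L (t, x) * \<bar>u t x - w x\<bar>)"

text \<open>The entropy inequalities for the constants \<open>c i\<close>, tested with the cutoff
  times the pieces of a partition of unity with transition layers of width \<open>1 / N\<close>, are
  added. The order of the fronts makes the pieces nonnegative during the whole interval. Since the
  resulting bound is uniform in \<open>N\<close>, the layers can be shrunk to the fronts.\<close>

lemma cone_dist_move: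
  assumes ab: "0 \<le> a" "a < b" and \<omega>: "0 \<le> \<omega>"
    and lip: "\<And>w c. \<bar>w\<bar> \<le> M \<Longrightarrow> c \<in> set (k # map snd fs) \<Longrightarrow> \<bar>f w - f c\<bar> \<le> L * \<bar>w - c\<bar>" and L: "0 \<le> L"
    and adm: "successively (admissible f \<omega>) (k # map snd fs)"
    and sorted: "\<And>\<tau>. 0 \<le> \<tau> \<Longrightarrow> \<tau> \<le> b - a \<Longrightarrow> sorted (map fst (advance f \<tau> k fs))"
  shows "cone_dist R L b (step k (advance f (b - a) k fs))
    \<le> cone_dist R L a (step k fs) + 2 * \<omega> * pvar 1 (k # map snd fs) * (b - a)"
proof -
  define n where "n = length fs"
  define c where "c i = (k # map snd fs) ! i" for i
  define \<gamma> where "\<gamma> j = chord_slope f (c j) (c (Suc j))" for j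
  define y where "y t j = fst (fs ! j) + (t - a) * \<gamma> j" for t j
  have c_in: "c i \<in> set (k # map snd fs)" if "i \<le> n" for i
    unfolding c_def using that by (intro nth_mem) (simp add: n_def)
  have adv: "fst (advance f (t - a) k fs ! j) = y t j" if "j < n" for t j
    using that fst_advance_nth[of j fs f "t - a" k] by (simp add: y_def \<gamma>_def c_def n_def)
  have y_mono: "y t j \<le> y t (Suc j)" if "a \<le> t" "t \<le> b" "Suc j < n" for t j
    using sorted[of "t - a"] that adv by (simp add: sorted_iff_nth_Suc n_def)
  have adm_j: "admissible f \<omega> (c j) (c (Suc j))" if "j < n" for j
    using adm that unfolding successively_conv_nth c_def n_def by auto
  have K: "\<bar>kruzhkov_flux f w (c i)\<bar> \<le> L * \<bar>w - c i\<bar>" if "\<bar>w\<bar> \<le> M" "i \<le> n" for w i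
    using lip[OF that(1) c_in[OF that(2)]] L by (auto simp: kruzhkov_flux_def abs_mult sgn_if)
  have key: "(\<Sum>i\<le>n. LINT x|lebesgue. cone_weight R L (b, x) * telescope 1 (\<lambda>j. smooth_step (N * (x - y b j))) n i * \<bar>u b x - c i\<bar>)
    \<le> (\<Sum>i\<le>n. LINT x|lebesgue. cone_weight R L (a, x) * telescope 1 (\<lambda>j. smooth_step (N * (x - y a j))) n i * \<bar>u a x - c i\<bar>)
      + 2 * \<omega> * pvar 1 (k # map snd fs) * (b - a)" if N: "0 < N" for N
  proof -
    define S where "S p j = smooth_step (N * (snd p - y (fst p) j))" for p j
    define s where "s p j = N * hat (N * (snd p - y (fst p) j))" for p j
    \<comment> \<open>The time derivative of \<open>S\<close>, as front \<open>j\<close> travels at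
      speed \<open>\<gamma> j\<close>.\<close>
    define st where "st p j = - \<gamma> j * s p j" for p j
    define \<Phi> where "\<Phi> i p = cone_weight R L p * telescope 1 (S p) n i" for i p
    define \<Phi>t where "\<Phi>t i p = cone_weight_t R L p * telescope 1 (S p) n i + cone_weight R L p * telescope 0 (st p) n i" for i p
    define \<Phi>x where "\<Phi>x i p = cone_weight_x R L p * telescope 1 (S p) n i + cone_weight R L p * telescope 0 (s p) n i" for i p
    have Sder: "((\<lambda>p. S p j) has_derivative (\<lambda>(h, l). h * st p j + l * s p j)) (at p)" for p j
      unfolding S_def y_def
      by (rule has_derivative_eq_rhs, (rule derivative_intros)+)
        (auto simp: fun_eq_iff st_def s_def y_def algebra_simps)
    have Tder: "((\<lambda>p. telescope 1 (S p) n i) has_derivative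
        (\<lambda>(h, l). h * telescope 0 (st p) n i + l * telescope 0 (s p) n i)) (at p)" for p i
    proof -
      have 1: "((\<lambda>p. if i = 0 then 1 else S p (i - 1)) has_derivative
        (\<lambda>(h, l). h * (if i = 0 then 0 else st p (i - 1)) + l * (if i = 0 then 0 else s p (i - 1)))) (at p)"
        using Sder[of "i - 1" p] by (cases "i = 0") (auto simp: split_beta')
      have 2: "((\<lambda>p. if i = n then 0 else S p i) has_derivative
        (\<lambda>(h, l). h * (if i = n then 0 else st p i) + l * (if i = n then 0 else s p i))) (at p)"
        using Sder[of i p] by (cases "i = n") (auto simp: split_beta')
      show ?thesis unfolding telescope_def
        by (rule has_derivative_eq_rhs[OF has_derivative_diff[OF 1 2]])
          (auto simp: fun_eq_iff algebra_simps)
    qed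
    have der: "(\<Phi> i has_derivative (\<lambda>(h, l). h * \<Phi>t i p + l * \<Phi>x i p)) (at p)" for i p
      unfolding \<Phi>_def[abs_def]
      by (rule has_derivative_eq_rhs[OF has_derivative_mult[OF has_derivative_cone_weight Tder]])
        (auto simp: fun_eq_iff \<Phi>t_def \<Phi>x_def algebra_simps)
    have Scont: "continuous_on UNIV (\<lambda>p. S p j)" "continuous_on UNIV (\<lambda>p. s p j)" "continuous_on UNIV (\<lambda>p. st p j)" for j
      unfolding S_def s_def st_def y_def by (intro continuous_intros)+
    have Tcont: "continuous_on UNIV (\<lambda>p. telescope 1 (S p) n i)" "continuous_on UNIV (\<lambda>p. telescope 0 (s p) n i)"
      "continuous_on UNIV (\<lambda>p. telescope 0 (st p) n i)" for i
      unfolding telescope_def by (cases "i = 0"; cases "i = n"; auto intro!: continuous_intros Scont)+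
    have cont: "continuous_on UNIV (\<Phi>t i)" "continuous_on UNIV (\<Phi>x i)" for i
      unfolding \<Phi>t_def[abs_def] \<Phi>x_def[abs_def] by (intro continuous_intros continuous_on_cone_weight Tcont)+
    have S_anti: "S (t, x) j \<le> S (t, x) (j - 1)" if "a \<le> t" "t \<le> b" "0 < j" "j < n" for t x j
      unfolding S_def using y_mono[of t "j - 1"] that N
      by (intro smooth_step_mono mult_left_mono) auto
    have T0: "0 \<le> telescope 1 (S (t, x)) n i" if "a \<le> t" "t \<le> b" "i \<le> n" for t x i
    proof -
      have "0 \<le> S (t, x) j" "S (t, x) j \<le> 1" for j
        unfolding S_def by (auto intro: smooth_step_nonneg smooth_step_le_1)
      then show ?thesis using S_anti[of t i x] that by (auto simp: telescope_def)
    qed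
    have \<Phi>0: "0 \<le> \<Phi> i (t, x)" if "a \<le> t" "t \<le> b" "i \<le> n" for t x i
      unfolding \<Phi>_def using T0[OF that] cone_weight_nonneg by simp
    have \<Phi>R: "\<Phi> i (t, x) = 0" if "a \<le> t" "t \<le> b" "R < \<bar>x\<bar>" for t x i
      unfolding \<Phi>_def using cone_weight_eq_0[OF L _ that(3), of t] that ab by simp
    define J where "J i p = indicator ({a<..<b} \<times> UNIV) p *
      (\<bar>v p - c i\<bar> * \<Phi>t i p + kruzhkov_flux f (v p) (c i) * \<Phi>x i p)" for i p
    have J: "integrable lborel (J i)"
      "(LINT x|lebesgue. \<Phi> i (b, x) * \<bar>u b x - c i\<bar>) - (LINT x|lebesgue. \<Phi> i (a, x) * \<bar>u a x - c i\<bar>)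
        \<le> (\<integral>p. J i p \<partial>lborel)" if "i \<le> n" for i
      using entropy_inequality_interval[where k = "c i" and R = R, OF ab der[of i] cont[of i] \<Phi>0[OF _ _ that] \<Phi>R]
      unfolding J_def[abs_def] by auto
    define H where "H j p = indicator ({a<..<b} \<times> UNIV) p * (N * hat (N * (snd p - (fst (fs ! j) + (fst p - a) * \<gamma> j))))" for j p
    have H: "integrable lborel (H j)" "(\<integral>p. H j p \<partial>lborel) = b - a" for j
      using integral_moving_hat[of a b N "fst (fs ! j)" "\<gamma> j"] ab N by (auto simp: H_def[abs_def])
    have le: "(\<Sum>i\<le>n. J i p) \<le> (\<Sum>j<n. 2 * \<omega> * \<bar>c (Suc j) - c j\<bar> * H j p)" for p
    proof (cases "p \<in> {a<..<b} \<times> UNIV")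
      case True
      obtain t x where p: "p = (t, x)" by force
      have t: "a < t" "t < b" using True p by auto
      define w where "w i = \<bar>v p - c i\<bar>" for i
      define q where "q i = kruzhkov_flux f (v p) (c i)" for i
      have "(\<Sum>i\<le>n. J i p) = (\<Sum>i\<le>n. w i * \<Phi>t i p + q i * \<Phi>x i p)"
        using True by (simp add: J_def w_def q_def)
      \<comment> \<open>Derivatives of the cone cutoff are separated from those of the partition of
        unity: the former give nonpositive terms, the latter are concentrated in the layers at the
        fronts.\<close>
      also have "\<dots> = (\<Sum>i\<le>n. telescope 1 (S p) n i * (w i * cone_weight_t R L p + q i * cone_weight_x R L p))
        + cone_weight R L p * ((\<Sum>i\<le>n. telescope 0 (s p) n i * q i) + (\<Sum>i\<le>n. telescope 0 (st p) n i * w i))"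
        by (simp add: \<Phi>t_def \<Phi>x_def sum_distrib_left flip: sum.distrib) (simp add: algebra_simps)
      also have "\<dots> \<le> 0 + cone_weight R L p * ((\<Sum>i\<le>n. telescope 0 (s p) n i * q i) + (\<Sum>i\<le>n. telescope 0 (st p) n i * w i))"
      proof (intro add_right_mono sum_nonpos mult_nonneg_nonpos)
        fix i assume "i \<in> {..n}"
        then show "0 \<le> telescope 1 (S p) n i" "w i * cone_weight_t R L p + q i * cone_weight_x R L p \<le> 0"
          using T0[of t i x] t p K[OF v_bound] by (auto simp: w_def q_def intro!: cone_weight_decreases)
      qed
      \<comment> \<open>After summation by parts each front carries the jump of the entropy flux
        minus its speed times the jump of the entropy, the expression estimated by
        \<open>admissible_kruzhkov\<close>.\<close>
      also have "(\<Sum>i\<le>n. telescope 0 (s p) n i * q i) + (\<Sum>i\<le>n. telescope 0 (st p) n i * w i)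
        = (\<Sum>j<n. s p j * ((q (Suc j) - q j) - \<gamma> j * (w (Suc j) - w j)))"
        by (simp add: sum_telescope st_def flip: sum.distrib) (simp add: algebra_simps)
      also have "0 + cone_weight R L p * (\<Sum>j<n. s p j * ((q (Suc j) - q j) - \<gamma> j * (w (Suc j) - w j)))
        \<le> cone_weight R L p * (\<Sum>j<n. s p j * (2 * \<omega> * \<bar>c (Suc j) - c j\<bar>))"
        unfolding add_0
      proof (intro mult_left_mono sum_mono cone_weight_nonneg)
        fix j assume "j \<in> {..<n}"
        then show "(q (Suc j) - q j) - \<gamma> j * (w (Suc j) - w j) \<le> 2 * \<omega> * \<bar>c (Suc j) - c j\<bar>"
          unfolding q_def w_def \<gamma>_def by (intro admissible_kruzhkov adm_j \<omega>) auto
        show "0 \<le> s p j" unfolding s_def using N hat_nonneg by simp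
      qed
      also have "\<dots> \<le> 1 * (\<Sum>j<n. s p j * (2 * \<omega> * \<bar>c (Suc j) - c j\<bar>))"
        using \<omega> N hat_nonneg by (intro mult_right_mono cone_weight_le_1 sum_nonneg) (auto simp: s_def)
      also have "\<dots> = (\<Sum>j<n. 2 * \<omega> * \<bar>c (Suc j) - c j\<bar> * H j p)"
        using True by (simp add: H_def s_def y_def mult.commute)
      finally show ?thesis .
    qed (simp add: J_def H_def)
    have "(\<Sum>i\<le>n. (LINT x|lebesgue. \<Phi> i (b, x) * \<bar>u b x - c i\<bar>) - (LINT x|lebesgue. \<Phi> i (a, x) * \<bar>u a x - c i\<bar>))
      \<le> (\<Sum>i\<le>n. \<integral>p. J i p \<partial>lborel)"
      using J(2) by (intro sum_mono) auto
    also have "\<dots> = (\<integral>p. (\<Sum>i\<le>n. J i p) \<partial>lborel)"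
      using J(1) by (intro Bochner_Integration.integral_sum[symmetric]) auto
    also have "\<dots> \<le> (\<integral>p. (\<Sum>j<n. 2 * \<omega> * \<bar>c (Suc j) - c j\<bar> * H j p) \<partial>lborel)"
      using J(1) H(1) le by (intro integral_mono Bochner_Integration.integrable_sum integrable_mult_right) auto
    also have "\<dots> = (\<Sum>j<n. 2 * \<omega> * \<bar>c (Suc j) - c j\<bar> * (b - a))"
      using H by (subst Bochner_Integration.integral_sum) auto
    also have "\<dots> = 2 * \<omega> * pvar 1 (k # map snd fs) * (b - a)"
      unfolding pvar_1_eq_sum c_def n_def by (simp only: sum_distrib_left sum_distrib_right)
    finally have "(\<Sum>i\<le>n. LINT x|lebesgue. \<Phi> i (b, x) * \<bar>u b x - c i\<bar>)
      \<le> (\<Sum>i\<le>n. LINT x|lebesgue. \<Phi> i (a, x) * \<bar>u a x - c i\<bar>)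
        + 2 * \<omega> * pvar 1 (k # map snd fs) * (b - a)" by (simp add: sum_subtractf)
    moreover have "S (t, x) = (\<lambda>j. smooth_step (N * (x - y t j)))" for t x
      by (simp add: S_def fun_eq_iff)
    ultimately show ?thesis by (simp add: \<Phi>_def)
  qed
  have lim: "(\<lambda>m. \<Sum>i\<le>n. LINT x|lebesgue. cone_weight R L (t, x) * telescope 1 (\<lambda>j. smooth_step (real (Suc m) * (x - y t j))) n i * \<bar>u t x - c i\<bar>)
      \<longlonglongrightarrow> cone_dist R L t (step k (advance f (t - a) k fs))" if t: "a \<le> t" "t \<le> b" for t
  proof -
    have t0: "0 \<le> t" using t ab by simp
    define ct where "ct x = cone_weight R L (t, x)" for x
    have ct_cont: "continuous_on UNIV ct"
      unfolding ct_def by (rule continuous_on_compose2[OF continuous_on_cone_weight(1)[of UNIV]]) (auto intro!: continuous_intros)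
    have ct0: "0 \<le> ct x" for x by (simp add: ct_def cone_weight_nonneg)
    have ctR: "ct x = 0" if "R < \<bar>x\<bar>" for x using cone_weight_eq_0[OF L t0 that] by (simp add: ct_def)
    have ct_int: "integrable lebesgue (\<lambda>x. ct x * \<bar>u t x - z\<bar>)" for z
      by (rule weighted_integrable[OF t0 ct_cont ctR])
    define tel where "tel m x i = telescope 1 (\<lambda>j. smooth_step (real (Suc m) * (x - y t j))) n i" for m x i
    have tel_cont: "continuous_on UNIV (\<lambda>x. tel m x i)" for m i
      unfolding tel_def telescope_def
      by (cases "i = 0"; cases "i = n"; auto intro!: continuous_intros)
    have int: "integrable lebesgue (\<lambda>x. ct x * tel m x i * \<bar>u t x - c i\<bar>)" for m i
      using ctR by (intro weighted_integrable[OF t0] continuous_intros ct_cont tel_cont) auto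
    define TV where "TV = (\<Sum>j<n. \<bar>c (Suc j) - c j\<bar>)"
    have eq: "(\<Sum>i\<le>n. ct x * tel m x i * \<bar>u t x - c i\<bar>)
      = ct x * (\<bar>u t x - c 0\<bar> + (\<Sum>j<n. smooth_step (real (Suc m) * (x - y t j)) * (\<bar>u t x - c (Suc j)\<bar> - \<bar>u t x - c j\<bar>)))" for m x
      unfolding mult.assoc sum_distrib_left[symmetric] tel_def sum_telescope by simp
    have "(\<lambda>m. LINT x|lebesgue. (\<Sum>i\<le>n. ct x * tel m x i * \<bar>u t x - c i\<bar>))
      \<longlonglongrightarrow> (LINT x|lebesgue. ct x * \<bar>u t x - step k (advance f (t - a) k fs) x\<bar>)"
    \<comment> \<open>The natural bound \<open>\<bar>u t x - c 0\<bar> + TV\<close> is brought into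
      the form covered by \<open>weighted_integrable\<close>: with \<open>d = u t x - c 0\<close>,
      one has \<open>TV \<le> \<bar>d\<bar> + \<bar>d - TV\<bar>\<close>.\<close>
    proof (rule integral_dominated_convergence[where w = "\<lambda>x. 2 * (ct x * \<bar>u t x - c 0\<bar>) + ct x * \<bar>u t x - (c 0 + TV)\<bar>"])
      have conv: "(\<lambda>m. \<Sum>i\<le>n. ct x * tel m x i * \<bar>u t x - c i\<bar>) \<longlonglongrightarrow> ct x * \<bar>u t x - step k (advance f (t - a) k fs) x\<bar>" for x
      proof -
        have "\<bar>u t x - step k (advance f (t - a) k fs) x\<bar>
          = \<bar>u t x - c 0\<bar> + (\<Sum>j<n. (if 0 < x - y t j then 1 else 0) * (\<bar>u t x - c (Suc j)\<bar> - \<bar>u t x - c j\<bar>))"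
          using step_telescope[OF sorted[of "t - a"], where g = "\<lambda>z. \<bar>u t x - z\<bar>" and x = x] t adv
          by (simp add: c_def n_def)
        moreover have "(\<lambda>m. smooth_step (real (Suc m) * (x - y t j))) \<longlonglongrightarrow> (if 0 < x - y t j then 1 else 0)" for j
          using smooth_step_tendsto[of "x - y t j"] by (simp add: mult.commute)
        ultimately show ?thesis unfolding eq
          by (auto intro!: tendsto_intros simp del: of_nat_Suc)
      qed
      then show "AE x in lebesgue. (\<lambda>m. \<Sum>i\<le>n. ct x * tel m x i * \<bar>u t x - c i\<bar>)
          \<longlonglongrightarrow> ct x * \<bar>u t x - step k (advance f (t - a) k fs) x\<bar>" by simp
      show m: "(\<lambda>x. \<Sum>i\<le>n. ct x * tel m x i * \<bar>u t x - c i\<bar>) \<in> borel_measurable lebesgue" for m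
        using int by (intro borel_measurable_sum borel_measurable_integrable)
      show "(\<lambda>x. ct x * \<bar>u t x - step k (advance f (t - a) k fs) x\<bar>) \<in> borel_measurable lebesgue"
        by (rule borel_measurable_LIMSEQ_metric[OF m conv])
      show "integrable lebesgue (\<lambda>x. 2 * (ct x * \<bar>u t x - c 0\<bar>) + ct x * \<bar>u t x - (c 0 + TV)\<bar>)"
        using ct_int by (intro Bochner_Integration.integrable_add integrable_mult_right)
      have "\<bar>\<Sum>i\<le>n. ct x * tel m x i * \<bar>u t x - c i\<bar>\<bar> \<le> 2 * (ct x * \<bar>u t x - c 0\<bar>) + ct x * \<bar>u t x - (c 0 + TV)\<bar>" for m x
      proof -
        have bnd: "\<bar>\<Sum>j<n. smooth_step (real (Suc m) * (x - y t j)) * (\<bar>u t x - c (Suc j)\<bar> - \<bar>u t x - c j\<bar>)\<bar> \<le> TV"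
          unfolding TV_def
        proof (rule order_trans[OF sum_abs], rule sum_mono)
          fix j
          have "\<bar>smooth_step (real (Suc m) * (x - y t j))\<bar> * \<bar>\<bar>u t x - c (Suc j)\<bar> - \<bar>u t x - c j\<bar>\<bar> \<le> 1 * \<bar>c (Suc j) - c j\<bar>"
            using smooth_step_nonneg smooth_step_le_1 by (intro mult_mono) auto
          then show "\<bar>smooth_step (real (Suc m) * (x - y t j)) * (\<bar>u t x - c (Suc j)\<bar> - \<bar>u t x - c j\<bar>)\<bar> \<le> \<bar>c (Suc j) - c j\<bar>"
            by (simp add: abs_mult)
        qed
        have aux: "\<bar>\<bar>z\<bar> + X\<bar> \<le> 2 * \<bar>z\<bar> + \<bar>z - TV\<bar>" if "\<bar>X\<bar> \<le> TV" for z X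
          using that by linarith
        have "\<bar>\<bar>u t x - c 0\<bar> + (\<Sum>j<n. smooth_step (real (Suc m) * (x - y t j)) * (\<bar>u t x - c (Suc j)\<bar> - \<bar>u t x - c j\<bar>))\<bar>
          \<le> 2 * \<bar>u t x - c 0\<bar> + \<bar>u t x - (c 0 + TV)\<bar>"
          unfolding diff_diff_eq[symmetric] by (rule aux) (rule bnd)
        from mult_left_mono[OF this ct0[of x]] show ?thesis
          unfolding eq abs_mult abs_of_nonneg[OF ct0] by (simp only: distrib_left mult.left_commute)
      qed
      then show "AE x in lebesgue. norm (\<Sum>i\<le>n. ct x * tel m x i * \<bar>u t x - c i\<bar>)
          \<le> 2 * (ct x * \<bar>u t x - c 0\<bar>) + ct x * \<bar>u t x - (c 0 + TV)\<bar>" for m by simp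
    qed
    moreover have "(LINT x|lebesgue. (\<Sum>i\<le>n. ct x * tel m x i * \<bar>u t x - c i\<bar>))
      = (\<Sum>i\<le>n. LINT x|lebesgue. ct x * tel m x i * \<bar>u t x - c i\<bar>)" for m
      using int by (intro Bochner_Integration.integral_sum)
    ultimately show ?thesis by (simp add: cone_dist_def ct_def tel_def)
  qed
  have "cone_dist R L b (step k (advance f (b - a) k fs))
    \<le> cone_dist R L a (step k (advance f (a - a) k fs)) + 2 * \<omega> * pvar 1 (k # map snd fs) * (b - a)"
    by (rule LIMSEQ_le[OF lim tendsto_add[OF lim tendsto_const]]) (use ab key in auto)
  then show ?thesis by simp
qed

end

section \<open>Approximation of the data and lower semicontinuity\<close>

lemma mean_value_segment:
  fixes f D :: "real \<Rightarrow> real"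
  assumes "\<And>x. (f has_real_derivative D x) (at x)"
  shows "\<exists>\<xi>\<in>closed_segment a b. f b - f a = (b - a) * D \<xi>"
proof -
  have *: "\<exists>\<xi>\<in>{a..b}. f b - f a = (b - a) * D \<xi>" if "a < b" for a b
    using MVT2[OF that, of f D] assms by force
  consider "a = b" | "a < b" | "b < a" by linarith
  then show ?thesis
  proof cases
    case 3
    then obtain \<xi> where "\<xi> \<in> {b..a}" "f a - f b = (a - b) * D \<xi>" using * by blast
    then show ?thesis using 3 by (intro bexI[of _ \<xi>]) (auto simp: closed_segment_eq_real_ivl algebra_simps)
  qed (use * in \<open>auto simp: closed_segment_eq_real_ivl\<close>)
qed

text \<open>By the mean value theorem the deviation from the chord is a difference of two values of
  \<open>D\<close> times \<open>z - a\<close>. The estimate is two-sided, so jumps up and down are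
  treated alike.\<close>

lemma admissible_small_oscillation:
  assumes der: "\<And>x. (f has_real_derivative D x) (at x)"
    and osc: "\<And>x y. x \<in> closed_segment a b \<Longrightarrow> y \<in> closed_segment a b \<Longrightarrow> \<bar>D x - D y\<bar> \<le> \<omega>"
  shows "admissible f \<omega> a b"
  unfolding admissible_def
proof
  fix z assume z: "z \<in> closed_segment a b"
  obtain \<xi> where \<xi>: "\<xi> \<in> closed_segment a z" "f z - f a = (z - a) * D \<xi>"
    using mean_value_segment[of f D a z] der by blast
  obtain \<zeta> where \<zeta>: "\<zeta> \<in> closed_segment a b" "f b - f a = (b - a) * D \<zeta>"
    using mean_value_segment[of f D a b] der by blast
  have \<xi>': "\<xi> \<in> closed_segment a b"
    using \<xi>(1) z by (auto simp: closed_segment_eq_real_ivl split: if_splits)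
  show "- \<omega> * \<bar>b - a\<bar> \<le> sgn (b - a) * (f z - f a - chord_slope f a b * (z - a))"
  proof (cases "a = b")
    case False
    then have "chord_slope f a b = D \<zeta>" using \<zeta>(2) by (simp add: chord_slope_def)
    then have "f z - f a - chord_slope f a b * (z - a) = (D \<xi> - D \<zeta>) * (z - a)"
      using \<xi>(2) by (simp add: algebra_simps)
    then have "\<bar>sgn (b - a) * (f z - f a - chord_slope f a b * (z - a))\<bar> \<le> \<bar>D \<xi> - D \<zeta>\<bar> * \<bar>z - a\<bar>"
      by (simp add: abs_mult sgn_if)
    also have "\<dots> \<le> \<omega> * \<bar>b - a\<bar>"
      using osc[OF \<xi>' \<zeta>(1)] z by (intro mult_mono) (auto simp: closed_segment_eq_real_ivl split: if_splits)
    finally show ?thesis by linarith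
  qed simp
qed

text \<open>Adding equidistant points to \<open>V\<close> makes neighbours so close that uniform
  continuity of \<open>D\<close> on \<open>{-B..B}\<close> bounds its oscillation between them by
  \<open>\<omega>\<close>.\<close>

lemma fine_grid_exists:
  fixes f D :: "real \<Rightarrow> real"
  assumes der: "\<And>x. (f has_real_derivative D x) (at x)" and cont: "continuous_on UNIV D"
    and \<omega>: "0 < \<omega>" and V: "finite V" "V \<subseteq> {-B..B}" and B: "0 < B"
  obtains G where "finite G" "V \<subseteq> G" "G \<subseteq> {-B..B}" "fine_grid f \<omega> G"
proof -
  have "uniformly_continuous_on {-B..B} D"
    using cont by (intro compact_uniformly_continuous) (auto intro: continuous_on_subset)
  then obtain \<delta> where \<delta>: "\<delta> > 0"
    "\<And>x y. x \<in> {-B..B} \<Longrightarrow> y \<in> {-B..B} \<Longrightarrow> \<bar>x - y\<bar> < \<delta> \<Longrightarrow> \<bar>D x - D y\<bar> < \<omega>"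
    using \<omega> unfolding uniformly_continuous_on_def dist_real_def by blast
  obtain N :: nat where N: "2 * B / \<delta> < real N" using reals_Archimedean2 by blast
  have N0: "0 < real N" using N B \<delta>(1) by (intro order_le_less_trans[OF _ N]) auto
  define d where "d = 2 * B / real N"
  have d: "0 < d" "d < \<delta>" "real N * d = 2 * B"
    using N N0 B \<delta>(1) by (auto simp: d_def field_simps)
  define P where "P = (\<lambda>i. - B + real i * d) ` {..N}"
  have P: "P \<subseteq> {-B..B}"
  proof
    fix x assume "x \<in> P"
    then obtain i where i: "i \<le> N" "x = - B + real i * d" by (auto simp: P_def)
    have "real i * d \<le> real N * d" using i d by (intro mult_right_mono) auto
    then show "x \<in> {-B..B}" using i d by auto
  qed
  have gap: "h - g \<le> d" if gh: "g < h" "g \<in> {-B..B}" "h \<in> {-B..B}" "(V \<union> P) \<inter> {g<..<h} = {}" for g h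
  proof (rule ccontr)
    assume "\<not> h - g \<le> d"
    \<comment> \<open>The index of the first equidistant point strictly above \<open>g\<close>; if
      the gap were longer than \<open>d\<close>, this point would lie inside it.\<close>
    define i where "i = nat (\<lfloor>(g + B) / d\<rfloor> + 1)"
    have "0 \<le> (g + B) / d" using gh d by auto
    then have i: "real i = \<lfloor>(g + B) / d\<rfloor> + 1" by (simp add: i_def)
    then have "(g + B) / d < real i" "real i \<le> (g + B) / d + 1" by linarith+
    then have x: "g + B < real i * d" "real i * d \<le> g + B + d" using d by (auto simp: field_simps)
    then have "real i * d < real N * d" using \<open>\<not> h - g \<le> d\<close> gh d by auto
    then have "i \<le> N" using d(1) by (simp only: mult_less_cancel_right_pos of_nat_less_iff less_imp_le)
    then have "- B + real i * d \<in> P" by (auto simp: P_def)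
    then show False using gh(4) x \<open>\<not> h - g \<le> d\<close> by fastforce
  qed
  show ?thesis
  proof (rule that)
    show "finite (V \<union> P)" using V by (simp add: P_def)
    show "V \<union> P \<subseteq> {-B..B}" using V P by auto
    show "fine_grid f \<omega> (V \<union> P)" unfolding fine_grid_def
    proof (intro ballI impI)
      fix g h assume gh: "g \<in> V \<union> P" "h \<in> V \<union> P" "(V \<union> P) \<inter> open_segment g h = {}"
      have gB: "g \<in> {-B..B}" "h \<in> {-B..B}" using gh V P by auto
      have "\<bar>h - g\<bar> \<le> d"
        using gap[of g h] gap[of h g] gh(3) gB d(1)
        by (cases g h rule: linorder_cases) (auto simp: open_segment_eq_real_ivl)
      then show "admissible f \<omega> g h"
      proof (intro admissible_small_oscillation[OF der])
        fix x y assume xy: "x \<in> closed_segment g h" "y \<in> closed_segment g h"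
        then have "x \<in> {-B..B}" "y \<in> {-B..B}" "\<bar>x - y\<bar> \<le> \<bar>h - g\<bar>"
          using gB by (auto simp: closed_segment_eq_real_ivl split: if_splits)
        then show "\<bar>D x - D y\<bar> \<le> \<omega>" using \<delta>(2)[of x y] \<open>\<bar>h - g\<bar> \<le> d\<close> d(2) by force
      qed
    qed
  qed auto
qed

lemma step_measurable [measurable]: "step k fs \<in> borel_measurable borel"
proof (induction fs arbitrary: k)
  case (Cons z fs)
  obtain y c where z: "z = (y, c)" by force
  have [measurable]: "step c fs \<in> borel_measurable borel" by (rule Cons)
  have "step k (z # fs) = (\<lambda>x. if y < x then step c fs x else k)" by (simp add: z fun_eq_iff)
  then show ?case by simp
next
  case Nil
  have "step k [] = (\<lambda>_. k)" by (simp add: fun_eq_iff)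
  then show ?case by simp
qed

lemma step_in_values: "step k fs x \<in> set (k # map snd fs)"
  by (induction k fs x rule: step.induct) auto

section \<open>Sampling the datum\<close>

lemma pvar_pairs:
  "(\<Sum>i<N. \<bar>b i - a i\<bar> powr p) \<le> pvar p (concat (map (\<lambda>i. [a i, b i]) [0..<N]))"
proof (induction N)
  case (Suc N)
  define l where "l = concat (map (\<lambda>i. [a i, b i]) [0..<N])"
  have "pvar p l + \<bar>b N - a N\<bar> powr p \<le> pvar p (l @ [a N, b N])"
    using pvar_join[of p l "a N" "[b N]"] pvar_snoc[of l p "a N"] by (cases "l = []") auto
  then show ?case using Suc by (simp add: l_def)
qed simp

lemma sorted_wrt_pairs:
  fixes y z :: "nat \<Rightarrow> real"
  assumes "\<And>i. y i < z i" "\<And>i. z i < y (Suc i)"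
  shows "sorted_wrt (<) (concat (map (\<lambda>i. [y i, z i]) [0..<N])) \<and>
    (\<forall>x\<in>set (concat (map (\<lambda>i. [y i, z i]) [0..<N])). x < y N)"
proof (induction N)
  case (Suc N)
  have "y N < z N" "z N < y (Suc N)" "y N < y (Suc N)" using assms[of N] by auto
  then show ?case using Suc by (fastforce simp: sorted_wrt_append)
qed simp

lemma TVs_pairs_le:
  assumes TV: "TVs s w UNIV \<le> ennreal C" "0 \<le> C"
    and yz: "\<And>i. y i < z i" "\<And>i. z i < y (Suc i)"
  shows "(\<Sum>i<N. \<bar>w (z i) - w (y i)\<bar> powr (1 / s)) \<le> C"
proof -
  define l where "l = concat (map (\<lambda>i. [y i, z i]) [0..<N])"
  have "sorted_wrt (<) l" using sorted_wrt_pairs[where y = y and z = z and N = N, OF yz] by (simp add: l_def)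
  then have "pvar (1 / s) (map w l) \<le> C"
    using pvar_le_self[OF pvar_le_TVs[OF TV]] by (simp add: strict_sorted_iff)
  moreover have "map w l = concat (map (\<lambda>i. [w (y i), w (z i)]) [0..<N])"
    by (simp add: l_def map_concat o_def)
  ultimately show ?thesis using pvar_pairs[of "\<lambda>i. w (z i)" "\<lambda>i. w (y i)" "1 / s" N] by simp
qed

text \<open>A distance above 1 is at most its \<open>p\<close>-th power. The crude
  \<open>1 + C\<close> suffices, as it only enters bounds on the range and on bad cells.\<close>

lemma abs_le_of_powr_le:
  fixes d p C :: real
  assumes "1 \<le> p" "0 \<le> C" "\<bar>d\<bar> powr p \<le> C"
  shows "\<bar>d\<bar> \<le> 1 + C"
proof (cases "\<bar>d\<bar> \<le> 1")
  case False
  then have "\<bar>d\<bar> powr 1 \<le> \<bar>d\<bar> powr p" using assms(1) by (intro powr_mono) auto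
  then show ?thesis using assms(3) by simp
qed (use assms(2) in auto)

lemma TVs_bounded:
  assumes TV: "TVs s w UNIV \<le> ennreal C" "0 \<le> C" and s: "0 < s" "s \<le> 1"
  shows "\<bar>w x - w y\<bar> \<le> 1 + C"
proof -
  have *: "\<bar>w b - w a\<bar> \<le> 1 + C" if "a < b" for a b
    using pvar_le_self[OF pvar_le_TVs[OF TV, of "[a, b]"]] that s TV(2)
    by (intro abs_le_of_powr_le[of "1 / s"]) auto
  consider "x = y" | "x < y" | "y < x" by linarith
  then show ?thesis using *[of x y] *[of y x] TV by cases (auto simp: abs_minus_commute)
qed

definition sample_fronts :: "(real \<Rightarrow> real) \<Rightarrow> (nat \<Rightarrow> real) \<Rightarrow> nat \<Rightarrow> nat \<Rightarrow> (real \<times> real) list" where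
  "sample_fronts w y i N = map (\<lambda>j. (y j, w (y j))) [i..<N]"

lemma step_sample_fronts:
  fixes y :: "nat \<Rightarrow> real"
  assumes "strict_mono y" "i \<le> j" "j < N" "y j < x" "x \<le> y (Suc j)"
  shows "step (w (y i)) (sample_fronts w y (Suc i) N) x = w (y j)"
  using assms(2,3)
proof (induction "N - i" arbitrary: i)
  case (Suc n)
  show ?case
  proof (cases "i = j")
    case True
    then show ?thesis using assms(5) by (cases "Suc i < N") (auto simp: sample_fronts_def upt_conv_Cons)
  next
    case False
    then have "y (Suc i) \<le> y j" using Suc.prems assms(1) by (simp add: strict_mono_less_eq)
    then have "y (Suc i) < x" using assms(4) by simp
    moreover have "sample_fronts w y (Suc i) N = (y (Suc i), w (y (Suc i))) # sample_fronts w y (Suc (Suc i)) N"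
      using False Suc.prems by (simp add: sample_fronts_def upt_rec[of "Suc i"])
    ultimately show ?thesis using Suc.hyps(1)[of "Suc i"] Suc.hyps(2) False Suc.prems by simp
  qed
qed simp

text \<open>Only boundedly many cells of the sampling grid see an oscillation larger than \<open>\<eta>\<close>, and
  the total length of these cells tends to zero.\<close>

lemma sampling_approximation:
  assumes s: "0 < s" "s \<le> 1" and TV: "TVs s w UNIV \<le> ennreal C" "0 \<le> C"
    and R: "0 < R" and \<epsilon>: "0 < \<epsilon>"
  obtains k fs g where "sorted (map fst fs)" "set (k # map snd fs) \<subseteq> range w"
    "pvar_le (1 / s) C (k # map snd fs)"
    "integrable lebesgue g" "\<And>x. 0 \<le> g x"
    "AE x in lebesgue. \<bar>x\<bar> \<le> R \<longrightarrow> \<bar>w x - step k fs x\<bar> \<le> g x" "(LINT x|lebesgue. g x) \<le> \<epsilon>"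
proof -
  define p where "p = 1 / s"
  \<comment> \<open>An oscillation of \<open>\<eta>\<close> over the whole window of length
    \<open>2 * R\<close> costs half of \<open>\<epsilon>\<close>.\<close>
  define \<eta> where "\<eta> = \<epsilon> / (4 * R)"
  have \<eta>: "0 < \<eta>" "2 * R * \<eta> = \<epsilon> / 2" using R \<epsilon> by (auto simp: \<eta>_def)
  have \<eta>p: "0 < \<eta> powr p" using \<eta> by simp
  \<comment> \<open>At most \<open>C / \<eta> powr p\<close> cells are bad, each of length
    \<open>2 * R / N\<close> with error at most \<open>1 + C\<close>; this size of \<open>N\<close>
    makes their total at most \<open>\<epsilon> / 2\<close>.\<close>
  obtain N0 :: nat where N0: "4 * R * (1 + C) * C / (\<eta> powr p * \<epsilon>) < real N0" using reals_Archimedean2 by blast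
  define N where "N = Suc N0"
  have N: "0 < real N" "4 * R * (1 + C) * C / (\<eta> powr p * \<epsilon>) \<le> real N" using N0 by (auto simp: N_def)
  define h where "h = 2 * R / real N"
  have h: "0 < h" "real N * h = 2 * R" using R N by (auto simp: h_def)
  define y where "y i = - R + real i * h" for i
  have ySuc: "y (Suc i) = y i + h" for i by (simp add: y_def algebra_simps)
  have ymono: "strict_mono y" using h by (intro strict_monoI_Suc) (simp add: ySuc)
  define fs where "fs = sample_fronts w y (Suc 0) N"
  have vals: "w (y 0) # map snd fs = map w (map y [0..<N])"
    using N by (simp add: fs_def sample_fronts_def upt_rec[of 0])
  have sorted_y: "sorted (map y [0..<n])" "distinct (map y [0..<n])" for n
    using ymono by (auto simp: sorted_iff_nth_mono strict_mono_less_eq distinct_map strict_mono_imp_inj_on inj_on_subset)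
  define Bad where "Bad = {i. i < N \<and> (\<exists>z. y i < z \<and> z < y (Suc i) \<and> \<eta> < \<bar>w z - w (y i)\<bar>)}"
  have fBad: "finite Bad" by (rule finite_subset[of _ "{..<N}"]) (auto simp: Bad_def)
  have cBad: "real (card Bad) * \<eta> powr p \<le> C"
  proof -
    \<comment> \<open>In a bad cell \<open>z i\<close> witnesses the oscillation. The midpoint in
      the other cells is a mere placeholder that keeps the points \<open>y i\<close>,
      \<open>z i\<close> interleaved for all \<open>i\<close>.\<close>
    define z where "z i = (if i \<in> Bad then SOME z. y i < z \<and> z < y (Suc i) \<and> \<eta> < \<bar>w z - w (y i)\<bar>
      else y i + h / 2)" for i
    have zB: "y i < z i \<and> z i < y (Suc i) \<and> \<eta> < \<bar>w (z i) - w (y i)\<bar>" if "i \<in> Bad" for i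
    proof -
      have "\<exists>z. y i < z \<and> z < y (Suc i) \<and> \<eta> < \<bar>w z - w (y i)\<bar>" using that by (auto simp: Bad_def)
      from someI_ex[OF this] show ?thesis using that by (simp add: z_def)
    qed
    have z: "y i < z i" "z i < y (Suc i)" for i
      using zB[of i] h by (cases "i \<in> Bad"; simp add: z_def ySuc)+
    have "real (card Bad) * \<eta> powr p = (\<Sum>i\<in>Bad. \<eta> powr p)" by simp
    also have "\<dots> \<le> (\<Sum>i\<in>Bad. \<bar>w (z i) - w (y i)\<bar> powr p)"
      using zB \<eta> s by (intro sum_mono powr_mono2) (auto simp: p_def intro: less_imp_le)
    also have "\<dots> \<le> (\<Sum>i<N. \<bar>w (z i) - w (y i)\<bar> powr p)"
      by (intro sum_mono2) (auto simp: Bad_def)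
    also have "\<dots> \<le> C" unfolding p_def by (rule TVs_pairs_le[where y = y and z = z, OF TV z])
    finally show ?thesis .
  qed
  \<comment> \<open>On good cells the error is at most \<open>\<eta>\<close>, on bad ones at most
    the global oscillation \<open>1 + C\<close>.\<close>
  define g where "g x = \<eta> * indicator {-R..R} x + (\<Sum>i\<in>Bad. (1 + C) * indicator {y i..y (Suc i)} x)" for x
  have gi: "integrable lebesgue (\<lambda>x. c * indicator {a..b} x)" for a b c :: real
    by (intro integrable_mult_right integrable_real_indicator) (auto simp: emeasure_lborel_Icc_eq)
  show ?thesis
  proof (rule that)
    show "sorted (map fst fs)"
      using ymono by (auto simp: fs_def sample_fronts_def o_def sorted_iff_nth_mono strict_mono_less_eq)
    show "set (w (y 0) # map snd fs) \<subseteq> range w" unfolding vals by auto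
    show "pvar_le (1 / s) C (w (y 0) # map snd fs)"
      unfolding vals by (rule pvar_le_TVs[OF TV sorted_y])
    show "integrable lebesgue g" unfolding g_def[abs_def]
      by (intro Bochner_Integration.integrable_add Bochner_Integration.integrable_sum gi)
    show "0 \<le> g x" for x unfolding g_def using \<eta> TV by (intro add_nonneg_nonneg sum_nonneg) auto
    have "(LINT x|lebesgue. g x) = \<eta> * (2 * R) + (\<Sum>i\<in>Bad. (1 + C) * h)"
      unfolding g_def using gi R h(1) by (subst Bochner_Integration.integral_add) (auto simp: ySuc)
    also have "\<dots> = \<epsilon> / 2 + (1 + C) * h * real (card Bad)"
      using \<eta>(2) by (simp add: mult.commute)
    also have "(1 + C) * h * real (card Bad) \<le> (1 + C) * h * (C / \<eta> powr p)"
      using cBad \<eta>p TV h(1) by (intro mult_left_mono) (auto simp: pos_le_divide_eq)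
    also have "\<dots> \<le> \<epsilon> / 2"
      using N \<eta>p \<epsilon> by (simp add: h_def field_simps)
    finally show "(LINT x|lebesgue. g x) \<le> \<epsilon>" by simp
    \<comment> \<open>The finitely many sampling points are excluded because \<open>Bad\<close>
      tests the oscillation only at interior points of the cells.\<close>
    have "\<bar>w x - step (w (y 0)) fs x\<bar> \<le> g x" if x: "\<bar>x\<bar> \<le> R" "x \<notin> y ` {..N}" for x
    proof -
      define i where "i = nat \<lfloor>(x + R) / h\<rfloor>"
      have pos: "0 \<le> (x + R) / h" using x h by auto
      then have "real i \<le> (x + R) / h" "(x + R) / h < real i + 1" unfolding i_def by linarith+
      then have yi: "y i \<le> x" "x < y (Suc i)" using h by (auto simp: y_def field_simps)
      have "y N = R" using h by (simp add: y_def)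
      then have "x \<noteq> R" using x(2) by (metis atMost_iff imageI order_refl)
      then have "real i * h < real N * h" using yi x h by (auto simp: y_def)
      then have iN: "i < N" using h(1) by (simp only: mult_less_cancel_right_pos of_nat_less_iff)
      then have yi': "y i < x" using yi(1) x(2) by (cases "y i = x") auto
      have st: "step (w (y 0)) fs x = w (y i)"
        unfolding fs_def using yi' yi(2) by (intro step_sample_fronts ymono iN) auto
      have ind: "0 \<le> (\<Sum>i\<in>Bad. (1 + C) * indicator {y i..y (Suc i)} x)"
        using TV by (intro sum_nonneg) auto
      show ?thesis
      proof (cases "i \<in> Bad")
        case True
        have "(1 + C) * indicator {y i..y (Suc i)} x \<le> (\<Sum>i\<in>Bad. (1 + C) * indicator {y i..y (Suc i)} x)"
          using True fBad TV by (intro member_le_sum) auto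
        then have "1 + C \<le> g x" using yi \<eta> by (simp add: g_def indicator_def)
        then show ?thesis using TVs_bounded[OF TV s, of x "y i"] st by simp
      next
        case False
        have "\<bar>w x - w (y i)\<bar> \<le> \<eta>"
        proof (rule ccontr)
          assume "\<not> ?thesis"
          then have "i \<in> Bad" unfolding Bad_def using iN yi' yi(2) by auto
          then show False using False by simp
        qed
        then show ?thesis using st ind x by (simp add: g_def indicator_def abs_le_iff)
      qed
    qed
    moreover have "AE x in lebesgue. x \<notin> y ` {..N}"
      by (intro AE_not_in) (simp add: negligible_finite flip: negligible_iff_null_sets)
    ultimately show "AE x in lebesgue. \<bar>x\<bar> \<le> R \<longrightarrow> \<bar>w x - step (w (y 0)) fs x\<bar> \<le> g x"
      by (auto elim: AE_mp)
  qed
qed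

section \<open>Lower semicontinuity of the essential variation\<close>

text \<open>The condition \<open>0 < p\<close> gives continuity of the power also where an increment
  tends to 0.\<close>

lemma tendsto_pvar:
  assumes "0 < p" "\<And>x. x \<in> set xs \<Longrightarrow> (\<lambda>n. F n x) \<longlonglongrightarrow> L x"
  shows "(\<lambda>n. pvar p (map (F n) xs)) \<longlonglongrightarrow> pvar p (map L xs)"
  using assms(2)
proof (induction xs)
  case (Cons a xs)
  show ?case
  proof (cases xs)
    case (Cons b ys)
    have "(\<lambda>n. \<bar>F n b - F n a\<bar> powr p + pvar p (map (F n) xs)) \<longlonglongrightarrow> \<bar>L b - L a\<bar> powr p + pvar p (map L xs)"
      using Cons Cons.prems assms(1) by (intro tendsto_intros Cons.IH) auto
    then show ?thesis using Cons by simp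
  qed simp
qed simp

lemma eventually_sorted_map:
  fixes e :: "real \<Rightarrow> nat \<Rightarrow> real"
  assumes "\<And>x. e x \<longlonglongrightarrow> x" "sorted xs" "distinct xs"
  shows "eventually (\<lambda>n. sorted (map (\<lambda>x. e x n) xs)) sequentially"
proof -
  have "eventually (\<lambda>n. \<forall>i\<in>{i. Suc i < length xs}. e (xs ! i) n \<le> e (xs ! Suc i) n) sequentially"
  proof (rule eventually_ball_finite)
    show "\<forall>i\<in>{i. Suc i < length xs}. eventually (\<lambda>n. e (xs ! i) n \<le> e (xs ! Suc i) n) sequentially"
    proof
      fix i assume i: "i \<in> {i. Suc i < length xs}"
      then have "xs ! i \<le> xs ! Suc i" "xs ! i \<noteq> xs ! Suc i"
        using assms(2,3) by (auto simp: sorted_iff_nth_Suc nth_eq_iff_index_eq)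
      then have "xs ! i < xs ! Suc i" by simp
      then obtain m where m: "xs ! i < m" "m < xs ! Suc i" using dense by blast
      have "eventually (\<lambda>n. e (xs ! i) n < m) sequentially" "eventually (\<lambda>n. m < e (xs ! Suc i) n) sequentially"
        using order_tendstoD(2)[OF assms(1) m(1)] order_tendstoD(1)[OF assms(1) m(2)] by auto
      then show "eventually (\<lambda>n. e (xs ! i) n \<le> e (xs ! Suc i) n) sequentially"
        by eventually_elim simp
    qed
    show "finite {i. Suc i < length xs}" by (rule finite_subset[of _ "{..<length xs}"]) auto
  qed
  then show ?thesis by (simp add: sorted_iff_nth_Suc)
qed

text \<open>On the null set where the sequence does not converge, the representative of the limit takes
  cluster values of its restriction to the set of convergence.\<close>

lemma ess_TVs_le_of_AE_limit:
  fixes W :: "nat \<Rightarrow> real \<Rightarrow> real"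
  assumes s: "0 < s" "s \<le> 1" and C: "0 \<le> C"
    and lim: "AE x in lebesgue. (\<lambda>n. W n x) \<longlonglongrightarrow> U x"
    and W: "\<And>n xs. sorted xs \<Longrightarrow> pvar (1 / s) (map (W n) xs) \<le> C"
  shows "ess_TVs s U UNIV \<le> ennreal C"
proof -
  define p where "p = 1 / s"
  have p: "0 < p" "1 \<le> p" using s by (auto simp: p_def)
  define E where "E = {x. (\<lambda>n. W n x) \<longlonglongrightarrow> U x}"
  have AE_E: "AE x in lebesgue. x \<in> E" using lim by (simp add: E_def)
  have dense_E: "\<exists>e\<in>E. a < e \<and> e < b" if "a < b" for a b
  proof (rule ccontr)
    assume "\<not> ?thesis"
    then have "AE x in lebesgue. x \<notin> {a<..<b}" using AE_E by (auto elim!: eventually_mono)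
    then have "{a<..<b} \<in> null_sets lebesgue" by (subst AE_iff_null_sets) auto
    then show False using that by (auto simp: null_sets_def)
  qed
  have UE: "pvar p (map U xs) \<le> C" if "sorted xs" "set xs \<subseteq> E" for xs
  proof (rule LIMSEQ_le_const2)
    show "(\<lambda>n. pvar p (map (W n) xs)) \<longlonglongrightarrow> pvar p (map U xs)"
      using that p by (intro tendsto_pvar) (auto simp: E_def)
    show "\<exists>N. \<forall>n\<ge>N. pvar p (map (W n) xs) \<le> C" using W that by (auto simp: p_def)
  qed
  have Ub: "\<bar>U x - U y\<bar> \<le> 1 + C" if "x \<in> E" "y \<in> E" for x y
  proof -
    have *: "\<bar>U b - U a\<bar> \<le> 1 + C" if "a \<le> b" "a \<in> E" "b \<in> E" for a b
      using UE[of "[a, b]"] that p C by (intro abs_le_of_powr_le[of p]) auto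
    show ?thesis using *[of x y] *[of y x] that by (cases "x \<le> y") (auto simp: abs_minus_commute)
  qed
  \<comment> \<open>For \<open>x\<close> in \<open>E\<close> the constant sequence is taken, so the
    new representative agrees with \<open>U\<close> almost everywhere. Otherwise points of
    \<open>E\<close> approach \<open>x\<close> from the right, and boundedness of \<open>U\<close>
    on \<open>E\<close> yields a cluster value.\<close>
  have "\<exists>e l. (\<forall>n. e n \<in> E) \<and> e \<longlonglongrightarrow> x \<and> (\<lambda>n. U (e n)) \<longlonglongrightarrow> l \<and> (x \<in> E \<longrightarrow> l = U x)" for x
  proof (cases "x \<in> E")
    case True
    then show ?thesis by (intro exI[of _ "\<lambda>_. x"] exI[of _ "U x"]) auto
  next
    case False
    have "\<exists>e\<in>E. x < e \<and> e < x + inverse (real (Suc n))" for n by (intro dense_E) simp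
    then obtain e where e: "\<And>n. e n \<in> E" "\<And>n. x < e n" "\<And>n. e n < x + inverse (real (Suc n))" by metis
    have "e \<longlonglongrightarrow> x"
    proof (rule tendsto_sandwich)
      show "(\<lambda>n. x) \<longlonglongrightarrow> x" by simp
      show "(\<lambda>n. x + inverse (real (Suc n))) \<longlonglongrightarrow> x"
        using tendsto_add[OF tendsto_const LIMSEQ_inverse_real_of_nat, of x] by simp
    qed (auto intro!: always_eventually less_imp_le e simp del: of_nat_Suc)
    have "bounded (range (\<lambda>n. U (e n)))"
      unfolding bounded_iff
    proof (intro exI ballI)
      fix z assume "z \<in> range (\<lambda>n. U (e n))"
      then obtain n where "z = U (e n)" by auto
      then show "norm z \<le> \<bar>U (e 0)\<bar> + (1 + C)" using Ub[OF e(1)[of n] e(1)[of 0]] by simp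
    qed
    then obtain l r where r: "strict_mono r" "((\<lambda>n. U (e n)) \<circ> r) \<longlonglongrightarrow> l"
      using bounded_imp_convergent_subsequence by blast
    have "(e \<circ> r) \<longlonglongrightarrow> x" using \<open>e \<longlonglongrightarrow> x\<close> r(1) by (rule LIMSEQ_subseq_LIMSEQ)
    then show ?thesis using r(2) e(1) False by (intro exI[of _ "e \<circ> r"] exI[of _ l]) (auto simp: o_def)
  qed
  then obtain e V where eV: "\<And>x n. e x n \<in> E" "\<And>x. e x \<longlonglongrightarrow> x" "\<And>x. (\<lambda>n. U (e x n)) \<longlonglongrightarrow> V x"
    "\<And>x. x \<in> E \<Longrightarrow> V x = U x" by metis
  have "ess_TVs s U UNIV \<le> TVs s V UNIV"
    unfolding ess_TVs_def using AE_E eV(4) by (intro INF_lower) (auto elim!: eventually_mono)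
  also have "\<dots> \<le> ennreal C"
    unfolding TVs_def
  proof (rule SUP_least)
    fix \<sigma> :: "real set" assume "\<sigma> \<in> subdivisions UNIV"
    define xs where "xs = sorted_list_of_set \<sigma>"
    have xs: "sorted xs" "distinct xs" by (auto simp: xs_def)
    have "pvar p (map V xs) \<le> C"
    proof (rule tendsto_upperbound)
      show "(\<lambda>n. pvar p (map (\<lambda>x. U (e x n)) xs)) \<longlonglongrightarrow> pvar p (map V xs)"
        using p eV(3) by (intro tendsto_pvar)
      \<comment> \<open>For large \<open>n\<close> the approximating points inherit the order of the
        distinct points of \<open>xs\<close>, so \<open>UE\<close> applies to them.\<close>
      show "eventually (\<lambda>n. pvar p (map (\<lambda>x. U (e x n)) xs) \<le> C) sequentially"
        using eventually_sorted_map[OF eV(2) xs]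
      proof eventually_elim
        case (elim n)
        have "pvar p (map U (map (\<lambda>x. e x n) xs)) \<le> C" using elim eV(1) by (intro UE) auto
        then show ?case by (simp add: o_def)
      qed
    qed simp
    then show "ennreal (TVs_subdiv s V \<sigma>) \<le> ennreal C"
      by (simp add: TVs_subdiv_eq_pvar xs_def p_def ennreal_leI)
  qed
  finally show ?thesis .
qed

section \<open>The estimate for the entropy solution\<close>

context borel_entropy_solution
begin

lemma u_measurable:
  assumes "0 \<le> t"
  shows "u t \<in> borel_measurable lebesgue"
proof (rule borel_measurable_LIMSEQ_metric)
  fix n
  have "set_integrable lebesgue {- real (Suc n)..real (Suc n)} (u t)"
    using continuous_u assms by (simp add: continuous_L1loc_def locally_integrable_def del: of_nat_Suc)
  then show "(\<lambda>x. indicator {- real (Suc n)..real (Suc n)} x * u t x) \<in> borel_measurable lebesgue"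
    by (auto simp: set_integrable_def)
next
  fix x
  obtain N where N: "\<bar>x\<bar> < real N" using reals_Archimedean2 by blast
  have "eventually (\<lambda>n. indicator {- real (Suc n)..real (Suc n)} x * u t x = u t x) sequentially"
    using eventually_ge_at_top[of N]
  proof eventually_elim
    case (elim n)
    then have "x \<in> {- real (Suc n)..real (Suc n)}" using N by auto
    then show ?case by simp
  qed
  then show "(\<lambda>n. indicator {- real (Suc n)..real (Suc n)} x * u t x) \<longlonglongrightarrow> u t x"
    by (rule tendsto_eventually)
qed

lemma step_measurable_lebesgue: "step k fs \<in> borel_measurable lebesgue"
  by (rule measurable_completion) simp

lemma integrable_diff_step:
  assumes "0 \<le> t" "0 < r"
  shows "integrable lebesgue (\<lambda>x. indicator {-r..r} x * (u t x - step k fs x))"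
proof -
  obtain K where K: "\<And>z. z \<in> set (k # map snd fs) \<Longrightarrow> \<bar>z\<bar> \<le> K"
    using finite_imp_bounded[of "set (k # map snd fs)"] unfolding bounded_iff by auto
  have "set_integrable lebesgue {-r..r} (u t)"
    using continuous_u assms by (auto simp: continuous_L1loc_def locally_integrable_def)
  moreover have "set_integrable lebesgue {-r..r} (step k fs)"
    unfolding set_integrable_def
  proof (rule Bochner_Integration.integrable_bound)
    show "integrable lebesgue (\<lambda>x. K * indicator {-r..r} x)"
      by (intro integrable_mult_right integrable_real_indicator) (auto simp: emeasure_lborel_Icc_eq)
    show "(\<lambda>x. indicator {-r..r} x *\<^sub>R step k fs x) \<in> borel_measurable lebesgue"
      unfolding real_scaleR_def
      by (intro borel_measurable_times borel_measurable_indicator step_measurable_lebesgue) simp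
    have "\<bar>step k fs x\<bar> \<le> \<bar>K\<bar>" for x using K[OF step_in_values, of x] by linarith
    then show "AE x in lebesgue. norm (indicator {-r..r} x *\<^sub>R step k fs x) \<le> norm (K * indicator {-r..r} x)"
      by (auto simp: indicator_def)
  qed
  ultimately have "set_integrable lebesgue {-r..r} (\<lambda>x. u t x - step k fs x)"
    by (rule set_integral_diff(1))
  then show ?thesis by (simp add: set_integrable_def)
qed

text \<open>Of the radius \<open>r + 1 + L * T\<close>, the part \<open>L * T\<close> is lost to the
  shrinking of the cone up to time \<open>T\<close> and 1 to its smooth edge; on
  \<open>[-r, r]\<close> the cutoff is still 1.\<close>

lemma cone_dist_bounds_L1:
  assumes "0 \<le> T" "0 \<le> L" "0 < r"
  shows "(LINT x|lebesgue. \<bar>indicator {-r..r} x * (u T x - step k fs x)\<bar>)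
    \<le> cone_dist (r + 1 + L * T) L T (step k fs)"
  unfolding cone_dist_def
proof (rule integral_mono_AE')
  define R where "R = r + 1 + L * T"
  have R: "0 < R" using assms by (simp add: R_def add_pos_nonneg)
  define g where "g x = cone_weight R L (T, x)" for x
  have "continuous_on UNIV g"
    unfolding g_def by (rule continuous_on_compose2[OF continuous_on_cone_weight(1)[of UNIV]]) (auto intro!: continuous_intros)
  then have gm: "g \<in> borel_measurable lebesgue"
    by (intro measurable_completion) (simp add: borel_measurable_continuous_onI)
  have "integrable lebesgue (\<lambda>x. g x * \<bar>u T x - step k fs x\<bar>)"
  proof (rule Bochner_Integration.integrable_bound[OF integrable_diff_step[OF assms(1) R, of k fs]])
    show "(\<lambda>x. g x * \<bar>u T x - step k fs x\<bar>) \<in> borel_measurable lebesgue"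
      using gm u_measurable[OF assms(1)] step_measurable_lebesgue[of k fs] by measurable
    have "\<bar>g x\<bar> * \<bar>u T x - step k fs x\<bar> \<le> indicator {-R..R} x * \<bar>u T x - step k fs x\<bar>" for x
      using cone_weight_nonneg[of R L "(T, x)"] cone_weight_le_1[of R L "(T, x)"]
        cone_weight_eq_0[OF assms(2,1), of R x]
      by (intro mult_right_mono) (auto simp: g_def indicator_def)
    then show "AE x in lebesgue. norm (g x * \<bar>u T x - step k fs x\<bar>)
        \<le> norm (indicator {-R..R} x * (u T x - step k fs x))"
      by (simp add: abs_mult)
  qed
  then show "integrable lebesgue (\<lambda>x. cone_weight (r + 1 + L * T) L (T, x) * \<bar>u T x - step k fs x\<bar>)"
    by (simp add: g_def R_def)
  have "\<bar>indicator {-r..r} x * (u T x - step k fs x)\<bar> \<le> cone_weight R L (T, x) * \<bar>u T x - step k fs x\<bar>" for x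
  proof (cases "x \<in> {-r..r}")
    case True
    then have "cone_weight R L (T, x) = 1" by (simp add: cone_weight_def R_def smooth_step_eq_1)
    then show ?thesis using True by simp
  qed (simp add: cone_weight_nonneg)
  then show "AE x in lebesgue. \<bar>indicator {-r..r} x * (u T x - step k fs x)\<bar>
      \<le> cone_weight (r + 1 + L * T) L (T, x) * \<bar>u T x - step k fs x\<bar>"
    by (simp add: R_def)
qed (simp add: cone_weight_nonneg)

text \<open>Half of \<open>\<epsilon>\<close> is spent on sampling the datum, half on front
  tracking. The domination of lists passes the bound \<open>C\<close> from the sample through the
  refinement and all collisions.\<close>

lemma step_approximation:
  assumes s: "0 < s" "s \<le> 1"
    and der: "\<And>x. (f has_real_derivative D x) (at x)" and D: "continuous_on UNIV D"
    and w: "AE x in lebesgue. u 0 x = w x" and TV: "TVs s w UNIV \<le> ennreal C" "0 \<le> C"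
    and T: "0 \<le> T" and r: "0 < r" and \<epsilon>: "0 < \<epsilon>"
  shows "\<exists>k fs. pvar_le (1 / s) C (k # map snd fs) \<and>
    (LINT x|lebesgue. \<bar>indicator {-r..r} x * (u T x - step k fs x)\<bar>) \<le> \<epsilon>"
proof -
  have M0: "0 \<le> M" using v_bound[of undefined] by linarith
  \<comment> \<open>The interval must contain the values of \<open>v\<close>, bounded by
    \<open>M\<close>, and those of \<open>w\<close>, bounded by
    \<open>\<bar>w 0\<bar> + 1 + C\<close>, so that one Lipschitz constant \<open>L\<close> serves
    both.\<close>
  define B where "B = M + \<bar>w 0\<bar> + 1 + C + 1"
  have B: "0 < B" "M \<le> B" using M0 TV by (auto simp: B_def)
  have wB: "range w \<subseteq> {-B..B}"
  proof
    fix z assume "z \<in> range w"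
    then obtain x where "z = w x" by auto
    then show "z \<in> {-B..B}" using TVs_bounded[OF TV s, of x 0] M0 by (auto simp: B_def)
  qed
  have "bounded (D ` {-B..B})"
    using D by (intro compact_imp_bounded compact_continuous_image) (auto intro: continuous_on_subset)
  then obtain L' where L': "\<forall>z\<in>{-B..B}. \<bar>D z\<bar> \<le> L'" by (auto simp: bounded_iff)
  define L where "L = max 0 L'"
  have L: "0 \<le> L" by (simp add: L_def)
  have lip: "\<bar>f x - f y\<bar> \<le> L * \<bar>x - y\<bar>" if "x \<in> {-B..B}" "y \<in> {-B..B}" for x y
  proof -
    obtain \<xi> where \<xi>: "\<xi> \<in> closed_segment y x" "f x - f y = (x - y) * D \<xi>"
      using mean_value_segment[of f D y x] der by blast
    then have "\<xi> \<in> {-B..B}" using that by (auto simp: closed_segment_eq_real_ivl split: if_splits)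
    then have "\<bar>D \<xi>\<bar> \<le> L" using L' by (auto simp: L_def le_max_iff_disj)
    then show ?thesis using \<xi>(2) mult_right_mono[of "\<bar>D \<xi>\<bar>" L "\<bar>x - y\<bar>"] by (simp add: abs_mult mult.commute)
  qed
  define R where "R = r + 1 + L * T"
  have R: "0 < R" using r L T by (simp add: R_def add_pos_nonneg)
  have half_pos: "0 < \<epsilon> / 2" using \<epsilon> by simp
  obtain k fs0 g where fs0: "sorted (map fst fs0)" "set (k # map snd fs0) \<subseteq> range w"
    "pvar_le (1 / s) C (k # map snd fs0)"
    and g: "integrable lebesgue g" "\<And>x. 0 \<le> g x"
      "AE x in lebesgue. \<bar>x\<bar> \<le> R \<longrightarrow> \<bar>w x - step k fs0 x\<bar> \<le> g x" "(LINT x|lebesgue. g x) \<le> \<epsilon> / 2"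
    by (rule sampling_approximation[OF s TV R half_pos]) (rule that; assumption)
  have initial: "cone_dist R L 0 (step k fs0) \<le> \<epsilon> / 2"
  proof -
    have "cone_dist R L 0 (step k fs0) \<le> (LINT x|lebesgue. g x)"
      unfolding cone_dist_def
    proof (rule integral_mono_AE'[OF g(1)])
      show "AE x in lebesgue. cone_weight R L (0, x) * \<bar>u 0 x - step k fs0 x\<bar> \<le> g x"
        using w g(3)
      proof eventually_elim
        case (elim x)
        show ?case
        proof (cases "\<bar>x\<bar> \<le> R")
          case True
          have "cone_weight R L (0, x) * \<bar>u 0 x - step k fs0 x\<bar> \<le> 1 * \<bar>u 0 x - step k fs0 x\<bar>"
            by (intro mult_right_mono cone_weight_le_1) auto
          then show ?thesis using True elim by simp
        next
          case False
          then show ?thesis using cone_weight_eq_0[OF L, of 0 R x] g(2)[of x] by simp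
        qed
      qed
    qed (simp add: g(2))
    then show ?thesis using g(4) by simp
  qed
  obtain C1 where C1: "pvar_le 1 C1 (k # map snd fs0)" using pvar_le_exists by blast
  then have C1_0: "0 \<le> C1" unfolding pvar_le_def by (elim allE[of _ "[]"]) simp
  \<comment> \<open>\<open>C1\<close> depends on the sample already chosen, and
    \<open>\<omega>\<close> is adapted to it. Adding 1 to both factors keeps \<open>P\<close>
    positive when \<open>C1\<close> or \<open>T\<close> is 0, and \<open>C1 * T \<le> P\<close>
    holds the tracking error below \<open>\<epsilon> / 2\<close>.\<close>
  define P where "P = (C1 + 1) * (T + 1)"
  define \<omega> where "\<omega> = \<epsilon> / (4 * P)"
  have pos: "0 < P" using C1_0 T by (simp add: P_def)
  then have \<omega>: "0 < \<omega>" using \<epsilon> by (simp add: \<omega>_def)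
  have \<omega>e: "2 * \<omega> * C1 * (T - 0) \<le> \<epsilon> / 2"
  proof -
    have "C1 * T \<le> P" unfolding P_def using C1_0 T by (intro mult_mono) auto
    then have "2 * \<omega> * (C1 * T) \<le> 2 * \<omega> * P"
      using \<omega> by (intro mult_left_mono) auto
    also have "\<dots> = \<epsilon> / 2" using pos by (simp add: \<omega>_def)
    finally show ?thesis by (simp add: mult.assoc)
  qed
  have finV: "finite (set (k # map snd fs0))" by simp
  obtain G where G: "finite G" "set (k # map snd fs0) \<subseteq> G" "G \<subseteq> {-B..B}" "fine_grid f \<omega> G"
    by (rule fine_grid_exists[OF der D \<omega> finV subset_trans[OF fs0(2) wB] B(1)])
      (rule that; assumption)
  obtain fs1 where fs1: "step k fs1 = step k fs0" "set (k # map snd fs1) \<subseteq> G" "sorted (map fst fs1)"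
    "successively (admissible f \<omega>) (k # map snd fs1)"
    "pvar_dominates (k # map snd fs0) (k # map snd fs1)"
    using elementary_refinement[OF G(1,4,2) fs0(1)] by (metis append_Nil)
  have move: "cone_dist R L b (step k (advance f (b - a) k fs))
      \<le> cone_dist R L a (step k fs) + 2 * \<omega> * pvar 1 (k # map snd fs) * (b - a)"
    if "0 \<le> a" "a \<le> b" "set (k # map snd fs) \<subseteq> G"
      "successively (admissible f \<omega>) (k # map snd fs)"
      "\<And>\<tau>. 0 \<le> \<tau> \<Longrightarrow> \<tau> \<le> b - a \<Longrightarrow> sorted (map fst (advance f \<tau> k fs))" for a b k fs
  proof (cases "a = b")
    case False
    show ?thesis
    proof (rule cone_dist_move)
      fix z c assume zc: "\<bar>z\<bar> \<le> M" "c \<in> set (k # map snd fs)"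
      then have "c \<in> {-B..B}" using that(3) G(3) by blast
      moreover have "z \<in> {-B..B}" using zc(1) B by auto
      ultimately show "\<bar>f z - f c\<bar> \<le> L * \<bar>z - c\<bar>" by (intro lip)
    qed (use that False \<omega> L in auto)
  qed simp
  have C1': "pvar_le 1 C1 (k # map snd fs1)" using fs1(5) C1 by (simp add: pvar_dominates_def)
  have "\<exists>k' fs'. pvar_dominates (k # map snd fs1) (k' # map snd fs') \<and>
      cone_dist R L T (step k' fs') \<le> cone_dist R L 0 (step k fs1) + 2 * \<omega> * C1 * (T - 0)"
    by (rule front_tracking[OF G(1,4) less_imp_le[OF \<omega>] _ order_refl T fs1(2,4,3) C1'])
      (rule move; assumption)
  then obtain k' fs' where fs': "pvar_dominates (k # map snd fs1) (k' # map snd fs')"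
    "cone_dist R L T (step k' fs') \<le> cone_dist R L 0 (step k fs1) + 2 * \<omega> * C1 * (T - 0)"
    by blast
  have "pvar_le (1 / s) C (k' # map snd fs')"
    using fs0(3) fs1(5) fs'(1) s by (simp add: pvar_dominates_def)
  moreover have "(LINT x|lebesgue. \<bar>indicator {-r..r} x * (u T x - step k' fs' x)\<bar>) \<le> \<epsilon>"
    using cone_dist_bounds_L1[OF T L r, of k' fs'] fs'(2) initial \<omega>e fs1(1) by (simp add: R_def)
  ultimately show ?thesis by blast
qed

text \<open>Approximations with error \<open>1 / (n + 1)\<close> on windows of radius
  \<open>n + 1\<close> converge almost everywhere along a subsequence, which is the input for lower
  semicontinuity.\<close>

lemma ess_TVs_le_initial:
  assumes s: "0 < s" "s \<le> 1"
    and der: "\<And>x. (f has_real_derivative D x) (at x)" and D: "continuous_on UNIV D"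
    and w: "AE x in lebesgue. u 0 x = w x" and TV: "TVs s w UNIV \<le> ennreal C" "0 \<le> C"
    and T: "0 \<le> T"
  shows "ess_TVs s (u T) UNIV \<le> ennreal C"
proof -
  have "\<exists>k fs. pvar_le (1 / s) C (k # map snd fs) \<and>
    (LINT x|lebesgue. \<bar>indicator {- real (Suc n)..real (Suc n)} x * (u T x - step k fs x)\<bar>)
      \<le> inverse (real (Suc n))" for n
    by (rule step_approximation[OF s der D w TV T]) simp_all
  then obtain k fs where kfs: "\<And>n. pvar_le (1 / s) C (k n # map snd (fs n))"
    "\<And>n. (LINT x|lebesgue. \<bar>indicator {- real (Suc n)..real (Suc n)} x * (u T x - step (k n) (fs n) x)\<bar>)
      \<le> inverse (real (Suc n))" by metis
  define E where "E n x = indicator {- real (Suc n)..real (Suc n)} x * (u T x - step (k n) (fs n) x)" for n x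
  have "integrable lebesgue (E n)" for n
    unfolding E_def by (rule integrable_diff_step[OF T]) simp
  moreover have "(\<lambda>n. LINT x|lebesgue. norm (E n x)) \<longlonglongrightarrow> 0"
    by (rule tendsto_sandwich[OF _ _ tendsto_const LIMSEQ_inverse_real_of_nat])
      (use kfs(2) in \<open>auto simp: E_def simp del: of_nat_Suc\<close>)
  ultimately obtain q where q: "strict_mono q" "AE x in lebesgue. (\<lambda>n. E (q n) x) \<longlonglongrightarrow> 0"
    using tendsto_L1_AE_subseq[of lebesgue E] by blast
  show ?thesis
  proof (rule ess_TVs_le_of_AE_limit[OF s TV(2)])
    show "AE x in lebesgue. (\<lambda>n. step (k (q n)) (fs (q n)) x) \<longlonglongrightarrow> u T x"
      using q(2)
    proof eventually_elim
      case (elim x)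
      obtain N where N: "\<bar>x\<bar> < real N" using reals_Archimedean2 by blast
      have "(\<lambda>n. u T x - E (q n) x) \<longlonglongrightarrow> u T x" using tendsto_diff[OF tendsto_const elim, of "u T x"] by simp
      \<comment> \<open>As \<open>q n \<ge> n\<close>, the windows exhaust the line, and at a fixed
        \<open>x\<close> the indicator in \<open>E\<close> is eventually 1.\<close>
      moreover have "eventually (\<lambda>n. u T x - E (q n) x = step (k (q n)) (fs (q n)) x) sequentially"
        using eventually_ge_at_top[of N]
      proof eventually_elim
        case (elim n)
        then have "N \<le> q n" using strict_mono_imp_increasing[OF q(1), of n] by simp
        then have "x \<in> {- real (Suc (q n))..real (Suc (q n))}" using N by auto
        then show ?case by (simp add: E_def)
      qed
      ultimately show ?case by (rule Lim_transform_eventually)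
    qed
    show "pvar (1 / s) (map (step (k (q n)) (fs (q n))) xs) \<le> C" if "sorted xs" for n xs
      by (rule pvar_step_le[OF kfs(1) that])
  qed
qed

end

theorem theorem3p1:
  fixes s :: real and f u0 :: "real \<Rightarrow> real" and u :: "real \<Rightarrow> real \<Rightarrow> real"
  assumes "0 < s" and "s \<le> 1"
    and "u0 \<in> BVs s UNIV"
    and "f C1_differentiable_on UNIV"
    and "entropy_solution f u0 u"
  shows "\<forall>t>0. ess_TVs s (u t) UNIV \<le> ess_TVs s u0 UNIV"
proof (intro allI impI)
  fix t :: real assume "0 < t"
  obtain D where D: "\<And>x. (f has_real_derivative D x) (at x)" "continuous_on UNIV D"
    using assms(4) by (auto simp: C1_differentiable_on_def has_real_derivative_iff_has_vector_derivative)
  have "continuous_on UNIV f"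
    using D(1) by (intro continuous_at_imp_continuous_on) (auto intro: DERIV_isCont)
  then obtain v M where sol: "borel_entropy_solution f u v M"
    using entropy_solution_borel[OF assms(5)] by blast
  have u0: "AE x in lebesgue. u 0 x = u0 x" using assms(5) by (simp add: entropy_solution_def)
  show "ess_TVs s (u t) UNIV \<le> ess_TVs s u0 UNIV"
    unfolding ess_TVs_def[of s u0]
  proof (rule INF_greatest)
    \<comment> \<open>The initial condition holds only almost everywhere, so every representative
      \<open>w\<close> of \<open>u0\<close> is an initial datum for the same \<open>u\<close>. The
      estimate for each \<open>w\<close> gives the one for the infimum; an infinite variation needs
      no argument.\<close>
    fix w assume "w \<in> {v. AE x in lebesgue. x \<in> UNIV \<longrightarrow> v x = u0 x}"
    then have "AE x in lebesgue. w x = u0 x" by simp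
    with u0 have w: "AE x in lebesgue. u 0 x = w x" by eventually_elim simp
    show "ess_TVs s (u t) UNIV \<le> TVs s w UNIV"
    proof (cases "TVs s w UNIV")
      case (real C)
      then show ?thesis
        using borel_entropy_solution.ess_TVs_le_initial[OF sol assms(1,2) D w, of C t] \<open>0 < t\<close> by simp
    qed simp
  qed
qed

end
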